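(* The tropicalization $\mathrm{Trop}(X(L)^\circ)$ is the image of $N_\mathbb{R}\times\mathrm{Trop}(L^\circ)$ in $\mathbb{R}^{\#H}$ under the injective linear map $$\phi:(N\oplus\mathbb{Z}^m)_\mathbb{R}\to\mathbb{R}^{\#H},\qquad v\mapsto(\langle v,u\rangle)_{u\in H}.$$ In particular, $\mathrm{Trop}(X(L)^\circ)$ is the product of a tropical line with a plane of dimension $\mathrm{rank}\,N$.
   Context: $\mathbb{K}$ is an algebraically closed, trivially valued field; $T$ is an algebraic torus with character lattice $M$ and cocharacter lattice $N$. Fix $m\ge1$, a pointed polyhedral cone $\sigma\subset N_\mathbb{Q}$, and $\Delta_0,\dots,\Delta_m$, each either empty or a polyhedron in $N_\mathbb{Q}$ with tailcone $\{v:\Delta_i+v\subseteq\Delta_i\}=\sigma$, with $\sum_i\Delta_i\subsetneq\sigma$. For $u\in\sigma^\vee$, $\Delta_i(u)=\min_{v\in\Delta_i}\langle v,u\rangle$, $\infty$ if $\Delta_i=\emptyset$ (a coefficient $\infty$ allows poles of arbitrary order). Let $e_1,\dots,e_m$ be the standard basis of $\mathbb{Q}^m$, $e_0=-\sum_{i\ge1}e_i$, $C\subset N_\mathbb{Q}\times\mathbb{Q}^m$ the cone generated by $\sigma\times0$ and all $\Delta_i\times e_i$, $A(C)=\mathbb{K}[C^\vee\cap(M\times\mathbb{Z}^m)]$, $X(C)=\mathrm{Spec}\,A(C)$. Let $L\subset\mathbb{P}^m=\mathrm{Proj}\,\mathbb{K}[y_0,\dots,y_m]$ be a line meeting the dense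 torus $(\mathbb{K}^* )^m$ with coordinates $z_i=y_i/y_0$; $L^\circ=L\cap(\mathbb{K}^* )^m$; $Q_i$ the restriction of $V(y_i)$ to $L$; $A(L)=\bigoplus_{u\in\sigma^\vee\cap M}H^0(L,\mathcal{O}(\sum_i\lfloor\Delta_i(u)\rfloor Q_i))\chi^u$, $X(L)=\mathrm{Spec}\,A(L)$. The surjection $A(C)\to A(L)$, $\chi^{(u,v)}\mapsto z^v|_L\,\chi^u$, gives a closed embedding $X(L)\subset X(C)$. Fix a finite generating set $H$ of the semigroup $C^\vee\cap(M\times\mathbb{Z}^m)$, $n=\#H$; the surjection $\mathbb{K}[x_u\mid u\in H]\to A(C)$, $x_u\mapsto\chi^u$, gives closed embeddings $X(L)\subset X(C)\subset\mathbb{A}^n$. Put $X(L)^\circ=X(L)\cap(\mathbb{K}^* )^n$. For a closed subvariety $Z\subset(\mathbb{K}^* )^k$ with ideal $I\subset\mathbb{K}[x_1^{\pm1},\dots,x_k^{\pm1}]$, $\mathrm{Trop}(Z)$ is the set of $w\in\mathbb{R}^k$ such that $\mathrm{In}_w(I)$ contains no monomial, where $\mathrm{In}_w(I)$ is generated by the initial forms $\mathrm{In}_w(f)$ (sum of the terms of $f$ of minimal $w$-weight), $f\in I$. A tropical line is the tropicalization of a line (intersected with the torus), and may be degenerate. *)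

theory Defs
  imports
    "HOL-Analysis.Analysis"
    "HOL-Analysis.Finite_Function_Topology"
    "HOL-Computational_Algebra.Computational_Algebra"
begin

section \<open>Lattices and rational polyhedra\<close>

text \<open>
  The torus $T$ has a rank $r$, and bases identify both $M$ and $N$ with $\mathbb{Z}^r$.  Since $r = 0$ must be
  possible, vectors with $r$ coordinates are finitely supported functions on the naturals that
  vanish outside \<open>{..<r}\<close>.  So \<open>coords r\<close> is $M$ or $N$, $N_\mathbb{Q}$, $N_\mathbb{R}$ when the coefficients
  are integers, rationals, reals.  As $m \ge 1$, the $m$ coordinates of $\mathbb{Z}^m$, $\mathbb{Q}^m$, $\mathbb{R}^m$ are
  indexed by a finite type \<open>'m\<close>; the index set $\{0, \dots, m\}$ is \<open>'m option\<close>, with \<open>None\<close> for $0$.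
\<close>

definition coords :: "nat \<Rightarrow> (nat \<Rightarrow>\<^sub>0 'a::zero) set" where
  "coords r = {v. Poly_Mapping.keys v \<subseteq> {..<r}}"

definition npair :: "(nat \<Rightarrow>\<^sub>0 'a::comm_ring_1) \<Rightarrow> (nat \<Rightarrow>\<^sub>0 int) \<Rightarrow> 'a" where
  "npair v u = (\<Sum>i\<in>Poly_Mapping.keys v. Poly_Mapping.lookup v i * of_int (Poly_Mapping.lookup u i))"

definition zpair :: "'a::comm_ring_1 ^ 'm \<Rightarrow> int ^ 'm \<Rightarrow> 'a" where
  "zpair w v = (\<Sum>i\<in>UNIV. w $ i * of_int (v $ i))"

definition polyhedral_cone :: "nat \<Rightarrow> (nat \<Rightarrow>\<^sub>0 rat) set \<Rightarrow> bool" where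
  "polyhedral_cone r \<sigma> \<longleftrightarrow>
     (\<exists>F. finite F \<and> F \<subseteq> coords r \<and> \<sigma> = {v \<in> coords r. \<forall>u\<in>F. 0 \<le> npair v u})"

definition pointed :: "(nat \<Rightarrow>\<^sub>0 rat) set \<Rightarrow> bool" where
  "pointed \<sigma> \<longleftrightarrow> (\<forall>v. v \<in> \<sigma> \<and> - v \<in> \<sigma> \<longrightarrow> v = 0)"

definition rat_polyhedron :: "nat \<Rightarrow> (nat \<Rightarrow>\<^sub>0 rat) set \<Rightarrow> bool" where
  "rat_polyhedron r \<Delta> \<longleftrightarrow>
     (\<exists>F :: ((nat \<Rightarrow>\<^sub>0 int) \<times> rat) set. finite F \<and> F \<subseteq> coords r \<times> UNIV \<and>
        \<Delta> = {v \<in> coords r. \<forall>(u, c)\<in>F. c \<le> npair v u})"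

definition tailcone :: "nat \<Rightarrow> (nat \<Rightarrow>\<^sub>0 rat) set \<Rightarrow> (nat \<Rightarrow>\<^sub>0 rat) set" where
  "tailcone r \<Delta> = {v \<in> coords r. \<forall>x\<in>\<Delta>. x + v \<in> \<Delta>}"

definition minkowski_sum :: "('i::finite \<Rightarrow> 'a::comm_monoid_add set) \<Rightarrow> 'a set" where
  "minkowski_sum \<Delta> = {\<Sum>i\<in>UNIV. d i | d. \<forall>i. d i \<in> \<Delta> i}"

definition dual_lattice_cone :: "nat \<Rightarrow> (nat \<Rightarrow>\<^sub>0 rat) set \<Rightarrow> (nat \<Rightarrow>\<^sub>0 int) set" where
  \<comment> \<open>$\sigma^\vee \cap M$\<close>
  "dual_lattice_cone r \<sigma> = {u \<in> coords r. \<forall>v\<in>\<sigma>. 0 \<le> npair v u}"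

definition floor_eval :: "(nat \<Rightarrow>\<^sub>0 rat) set \<Rightarrow> (nat \<Rightarrow>\<^sub>0 int) \<Rightarrow> ereal" where
  \<comment> \<open>$\lfloor\Delta(u)\rfloor$ with $\Delta(u) = \min_{v \in \Delta} \langle v, u \rangle$\<close>
  "floor_eval \<Delta> u =
     (if \<Delta> = {} then \<infinity> else ereal (of_int \<lfloor>LEAST x. x \<in> (\<lambda>v. npair v u) ` \<Delta>\<rfloor>))"

fun e_vec :: "'m option \<Rightarrow> 'a::comm_ring_1 ^ 'm" where
  "e_vec (Some i) = axis i 1"
| "e_vec None = - (\<Sum>i\<in>UNIV. axis i 1)"

definition rat_cone :: "((nat \<Rightarrow>\<^sub>0 rat) \<times> (rat ^ 'm)) set \<Rightarrow> bool" where
  "rat_cone S \<longleftrightarrow> 0 \<in> S \<and> (\<forall>x\<in>S. \<forall>y\<in>S. x + y \<in> S) \<and>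
     (\<forall>c\<ge>0. \<forall>(a, b)\<in>S. (Poly_Mapping.map ((*) c) a, c *s b) \<in> S)"

definition cone_C ::
  "(nat \<Rightarrow>\<^sub>0 rat) set \<Rightarrow> ('m option \<Rightarrow> (nat \<Rightarrow>\<^sub>0 rat) set) \<Rightarrow> ((nat \<Rightarrow>\<^sub>0 rat) \<times> (rat ^ 'm)) set" where
  "cone_C \<sigma> \<Delta> = rat_cone hull (\<sigma> \<times> {0} \<union> (\<Union>i. \<Delta> i \<times> {e_vec i}))"

definition weight_semigroup ::
  "nat \<Rightarrow> ((nat \<Rightarrow>\<^sub>0 rat) \<times> (rat ^ 'm)) set \<Rightarrow> ((nat \<Rightarrow>\<^sub>0 int) \<times> (int ^ 'm)) set" where
  \<comment> \<open>$C^\vee \cap (M \times \mathbb{Z}^m)$\<close>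
  "weight_semigroup r C =
     {(u, v). u \<in> coords r \<and> (\<forall>(a, b)\<in>C. 0 \<le> npair a u + zpair b v)}"

definition submonoid :: "'a::monoid_add set \<Rightarrow> bool" where
  "submonoid S \<longleftrightarrow> 0 \<in> S \<and> (\<forall>x\<in>S. \<forall>y\<in>S. x + y \<in> S)"


section \<open>Tropicalization over a trivially valued field\<close>

text \<open>
  The Laurent polynomial ring in the variables $x_i$, \<open>i :: 'i\<close>, is the group algebra
  \<open>(int ^ 'i) \<Rightarrow>\<^sub>0 'k\<close>; its product is convolution.
\<close>

type_synonym ('k, 'i) laurent = "(int ^ 'i) \<Rightarrow>\<^sub>0 'k"

definition laurent_eval :: "('k::field, 'i::finite) laurent \<Rightarrow> 'k ^ 'i \<Rightarrow> 'k" where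
  "laurent_eval f x =
     (\<Sum>a\<in>Poly_Mapping.keys f. Poly_Mapping.lookup f a * (\<Prod>i\<in>UNIV. (x $ i) powi (a $ i)))"

definition torus :: "('k::field ^ 'i) set" where
  "torus = {x. \<forall>i. x $ i \<noteq> 0}"

definition vanishing_ideal :: "('k::field ^ 'i::finite) set \<Rightarrow> ('k, 'i) laurent set" where
  "vanishing_ideal Z = {f. \<forall>x\<in>Z. laurent_eval f x = 0}"

definition initial_form ::
  "real ^ 'i \<Rightarrow> ('k::field, 'i::finite) laurent \<Rightarrow> ('k, 'i) laurent" where
  "initial_form w f =
     (\<Sum>a\<in>{a \<in> Poly_Mapping.keys f. \<forall>b\<in>Poly_Mapping.keys f. zpair w a \<le> zpair w b}.
        Poly_Mapping.single a (Poly_Mapping.lookup f a))"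

definition ring_ideal :: "'a::comm_ring_1 set \<Rightarrow> bool" where
  "ring_ideal J \<longleftrightarrow> 0 \<in> J \<and> (\<forall>f\<in>J. \<forall>g\<in>J. f + g \<in> J) \<and> (\<forall>f\<in>J. \<forall>g. g * f \<in> J)"

definition initial_ideal ::
  "real ^ 'i \<Rightarrow> ('k::field, 'i::finite) laurent set \<Rightarrow> ('k, 'i) laurent set" where
  "initial_ideal w I = ring_ideal hull (initial_form w ` I)"

text \<open>
  A closed subvariety \<open>Z\<close> of the torus is given by its set of points over the algebraically closed
  base field, and its ideal is the ideal of Laurent polynomials vanishing on \<open>Z\<close>.
\<close>

definition Trop :: "('k::field ^ 'i::finite) set \<Rightarrow> (real ^ 'i) set" where
  "Trop Z = {w. \<forall>a. Poly_Mapping.single a 1 \<notin> initial_ideal w (vanishing_ideal Z)}"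


section \<open>Lines in projective space\<close>

text \<open>
  A line \<open>L\<close> in $\mathbb{P}^m$ is represented by the two-dimensional linear subspace \<open>W\<close> of $\mathbb{K}^{m+1}$ over it.
\<close>

definition proj_line :: "('k::field ^ 'n) set \<Rightarrow> bool" where
  "proj_line W \<longleftrightarrow> vec.subspace W \<and> vec.dim W = 2"

definition meets_torus :: "('k::field ^ 'n) set \<Rightarrow> bool" where
  "meets_torus W \<longleftrightarrow> (\<exists>y\<in>W. \<forall>i. y $ i \<noteq> 0)"

definition line_torus_part :: "('k::field ^ ('m::finite option)) set \<Rightarrow> ('k ^ 'm) set" where
  \<comment> \<open>$L^\circ$, in the coordinates $z_i = y_i / y_0$\<close>
  "line_torus_part W = {(\<chi> i. y $ Some i / y $ None) | y. y \<in> W \<and> (\<forall>i. y $ i \<noteq> 0)}"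

definition tropical_line :: "'k::field itself \<Rightarrow> (real ^ 'm::finite) set \<Rightarrow> bool" where
  "tropical_line _ \<Gamma> \<longleftrightarrow> (\<exists>W :: ('k ^ ('m option)) set.
     proj_line W \<and> meets_torus W \<and> \<Gamma> = Trop (line_torus_part W))"

text \<open>
  A basis \<open>p, q\<close> of \<open>W\<close> parametrizes \<open>L\<close>: the point \<open>Some t\<close> is $[p + t q]$ and \<open>None\<close> is $[q]$.
  In the function field $\mathbb{K}(L) = \mathbb{K}(t)$ the coordinate $y_i$ becomes the linear polynomial
  $p_i + q_i t$, as a section of $\mathcal{O}(1)$ trivialized away from \<open>None\<close>.
\<close>

fun ord_poly :: "'k::field option \<Rightarrow> 'k poly \<Rightarrow> int" where
  "ord_poly (Some a) f = int (order a f)"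
| "ord_poly None f = - int (degree f)"

definition ord_at :: "'k::field option \<Rightarrow> 'k poly fract \<Rightarrow> int" where
  "ord_at P f =
     (THE n. \<exists>a b. a \<noteq> 0 \<and> b \<noteq> 0 \<and> f = Fract a b \<and> n = ord_poly P a - ord_poly P b)"

lemma ord_poly_mult: "a \<noteq> 0 \<Longrightarrow> b \<noteq> 0 \<Longrightarrow> ord_poly P (a * b) = ord_poly P a + ord_poly P b"
  by (cases P) (simp_all add: order_mult degree_mult_eq)

lemma ord_at_Fract:
  assumes "a \<noteq> 0" "b \<noteq> 0"
  shows "ord_at P (Fract a b) = ord_poly P a - ord_poly P b"
  unfolding ord_at_def
proof (rule the_equality)
  fix n
  assume "\<exists>c d. c \<noteq> 0 \<and> d \<noteq> 0 \<and> Fract a b = Fract c d \<and> n = ord_poly P c - ord_poly P d"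
  then obtain c d where cd: "c \<noteq> 0" "d \<noteq> 0" "Fract a b = Fract c d"
    and n: "n = ord_poly P c - ord_poly P d" by blast
  have "a * d = c * b" using cd assms by (simp add: eq_fract)
  then have "ord_poly P a + ord_poly P d = ord_poly P c + ord_poly P b"
    using cd assms by (metis ord_poly_mult)
  then show "n = ord_poly P a - ord_poly P b" using n by simp
qed (use assms in blast)

definition y_on_L :: "'k::field ^ 'n \<Rightarrow> 'k ^ 'n \<Rightarrow> 'n \<Rightarrow> 'k poly" where
  "y_on_L p q i = [:p $ i, q $ i:]"

definition Q_pt :: "'k::field ^ 'n \<Rightarrow> 'k ^ 'n \<Rightarrow> 'n \<Rightarrow> 'k option" where
  \<comment> \<open>$V(y_i) \cap L$: a single reduced point whenever $y_i$ does not vanish identically on $L$\<close>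
  "Q_pt p q i = (if q $ i = 0 then None else Some (- p $ i / q $ i))"

definition z_monomial ::
  "'k::field ^ ('m::finite option) \<Rightarrow> 'k ^ ('m option) \<Rightarrow> int ^ 'm \<Rightarrow> 'k poly fract" where
  "z_monomial p q v =
     (\<Prod>i\<in>UNIV. Fract (y_on_L p q (Some i)) (y_on_L p q None) powi (v $ i))"

text \<open>
  Divisors may have coefficients \<open>\<infinity>\<close>, hence values in \<open>ereal\<close>; the points $Q_i$ need not be distinct.
\<close>

definition divisor_at ::
  "'k::field ^ ('m::finite option) \<Rightarrow> 'k ^ ('m option) \<Rightarrow> ('m option \<Rightarrow> (nat \<Rightarrow>\<^sub>0 rat) set) \<Rightarrow>
     (nat \<Rightarrow>\<^sub>0 int) \<Rightarrow> 'k option \<Rightarrow> ereal" where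
  \<comment> \<open>$\sum_i \lfloor\Delta_i(u)\rfloor Q_i$\<close>
  "divisor_at p q \<Delta> u P = (\<Sum>i\<in>{i. Q_pt p q i = P}. floor_eval (\<Delta> i) u)"

definition H0 :: "('k::field option \<Rightarrow> ereal) \<Rightarrow> 'k poly fract set" where
  "H0 D = {f. f = 0 \<or> (\<forall>P. 0 \<le> ereal (of_int (ord_at P f)) + D P)}"


section \<open>The variety $X(L)$ and its embedding\<close>

definition ring_AL ::
  "nat \<Rightarrow> (nat \<Rightarrow>\<^sub>0 rat) set \<Rightarrow> ('m::finite option \<Rightarrow> (nat \<Rightarrow>\<^sub>0 rat) set) \<Rightarrow>
     'k::field ^ ('m option) \<Rightarrow> 'k ^ ('m option) \<Rightarrow> ((nat \<Rightarrow>\<^sub>0 int) \<Rightarrow>\<^sub>0 'k poly fract) set" where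
  \<comment> \<open>$A(L)$, as a subring of the group algebra $\mathbb{K}(L)[M]$\<close>
  "ring_AL r \<sigma> \<Delta> p q = {F. \<forall>u\<in>Poly_Mapping.keys F.
     u \<in> dual_lattice_cone r \<sigma> \<and> Poly_Mapping.lookup F u \<in> H0 (divisor_at p q \<Delta> u)}"

definition algebra_point ::
  "((nat \<Rightarrow>\<^sub>0 int) \<Rightarrow>\<^sub>0 'k poly fract) set \<Rightarrow>
     (((nat \<Rightarrow>\<^sub>0 int) \<Rightarrow>\<^sub>0 'k::field poly fract) \<Rightarrow> 'k) \<Rightarrow> bool" where
  \<comment> \<open>a closed point of the spectrum of \<open>A\<close>: a homomorphism of algebras from \<open>A\<close> to the base field\<close>
  "algebra_point A \<xi> \<longleftrightarrow>
     (\<forall>F\<in>A. \<forall>G\<in>A. \<xi> (F + G) = \<xi> F + \<xi> G \<and> \<xi> (F * G) = \<xi> F * \<xi> G) \<and>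
     (\<forall>c. \<xi> (Poly_Mapping.single 0 (Fract [:c:] 1)) = c)"

definition X_L ::
  "nat \<Rightarrow> (nat \<Rightarrow>\<^sub>0 rat) set \<Rightarrow> ('m::finite option \<Rightarrow> (nat \<Rightarrow>\<^sub>0 rat) set) \<Rightarrow>
     'k::field ^ ('m option) \<Rightarrow> 'k ^ ('m option) \<Rightarrow>
     ('h::finite \<Rightarrow> (nat \<Rightarrow>\<^sub>0 int) \<times> (int ^ 'm)) \<Rightarrow> ('k ^ 'h) set" where
  \<comment> \<open>The image of $X(L)$ in $\mathbb{A}^n$ under $x_{(u,v)} \mapsto \chi^{(u,v)} \mapsto z^v|_L\,\chi^u$, where
     the enumeration \<open>H\<close> of the generating set indexes the coordinates.\<close>
  "X_L r \<sigma> \<Delta> p q H =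
     {(\<chi> j. \<xi> (Poly_Mapping.single (fst (H j)) (z_monomial p q (snd (H j))))) | \<xi>.
        algebra_point (ring_AL r \<sigma> \<Delta> p q) \<xi>}"

definition phi ::
  "('h::finite \<Rightarrow> (nat \<Rightarrow>\<^sub>0 int) \<times> (int ^ 'm::finite)) \<Rightarrow> (nat \<Rightarrow>\<^sub>0 real) \<times> (real ^ 'm) \<Rightarrow> real ^ 'h" where
  "phi H x = (\<chi> j. npair (fst x) (fst (H j)) + zpair (snd x) (snd (H j)))"

end

theory Submission
  imports Defs
begin

text \<open>
  Inside the torus, \<open>X(L)\<close> is the product \<open>T \<times> L\<^sup>\<circ>\<close>.  A point of \<open>X(L)\<close> with nonzero coordinates is a
  homomorphism \<open>\<xi>\<close> from \<open>A(L)\<close> to the base field that does not vanish on the monomials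
  \<open>\<chi>\<^sup>u z\<^sup>v\<close> with \<open>(u, v)\<close> in the weight semigroup of the cone \<open>C\<close>.  As this semigroup generates
  \<open>M \<times> \<int>\<^sup>m\<close> as a group, \<open>\<xi>\<close> extends to a character of the whole lattice, that is, to a pair
  \<open>(t, z)\<close> of torus points.  A linear relation among the coordinates of \<open>L\<close> holds in \<open>A(L)\<close> after it
  has been multiplied with a suitable monomial, and applying \<open>\<xi>\<close> shows that \<open>z\<close> satisfies it too, so
  \<open>z\<close> lies on \<open>L\<close>.  Conversely, \<open>A(L)\<close> can be evaluated at every \<open>(t, z)\<close> with \<open>z\<close> in \<open>L\<^sup>\<circ>\<close>,
  since the divisors that allow poles are supported in the points \<open>Q\<^sub>i\<close> outside \<open>L\<^sup>\<circ>\<close>.  Hence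
  \<open>X(L)\<^sup>\<circ>\<close> is the image of \<open>T \<times> L\<^sup>\<circ>\<close> under the monomial map with exponents \<open>H\<close>
  (\<open>X_L_torus\<close>).

  That the semigroup generates the lattice (\<open>weight_semigroup_generates\<close>) is where the
  polyhedra enter.  Being a proper subset of \<open>\<sigma>\<close>, the Minkowski sum of the \<open>\<Delta>\<^sub>i\<close> does
  not contain \<open>0\<close>, so by the lemma of Farkas some \<open>u\<close> has lower bounds on the \<open>\<Delta>\<^sub>i\<close> with positive sum
  (\<open>separating_character\<close>).  Adding a large multiple of this \<open>u\<close> makes room for any prescribed
  lattice vector.

  Tropicalization is compatible with such a monomial map (\<open>Trop_monomial_image\<close>).  A weight in
  \<open>Trop\<close> lies in the image of \<open>\<phi>\<close> because the binomials \<open>x\<^sup>a - 1\<close>, with \<open>a\<close> a relation among the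
  exponents, vanish on \<open>X(L)\<^sup>\<circ>\<close>.  For the weight \<open>w = \<phi>(n, w')\<close>, monomials in the initial ideals of
  \<open>X(L)\<^sup>\<circ>\<close> at \<open>w\<close> and of \<open>L\<^sup>\<circ>\<close> at \<open>w'\<close> produce each other.  From \<open>L\<^sup>\<circ>\<close> to \<open>X(L)\<^sup>\<circ>\<close> one
  substitutes monomials along a section of the exponent map, which commutes with taking initial forms.
  From \<open>X(L)\<^sup>\<circ>\<close> to \<open>L\<^sup>\<circ>\<close> one decomposes a Laurent polynomial by its degree in \<open>M\<close>: each slice vanishes
  on \<open>L\<^sup>\<circ>\<close> since distinct characters of \<open>T\<close> are linearly independent, and a slice of an initial form
  is either zero or the initial form of the slice.
\<close>

section \<open>Lattice vectors and pairings\<close>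

lemma npair_add_left: "npair (v + v') u = npair v u + npair v' u"
  unfolding npair_def
  by (rule setsum_keys_plus_distrib[where f = "\<lambda>k c. c * of_int (Poly_Mapping.lookup u k)"])
    (simp_all add: distrib_right)

lemma npair_add_right: "npair v (u + u') = npair v u + npair v u'"
  by (simp add: npair_def lookup_add distrib_left sum.distrib)

lemma npair_zero [simp]: "npair 0 u = 0" "npair v 0 = 0"
  by (simp_all add: npair_def)

lemma npair_minus_left [simp]: "npair (- v) u = - npair v u"
  by (metis add.left_inverse add_eq_0_iff npair_add_left npair_zero(1))

lemma npair_sum_right: "npair v (\<Sum>i\<in>I. u i) = (\<Sum>i\<in>I. npair v (u i))"
  by (induction I rule: infinite_finite_induct) (simp_all add: npair_add_right)

lemma lookup_scale [simp]:
  fixes c :: "'a::semiring_0"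
  shows "Poly_Mapping.lookup (Poly_Mapping.map ((*) c) v) i = c * Poly_Mapping.lookup v i"
  by (simp add: Poly_Mapping.map.rep_eq when_def)

lemma npair_scale_left: "npair (Poly_Mapping.map ((*) c) v) u = c * npair v u"
proof -
  have "npair (Poly_Mapping.map ((*) c) v) u =
      (\<Sum>i\<in>Poly_Mapping.keys v. c * Poly_Mapping.lookup v i * of_int (Poly_Mapping.lookup u i))"
    unfolding npair_def lookup_scale
    by (rule sum.mono_neutral_left) (auto simp: in_keys_iff)
  then show ?thesis
    by (simp add: npair_def sum_distrib_left mult.assoc)
qed

lemma npair_scale_right: "npair v (Poly_Mapping.map ((*) c) u) = of_int c * npair v u"
  by (simp add: npair_def sum_distrib_left mult.left_commute)

lemma npair_coords:
  assumes "v \<in> coords r"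
  shows "npair v u = (\<Sum>i<r. Poly_Mapping.lookup v i * of_int (Poly_Mapping.lookup u i))"
  unfolding npair_def
  by (rule sum.mono_neutral_left) (use assms in \<open>auto simp: coords_def in_keys_iff\<close>)

lemma coords_iff: "v \<in> coords r \<longleftrightarrow> (\<forall>i\<ge>r. Poly_Mapping.lookup v i = 0)"
proof -
  have "Poly_Mapping.keys v \<subseteq> {..<r} \<longleftrightarrow> (\<forall>i. r \<le> i \<longrightarrow> i \<notin> Poly_Mapping.keys v)"
    by (metis lessThan_iff not_le subset_eq)
  then show ?thesis by (simp add: coords_def in_keys_iff)
qed

lemma coords_closed [simp, intro]:
  "0 \<in> coords r"
  "v \<in> coords r \<Longrightarrow> w \<in> coords r \<Longrightarrow> v + w \<in> coords r"
  by (simp_all add: coords_iff lookup_add)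

lemma coords_group [simp, intro]:
  fixes v w :: "nat \<Rightarrow>\<^sub>0 'a::ab_group_add"
  shows "v \<in> coords r \<Longrightarrow> - v \<in> coords r" "v \<in> coords r \<Longrightarrow> w \<in> coords r \<Longrightarrow> v - w \<in> coords r"
  by (simp_all add: coords_iff lookup_minus)

lemma coords_scale [simp, intro]:
  fixes v :: "nat \<Rightarrow>\<^sub>0 'a::semiring_0"
  shows "v \<in> coords r \<Longrightarrow> Poly_Mapping.map ((*) c) v \<in> coords r"
  by (simp add: coords_iff)

lemma coords_sum [intro]: "(\<And>i. i \<in> I \<Longrightarrow> v i \<in> coords r) \<Longrightarrow> (\<Sum>i\<in>I. v i) \<in> coords r"
  by (induction I rule: infinite_finite_induct) auto

lemma poly_mapping_expansion:
  "f = (\<Sum>a\<in>Poly_Mapping.keys f. Poly_Mapping.single a (Poly_Mapping.lookup f a))"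
  by (rule poly_mapping_eqI) (simp add: lookup_sum lookup_single when_def in_keys_iff)

lemma coords_single: "i < r \<Longrightarrow> Poly_Mapping.single i c \<in> coords r"
  by (simp add: coords_def)

lemma coords_expansion:
  assumes "v \<in> coords r"
  shows "v = (\<Sum>i<r. Poly_Mapping.single i (Poly_Mapping.lookup v i))"
proof (rule poly_mapping_eqI)
  fix k
  show "Poly_Mapping.lookup v k =
      Poly_Mapping.lookup (\<Sum>i<r. Poly_Mapping.single i (Poly_Mapping.lookup v i)) k"
    using assms by (auto simp: lookup_sum lookup_single when_def coords_iff)
qed

lemma npair_single_left: "npair (Poly_Mapping.single i c) u = c * of_int (Poly_Mapping.lookup u i)"
  by (cases "c = 0") (simp_all add: npair_def)

lemma npair_single_right: "npair v (Poly_Mapping.single i c) = Poly_Mapping.lookup v i * of_int c"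
  by (simp add: npair_def lookup_single when_def if_distrib[of of_int] if_distrib[of "(*) _"]
      sum.delta in_keys_iff cong: if_cong)

lemma zpair_zero [simp]: "zpair 0 v = 0" "zpair w 0 = 0"
  by (simp_all add: zpair_def)

lemma zpair_add_left: "zpair (w + w') v = zpair w v + zpair w' v"
  by (simp add: zpair_def distrib_right sum.distrib)

lemma zpair_add_right: "zpair w (v + v') = zpair w v + zpair w v'"
  by (simp add: zpair_def distrib_left sum.distrib)

lemma zpair_minus_right [simp]: "zpair w (- v) = - zpair w v"
  by (simp add: zpair_def sum_negf)

lemma zpair_minus_left [simp]: "zpair (- w) v = - zpair w v"
  by (simp add: zpair_def sum_negf)

lemma zpair_sum_left: "zpair (\<Sum>i\<in>I. w i) v = (\<Sum>i\<in>I. zpair (w i) v)"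
  by (induction I rule: infinite_finite_induct) (simp_all add: zpair_add_left)

lemma zpair_sum_right: "zpair w (\<Sum>i\<in>I. v i) = (\<Sum>i\<in>I. zpair w (v i))"
  by (induction I rule: infinite_finite_induct) (simp_all add: zpair_add_right)

lemma zpair_scale_left: "zpair (c *s w) v = c * zpair w v"
  by (simp add: zpair_def sum_distrib_left mult.assoc)

lemma zpair_scale_right: "zpair w (c *s v) = of_int c * zpair w v"
  by (simp add: zpair_def sum_distrib_left mult.left_commute)

lemma zpair_axis_left: "zpair (axis i c) v = c * of_int (v $ i)"
  by (simp add: zpair_def axis_def if_distrib[of "\<lambda>x. x * _"] cong: if_cong)

lemma zpair_axis_right: "zpair w (axis i c) = w $ i * of_int c"
  by (simp add: zpair_def axis_def if_distrib[of of_int] if_distrib[of "(*) _"] cong: if_cong)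

lemma zpair_e_vec:
  "zpair (e_vec (Some i)) v = of_int (v $ i)"
  "zpair (e_vec None) v = - (\<Sum>i\<in>UNIV. of_int (v $ i))"
  by (simp_all add: zpair_axis_left zpair_sum_left)

section \<open>Linear inequalities over an ordered field\<close>

text \<open>
  Bartl's induction on the number of constraints.  If \<open>g\<close> is not already controlled by the constraints
  other than \<open>f j\<close>, there is a \<open>z\<close> that satisfies those but has \<open>g z < 0\<close>, hence \<open>f j z < 0\<close>.  Projecting
  along \<open>z\<close> onto the kernel of \<open>f j\<close> reduces to the other constraints, and the multiplier of \<open>f j\<close> that
  undoes the projection comes out nonnegative.  The argument only forms combinations \<open>x + c y\<close>, so \<open>V\<close>
  can be any set closed under them: \<open>coords r\<close> as well as a space of tuples with prescribed sum.
\<close>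

lemma farkas:
  fixes scale :: "'a::linordered_field \<Rightarrow> 'v::plus \<Rightarrow> 'v" and f :: "'k \<Rightarrow> 'v \<Rightarrow> 'a"
  assumes "finite K"
    and V: "\<And>c x y. x \<in> V \<Longrightarrow> y \<in> V \<Longrightarrow> x + scale c y \<in> V"
    and f: "\<And>k c x y. k \<in> K \<Longrightarrow> x \<in> V \<Longrightarrow> y \<in> V \<Longrightarrow> f k (x + scale c y) = f k x + c * f k y"
    and g: "\<And>c x y. x \<in> V \<Longrightarrow> y \<in> V \<Longrightarrow> g (x + scale c y) = g x + c * g y"
    and nonneg: "\<And>x. x \<in> V \<Longrightarrow> \<forall>k\<in>K. 0 \<le> f k x \<Longrightarrow> 0 \<le> g x"
  shows "\<exists>l. (\<forall>k\<in>K. 0 \<le> l k) \<and> (\<forall>x\<in>V. g x = (\<Sum>k\<in>K. l k * f k x))"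
  using assms(1) f g nonneg
proof (induction K arbitrary: f g rule: finite_induct)
  case empty
  have "g x = 0" if x: "x \<in> V" for x
  proof -
    have "0 \<le> g x" "0 \<le> g (x + scale (- 2) x)"
      using x V empty(3) by auto
    then show ?thesis using empty(2)[OF x x, of "- 2"] by simp
  qed
  then show ?case by simp
next
  case (insert j K)
  show ?case
  proof (cases "\<forall>x\<in>V. (\<forall>k\<in>K. 0 \<le> f k x) \<longrightarrow> 0 \<le> g x")
    case True
    then obtain l where l: "\<forall>k\<in>K. 0 \<le> l k" "\<forall>x\<in>V. g x = (\<Sum>k\<in>K. l k * f k x)"
      using insert.IH[of f g] insert.prems by auto
    have "(\<Sum>k\<in>insert j K. (l(j := 0)) k * f k x) = (\<Sum>k\<in>K. l k * f k x)" for x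
    proof -
      have "(\<Sum>k\<in>K. (l(j := 0)) k * f k x) = (\<Sum>k\<in>K. l k * f k x)"
        using insert.hyps by (intro sum.cong) auto
      then show ?thesis using insert.hyps by simp
    qed
    then show ?thesis
      using l by (intro exI[of _ "l(j := 0)"]) auto
  next
    case False
    then obtain z where z: "z \<in> V" "\<And>k. k \<in> K \<Longrightarrow> 0 \<le> f k z" "g z < 0" by force
    have a: "f j z < 0"
      using insert.prems(3)[of z] z by force
    define shift where "shift x = x + scale (- f j x / f j z) z" for x
    have shift: "shift x \<in> V" "f j (shift x) = 0" if "x \<in> V" for x
      using that z a V insert.prems(1)[of j x z "- f j x / f j z"] by (simp_all add: shift_def)
    define f' where "f' k x = f k x - f k z / f j z * f j x" for k x
    define g' where "g' x = g x - g z / f j z * f j x" for x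
    have f': "f' k x = f k (shift x)" if "x \<in> V" "k \<in> K" for k x
      using that z insert.prems(1)[of k x z "- f j x / f j z"] by (simp add: shift_def f'_def)
    have g': "g' x = g (shift x)" if "x \<in> V" for x
      using that z insert.prems(2)[of x z "- f j x / f j z"] by (simp add: shift_def g'_def)
    have "\<exists>l. (\<forall>k\<in>K. 0 \<le> l k) \<and> (\<forall>x\<in>V. g' x = (\<Sum>k\<in>K. l k * f' k x))"
    proof (rule insert.IH)
      fix x assume x: "x \<in> V" and "\<forall>k\<in>K. 0 \<le> f' k x"
      then have "\<forall>k\<in>insert j K. 0 \<le> f k (shift x)" using f' shift by auto
      then show "0 \<le> g' x" using insert.prems(3)[OF shift(1)[OF x]] g'[OF x] by simp
    qed (use insert.prems in \<open>auto simp: f'_def g'_def algebra_simps\<close>)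
    then obtain l where l: "\<forall>k\<in>K. 0 \<le> l k" "\<forall>x\<in>V. g' x = (\<Sum>k\<in>K. l k * f' k x)" by blast
    define m where "m = (g z - (\<Sum>k\<in>K. l k * f k z)) / f j z"
    have "0 \<le> (\<Sum>k\<in>K. l k * f k z)" using l z by (intro sum_nonneg) auto
    then have m: "0 \<le> m" using a z by (simp add: m_def zero_le_divide_iff)
    have "g x = (\<Sum>k\<in>insert j K. (l(j := m)) k * f k x)" if x: "x \<in> V" for x
    proof -
      have "(\<Sum>k\<in>K. l k * f' k x)
          = (\<Sum>k\<in>K. l k * f k x) - (\<Sum>k\<in>K. l k * f k z) / f j z * f j x"
        by (simp add: f'_def right_diff_distrib sum_subtractf sum_distrib_right sum_divide_distrib
            mult.assoc)
      moreover have "g' x = (\<Sum>k\<in>K. l k * f' k x)" using l x by blast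
      ultimately have "g x = (\<Sum>k\<in>K. l k * f k x) + m * f j x"
        unfolding g'_def m_def by (simp add: diff_divide_distrib algebra_simps)
      moreover have "(\<Sum>k\<in>K. (l(j := m)) k * f k x) = (\<Sum>k\<in>K. l k * f k x)"
        using insert.hyps by (intro sum.cong) auto
      ultimately show ?thesis using insert.hyps by simp
    qed
    then show ?thesis
      using l m by (intro exI[of _ "l(j := m)"]) auto
  qed
qed

text \<open>
  The idea is to move towards more tight constraints.  Unless \<open>g\<close> is constant along the face cut out by
  the constraints tight at \<open>x\<close>, there is a direction inside the face in which \<open>g\<close> decreases;
  boundedness of \<open>g\<close> forces a further constraint to become tight on the way.  So every point lies above
  a \<open>good\<close> one, where \<open>g\<close> is determined by the set of tight constraints, and there are only
  finitely many such sets.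
\<close>

lemma linear_minimum_attained:
  fixes scale :: "'a::linordered_field \<Rightarrow> 'v::plus \<Rightarrow> 'v" and f :: "'k \<Rightarrow> 'v \<Rightarrow> 'a"
  assumes "finite K"
    and V: "\<And>c x y. x \<in> V \<Longrightarrow> y \<in> V \<Longrightarrow> x + scale c y \<in> V"
    and f: "\<And>k c x y. k \<in> K \<Longrightarrow> x \<in> V \<Longrightarrow> y \<in> V \<Longrightarrow> f k (x + scale c y) = f k x + c * f k y"
    and g: "\<And>c x y. x \<in> V \<Longrightarrow> y \<in> V \<Longrightarrow> g (x + scale c y) = g x + c * g y"
    and P: "P = {x \<in> V. \<forall>k\<in>K. c k \<le> f k x}" "P \<noteq> {}" and bound: "\<And>x. x \<in> P \<Longrightarrow> b \<le> g x"
  shows "\<exists>x\<in>P. \<forall>y\<in>P. g x \<le> g y"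
proof -
  define tight where "tight x = {k \<in> K. f k x = c k}" for x
  \<comment> \<open>The points at which \<open>g\<close> cannot change without leaving a tight constraint.\<close>
  define good where "good x \<longleftrightarrow> x \<in> P \<and> (\<forall>d\<in>V. (\<forall>k\<in>tight x. f k d = 0) \<longrightarrow> g d = 0)" for x
  have improve: "\<exists>y. good y \<and> g y \<le> g x" if "x \<in> P" for x
    using that
  proof (induction "card (K - tight x)" arbitrary: x rule: less_induct)
    case less
    show ?case
    proof (cases "good x")
      case False
      then obtain d0 where d0: "d0 \<in> V" "\<forall>k\<in>tight x. f k d0 = 0" "g d0 \<noteq> 0"
        using less.prems by (auto simp: good_def)
      obtain d where d: "d \<in> V" "\<forall>k\<in>tight x. f k d = 0" "g d < 0"
      proof (cases "g d0 < 0")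
        case False
        then show ?thesis
          using d0 V[of d0 d0 "- 2"] f[of _ d0 d0 "- 2"] g[of d0 d0 "- 2"]
          by (intro that[of "d0 + scale (- 2) d0"]) (auto simp: tight_def)
      qed (use d0 that in blast)
      have xV: "x \<in> V" using less.prems P by blast
      \<comment> \<open>Moving along \<open>d\<close>, the constraint \<open>k\<close> with \<open>f k d < 0\<close> becomes tight at time \<open>s k\<close>.\<close>
      define N where "N = {k \<in> K. f k d < 0}"
      define s where "s k = (f k x - c k) / (- f k d)" for k
      have "N \<noteq> {}"
      proof
        assume N: "N = {}"
        define t where "t = (g x - b + 1) / (- g d)"
        have "0 \<le> t" unfolding t_def using bound[OF less.prems] d(3) by (intro divide_nonneg_pos) auto
        then have "x + scale t d \<in> P"
          using N less.prems xV d V f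
          by (auto simp: P N_def not_less intro!: add_increasing2)
        then have "b \<le> g x + t * g d" using bound g[OF xV d(1)] by metis
        also have "g x + t * g d = b - 1" using d by (simp add: t_def)
        finally show False by simp
      qed
      then obtain j where j: "j \<in> N" "\<And>k. k \<in> N \<Longrightarrow> s j \<le> s k"
        using ex_is_arg_min_if_finite[of N s] assms(1)
        by (auto simp: N_def is_arg_min_def) (metis (no_types, lifting) not_less)
      have sj: "0 \<le> s j" unfolding s_def using j(1) less.prems by (intro divide_nonneg_pos) (auto simp: N_def P)
      define y where "y = x + scale (s j) d"
      have fy: "f k y = f k x + s j * f k d" if "k \<in> K" for k
        using f[OF that xV d(1)] by (simp add: y_def)
      have "c k \<le> f k y" if k: "k \<in> K" for k
      proof (cases "f k d < 0")
        case True
        then have "s j * - f k d \<le> s k * - f k d" using j k by (intro mult_right_mono) (auto simp: N_def)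
        also have "\<dots> = f k x - c k" using True by (simp add: s_def)
        finally show ?thesis using fy[OF k] by simp
      next
        case False
        then show ?thesis using fy[OF k] sj less.prems k by (simp add: P add_increasing2)
      qed
      then have yP: "y \<in> P" using xV d V by (simp add: P y_def)
      have "j \<in> tight y" "j \<notin> tight x"
        using j fy[of j] d by (auto simp: tight_def N_def s_def)
      moreover have "tight x \<subseteq> tight y" using fy d by (auto simp: tight_def)
      ultimately have "K - tight y \<subset> K - tight x" by (auto simp: tight_def)
      then have "card (K - tight y) < card (K - tight x)"
        using assms(1) by (intro psubset_card_mono) auto
      then obtain y' where "good y'" "g y' \<le> g y" using less.hyps yP by blast
      moreover have "g y \<le> g x"
        using g[OF xV d(1), of "s j"] sj d by (simp add: y_def mult_nonneg_nonpos)
      ultimately show ?thesis by (meson order_trans)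
    qed auto
  qed
  have same: "g x = g y" if "good x" "good y" "tight x = tight y" for x y
  proof -
    have V': "x \<in> V" "y \<in> V" using that P by (auto simp: good_def)
    have "f k (x + scale (- 1) y) = 0" if "k \<in> tight x" for k
    proof -
      have "k \<in> K" "f k x = c k" "f k y = c k"
        using that \<open>tight x = tight y\<close> by (auto simp: tight_def)
      then show ?thesis using f[OF _ V', of k "- 1"] by simp
    qed
    then have "g (x + scale (- 1) y) = 0"
      using that(1) V[OF V', of "- 1"] unfolding good_def by blast
    then show ?thesis using g[OF V', of "- 1"] by simp
  qed
  have "g ` Collect good \<subseteq> (\<lambda>T. g (SOME x. good x \<and> tight x = T)) ` Pow K"
  proof
    fix a assume "a \<in> g ` Collect good"
    then obtain x where x: "good x" "a = g x" by blast
    define z where "z = (SOME y. good y \<and> tight y = tight x)"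
    have "good z \<and> tight z = tight x"
      unfolding z_def by (rule someI[of _ x]) (use x in blast)
    then have "a = g z" using same[OF x(1), of z] x(2) by metis
    moreover have "tight x \<in> Pow K" by (auto simp: tight_def)
    ultimately show "a \<in> (\<lambda>T. g (SOME x. good x \<and> tight x = T)) ` Pow K"
      unfolding z_def by (rule image_eqI)
  qed
  then have fin: "finite (g ` Collect good)"
    using assms(1) finite_subset by blast
  have ne: "g ` Collect good \<noteq> {}" using improve P(2) by blast
  then have "Min (g ` Collect good) \<in> g ` Collect good" using Min_in[OF fin] by blast
  then obtain x where x: "good x" "g x = Min (g ` Collect good)" by auto
  have "g x \<le> g y" if y: "y \<in> P" for y
  proof -
    obtain z where z: "good z" "g z \<le> g y" using improve[OF y] by blast
    then have "g x \<le> g z" unfolding x(2) using fin by (intro Min_le) auto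
    then show ?thesis using z(2) by simp
  qed
  then show ?thesis using x(1) by (auto simp: good_def)
qed

section \<open>The weight semigroup generates the lattice\<close>

lemma common_denominator:
  fixes q :: "'k \<Rightarrow> rat"
  assumes "finite K"
  shows "\<exists>D::int. 0 < D \<and> (\<exists>n. \<forall>k\<in>K. of_int (n k) = of_int D * q k)"
  using assms
proof (induction K rule: finite_induct)
  case empty
  show ?case by (intro exI[of _ 1]) simp
next
  case (insert j K)
  then obtain D n where D: "0 < D" "\<forall>k\<in>K. of_int (n k) = of_int D * q k" by blast
  obtain a b where ab: "quotient_of (q j) = (a, b)" by fastforce
  then have b: "0 < b" "q j = of_int a / of_int b"
    by (simp_all add: quotient_of_denom_pos quotient_of_div)
  have "\<forall>k\<in>insert j K. of_int (((\<lambda>k. b * n k)(j := D * a)) k) = of_int (D * b) * q k"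
    using D b insert.hyps by auto
  moreover have "0 < D * b" using D(1) b(1) by simp
  ultimately show ?case by blast
qed

text \<open>
  Otherwise the values of \<open>u\<close> along the ray \<open>x + n v\<close>, which stays in \<open>D\<close>, would be unbounded below.
\<close>

lemma bounded_imp_nonneg_on_tailcone:
  assumes "x \<in> D" "v \<in> tailcone r D" "\<And>y. y \<in> D \<Longrightarrow> b \<le> npair y u"
  shows "0 \<le> npair v u"
proof (rule ccontr)
  assume "\<not> 0 \<le> npair v u"
  then have neg: "0 < - npair v u" by simp
  have "\<exists>y\<in>D. npair y u = npair x u + of_nat n * npair v u" for n
  proof (induction n)
    case (Suc n)
    then obtain y where "y \<in> D" "npair y u = npair x u + of_nat n * npair v u" by blast
    then show ?case using assms(2)
      by (intro bexI[of _ "y + v"]) (auto simp: tailcone_def npair_add_left algebra_simps)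
  qed (use assms in auto)
  then have *: "b \<le> npair x u + of_nat n * npair v u" for n
    using assms(3) by metis
  obtain n where "npair x u - b < of_nat n * - npair v u"
    using ex_less_of_nat_mult[OF neg] by blast
  then show False using *[of n] by simp
qed

text \<open>
  The directions on which all constraints of \<open>D\<close> are nonnegative lie in the tailcone, where \<open>u\<close> is
  nonnegative.  By Farkas \<open>u\<close> is a nonnegative combination of the constraints, and the same
  combination of their right-hand sides is a lower bound.
\<close>

lemma dual_bounded_below:
  assumes D: "rat_polyhedron r D" "tailcone r D = \<sigma>" and u: "u \<in> dual_lattice_cone r \<sigma>"
  shows "\<exists>d::int. \<forall>x\<in>D. of_int d \<le> npair x u"
proof (cases "D = {}")
  case False
  then obtain x0 where x0: "x0 \<in> D" by blast
  obtain F :: "((nat \<Rightarrow>\<^sub>0 int) \<times> rat) set" where F: "finite F"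
    "D = {v \<in> coords r. \<forall>(u, c)\<in>F. c \<le> npair v u}"
    using D unfolding rat_polyhedron_def by blast
  have "\<exists>l. (\<forall>k\<in>F. 0 \<le> l k) \<and> (\<forall>x\<in>coords r. npair x u = (\<Sum>k\<in>F. l k * npair (x :: nat \<Rightarrow>\<^sub>0 rat) (fst k)))"
  proof (rule farkas[where scale = "\<lambda>c (v :: nat \<Rightarrow>\<^sub>0 rat). Poly_Mapping.map ((*) c) v"])
    fix v :: "nat \<Rightarrow>\<^sub>0 rat"
    assume v: "v \<in> coords r" "\<forall>k\<in>F. 0 \<le> npair v (fst k)"
    have "x + v \<in> D" if "x \<in> D" for x
    proof -
      have "c \<le> npair (x + v) a" if "(a, c) \<in> F" for a c
      proof -
        have "c \<le> npair x a" using \<open>x \<in> D\<close> that F(2) by blast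
        moreover have "0 \<le> npair v a" using v(2) that by force
        ultimately show ?thesis by (simp add: npair_add_left)
      qed
      then show ?thesis using that v(1) unfolding F(2) by auto
    qed
    then have "v \<in> tailcone r D" using v(1) by (simp add: tailcone_def)
    then have "v \<in> \<sigma>" using D(2) by simp
    then show "0 \<le> npair v u" using u by (auto simp: dual_lattice_cone_def)
  qed (use F(1) in \<open>auto simp: npair_add_left npair_scale_left\<close>)
  then obtain l where l: "\<forall>k\<in>F. 0 \<le> l k"
    "\<forall>x\<in>coords r. npair x u = (\<Sum>k\<in>F. l k * npair (x :: nat \<Rightarrow>\<^sub>0 rat) (fst k))"
    by (elim exE conjE)
  have "of_int \<lfloor>\<Sum>k\<in>F. l k * snd k\<rfloor> \<le> npair x u" if x: "x \<in> D" for x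
  proof -
    have "(\<Sum>k\<in>F. l k * snd k) \<le> (\<Sum>k\<in>F. l k * npair x (fst k))"
      using l x F(2) by (intro sum_mono mult_left_mono) auto
    also have "\<dots> = npair x u" using l x F(2) by simp
    finally show ?thesis using of_int_floor_le order_trans by blast
  qed
  then show ?thesis by blast
qed auto

lemma rat_polyhedron_minimum_attained:
  assumes D: "rat_polyhedron r D" "D \<noteq> {}" and b: "\<And>x. x \<in> D \<Longrightarrow> b \<le> npair x u"
  shows "\<exists>x\<in>D. \<forall>y\<in>D. npair x u \<le> npair y u"
proof -
  obtain F :: "((nat \<Rightarrow>\<^sub>0 int) \<times> rat) set" where F: "finite F"
    "D = {v \<in> coords r. \<forall>(u, c)\<in>F. c \<le> npair v u}"
    using D(1) unfolding rat_polyhedron_def by blast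
  show ?thesis
  proof (rule linear_minimum_attained[where scale = "\<lambda>c (v :: nat \<Rightarrow>\<^sub>0 rat). Poly_Mapping.map ((*) c) v"
        and f = "\<lambda>k v. npair v (fst k)" and c = snd and K = F and V = "coords r"])
    show "D = {x \<in> coords r. \<forall>k\<in>F. snd k \<le> npair x (fst k)}" using F(2) by (simp add: split_beta)
  qed (use F(1) D(2) b in \<open>auto simp: npair_add_left npair_scale_left\<close>)
qed

lemma dual_lattice_cone_closed:
  "0 \<in> dual_lattice_cone r \<sigma>"
  "u \<in> dual_lattice_cone r \<sigma> \<Longrightarrow> u' \<in> dual_lattice_cone r \<sigma> \<Longrightarrow> u + u' \<in> dual_lattice_cone r \<sigma>"
  by (auto simp: dual_lattice_cone_def npair_add_right)

lemma dual_lattice_cone_scale: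
  assumes "u \<in> dual_lattice_cone r \<sigma>" "0 \<le> c"
  shows "Poly_Mapping.map ((*) c) u \<in> dual_lattice_cone r \<sigma>"
  using assms by (auto simp: dual_lattice_cone_def npair_scale_right)

text \<open>
  This is where pointedness enters.  The functionals \<open>F\<close> that define \<open>\<sigma>\<close> have no common zero except
  \<open>0\<close>, so every point of \<open>\<sigma>\<close> where their sum is nonpositive is \<open>0\<close>.  Farkas then expresses \<open>u\<close> as a
  nonnegative combination of \<open>F\<close> minus a multiple of the sum of \<open>F\<close>; adding that multiple back moves
  \<open>u\<close> into the dual cone.
\<close>

lemma dual_lattice_cone_generates:
  assumes "polyhedral_cone r \<sigma>" "pointed \<sigma>" "u \<in> coords r"
  shows "\<exists>s\<in>dual_lattice_cone r \<sigma>. u + s \<in> dual_lattice_cone r \<sigma>"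
proof -
  obtain F :: "(nat \<Rightarrow>\<^sub>0 int) set" where F: "finite F" "F \<subseteq> coords r"
    "\<sigma> = {v \<in> coords r. \<forall>u\<in>F. 0 \<le> npair v u}"
    using assms(1) unfolding polyhedral_cone_def by blast
  let ?K = "insert None (Some ` F)"
  define f :: "(nat \<Rightarrow>\<^sub>0 int) option \<Rightarrow> (nat \<Rightarrow>\<^sub>0 rat) \<Rightarrow> rat" where
    "f k v = (case k of Some u \<Rightarrow> npair v u | None \<Rightarrow> - npair v (\<Sum>F))" for k v
  have "\<exists>l. (\<forall>k\<in>?K. 0 \<le> l k) \<and> (\<forall>x\<in>coords r. npair x u = (\<Sum>k\<in>?K. l k * f k x))"
  proof (rule farkas[where scale = "\<lambda>c (v :: nat \<Rightarrow>\<^sub>0 rat). Poly_Mapping.map ((*) c) v"])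
    fix v assume v: "v \<in> coords r" "\<forall>k\<in>?K. 0 \<le> f k v"
    then have nn: "\<forall>u\<in>F. 0 \<le> npair v u" and "npair v (\<Sum>F) \<le> 0" by (auto simp: f_def)
    then have "(\<Sum>u\<in>F. npair v u) = 0"
      using sum_nonneg[of F "npair v"] npair_sum_right[of v "\<lambda>x. x" F] by force
    then have "\<forall>u\<in>F. npair v u = 0" using F(1) nn by (simp add: sum_nonneg_eq_0_iff)
    then have "v \<in> \<sigma> \<and> - v \<in> \<sigma>" using v F(3) by auto
    then have "v = 0" using assms(2) by (auto simp: pointed_def)
    then show "0 \<le> npair v u" by simp
  qed (use F(1) in \<open>auto simp: f_def npair_add_left npair_scale_left algebra_simps split: option.splits\<close>)
  then obtain l where l: "\<forall>k\<in>?K. 0 \<le> l k"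
    "\<forall>x\<in>coords r. npair x u = (\<Sum>k\<in>?K. l k * f k x)" by (elim exE conjE)
  define c where "c = \<lceil>l None\<rceil>"
  have c: "0 \<le> c" "l None \<le> of_int c" using l by (auto simp: c_def)
  let ?s = "Poly_Mapping.map ((*) c) (\<Sum>F)"
  have F\<sigma>: "\<Sum>F \<in> dual_lattice_cone r \<sigma>"
    using F by (auto simp: dual_lattice_cone_def npair_sum_right intro!: coords_sum sum_nonneg)
  have "0 \<le> npair v (u + ?s)" if v: "v \<in> \<sigma>" for v
  proof -
    have "npair v u = (\<Sum>k\<in>Some ` F. l k * f k v) - l None * npair v (\<Sum>F)"
      using l v F by (simp add: f_def)
    moreover have "0 \<le> (\<Sum>k\<in>Some ` F. l k * f k v)"
      using l v F by (intro sum_nonneg) (auto simp: f_def)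
    moreover have "l None * npair v (\<Sum>F) \<le> of_int c * npair v (\<Sum>F)"
      using c F\<sigma> v by (intro mult_right_mono) (auto simp: dual_lattice_cone_def)
    ultimately show ?thesis by (simp add: npair_add_right npair_scale_right)
  qed
  then have "u + ?s \<in> dual_lattice_cone r \<sigma>"
    using assms(3) F\<sigma> by (auto simp: dual_lattice_cone_def)
  then show ?thesis using dual_lattice_cone_scale[OF F\<sigma> c(1)] by blast
qed

text \<open>
  Were \<open>0\<close> in the Minkowski sum, adding the common tailcone to one summand would fill all of \<open>\<sigma>\<close>.
\<close>

lemma zero_notin_minkowski_sum:
  assumes tail: "\<And>i. tailcone r (\<Delta> i) = \<sigma>" and strict: "minkowski_sum \<Delta> \<subset> \<sigma>"
    and x: "\<And>i. x i \<in> \<Delta> i"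
  shows "(\<Sum>i\<in>UNIV. x i) \<noteq> (0 :: nat \<Rightarrow>\<^sub>0 rat)"
proof
  assume 0: "(\<Sum>i\<in>UNIV. x i) = 0"
  fix j
  have "v \<in> minkowski_sum \<Delta>" if v: "v \<in> \<sigma>" for v
  proof -
    define y where "y = x(j := x j + v)"
    have "\<forall>i. y i \<in> \<Delta> i" using v x tail[of j] by (auto simp: y_def tailcone_def)
    moreover have "(\<Sum>i\<in>UNIV. y i) = (\<Sum>i\<in>UNIV. x i + (if i = j then v else 0))"
      by (intro sum.cong) (auto simp: y_def)
    then have "(\<Sum>i\<in>UNIV. y i) = v" using 0 by (simp add: sum.distrib)
    ultimately show ?thesis unfolding minkowski_sum_def by blast
  qed
  then show False using strict by blast
qed

text \<open>
  If some \<open>\<Delta> i\<close> is empty, its bound is arbitrary and \<open>u = 0\<close> will do.  Otherwise there are no points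
  \<open>x i\<close> of the \<open>\<Delta> i\<close> with sum \<open>0\<close>.  The Farkas certificate for this consists, for each \<open>i\<close>, of
  a nonnegative combination of the constraints of \<open>\<Delta> i\<close>.  Testing it on tuples with sum \<open>0\<close> shows
  that these combinations are the same functional \<open>u\<close> for all \<open>i\<close>, and the resulting lower bounds of
  \<open>u\<close> on the \<open>\<Delta> i\<close> have positive sum.
\<close>

lemma separating_character:
  fixes \<Delta> :: "'m::finite option \<Rightarrow> (nat \<Rightarrow>\<^sub>0 rat) set"
  assumes \<Delta>: "\<And>i. \<Delta> i = {} \<or> (rat_polyhedron r (\<Delta> i) \<and> tailcone r (\<Delta> i) = \<sigma>)"
    and strict: "minkowski_sum \<Delta> \<subset> \<sigma>"
  shows "\<exists>u\<in>dual_lattice_cone r \<sigma>. \<exists>d :: 'm option \<Rightarrow> int.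
    (\<forall>i. \<forall>x\<in>\<Delta> i. of_int (d i) \<le> npair x u) \<and> 1 \<le> (\<Sum>i\<in>UNIV. d i)"
proof (cases "\<exists>i. \<Delta> i = {}")
  case True
  then obtain j where "\<Delta> j = {}" by blast
  then show ?thesis
    by (intro bexI[of _ 0] exI[of _ "\<lambda>i. if i = j then 1 else 0"])
      (auto simp: dual_lattice_cone_closed)
next
  case False
  then have \<Delta>': "rat_polyhedron r (\<Delta> i)" "tailcone r (\<Delta> i) = \<sigma>" "\<Delta> i \<noteq> {}" for i
    using \<Delta> by auto
  have "\<forall>i. \<exists>F :: ((nat \<Rightarrow>\<^sub>0 int) \<times> rat) set. finite F \<and> F \<subseteq> coords r \<times> UNIV \<and>
        \<Delta> i = {v \<in> coords r. \<forall>(u, c)\<in>F. c \<le> npair v u}"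
    using \<Delta>'(1) unfolding rat_polyhedron_def by blast
  from choice[OF this] obtain F :: "'m option \<Rightarrow> ((nat \<Rightarrow>\<^sub>0 int) \<times> rat) set"
    where "\<forall>i. finite (F i) \<and> F i \<subseteq> coords r \<times> UNIV \<and>
      \<Delta> i = {v \<in> coords r. \<forall>(u, c)\<in>F i. c \<le> npair v u}" ..
  then have F: "\<And>i. finite (F i)" "\<And>i. F i \<subseteq> coords r \<times> UNIV"
    "\<And>i. \<Delta> i = {v \<in> coords r. \<forall>(u, c)\<in>F i. c \<le> npair v u}"
    by simp_all
  \<comment> \<open>The tuples with sum \<open>0\<close>; the extra coordinate \<open>s\<close> homogenizes the affine constraints, and
     infeasibility becomes the assertion that the constraints force \<open>s \<le> 0\<close>.\<close>
  define V where "V = {(x :: (nat \<Rightarrow>\<^sub>0 rat) ^ ('m option), s :: rat).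
      (\<forall>i. x $ i \<in> coords r) \<and> (\<Sum>i\<in>UNIV. x $ i) = 0}"
  define scale :: "rat \<Rightarrow> ((nat \<Rightarrow>\<^sub>0 rat) ^ ('m option)) \<times> rat \<Rightarrow> ((nat \<Rightarrow>\<^sub>0 rat) ^ ('m option)) \<times> rat"
    where "scale c y = ((\<chi> i. Poly_Mapping.map ((*) c) (fst y $ i)), c * snd y)" for c y
  define f :: "('m option \<times> (nat \<Rightarrow>\<^sub>0 int) \<times> rat) option \<Rightarrow> ((nat \<Rightarrow>\<^sub>0 rat) ^ ('m option)) \<times> rat \<Rightarrow> rat"
    where "f k y = (case k of None \<Rightarrow> snd y
      | Some (i, a, c) \<Rightarrow> npair (fst y $ i) a - c * snd y)" for k y
  let ?S = "SIGMA i:UNIV. F i"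
  let ?K = "insert None (Some ` ?S)"
  have finS: "finite ?S" using F(1) by (intro finite_SigmaI) auto
  have scale_sum: "(\<Sum>i\<in>UNIV. Poly_Mapping.map ((*) c) (x $ i)) = 0"
    if "(\<Sum>i\<in>UNIV. x $ i) = 0" for c and x :: "(nat \<Rightarrow>\<^sub>0 rat) ^ ('m option)"
  proof (rule poly_mapping_eqI)
    fix k
    have "(\<Sum>i\<in>UNIV. Poly_Mapping.lookup (x $ i) k) = 0"
      using that by (metis lookup_sum lookup_zero)
    then show "Poly_Mapping.lookup (\<Sum>i\<in>UNIV. Poly_Mapping.map ((*) c) (x $ i)) k =
        Poly_Mapping.lookup 0 k"
      by (simp add: lookup_sum flip: sum_distrib_left)
  qed
  have "\<exists>l. (\<forall>k\<in>?K. 0 \<le> l k) \<and> (\<forall>y\<in>V. - snd y = (\<Sum>k\<in>?K. l k * f k y))"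
  proof (rule farkas[where scale = scale])
    fix c and y z assume "y \<in> V" "z \<in> V"
    then show "y + scale c z \<in> V"
      using scale_sum by (auto simp: V_def scale_def sum.distrib)
  next
    fix y assume y: "y \<in> V" "\<forall>k\<in>?K. 0 \<le> f k y"
    obtain x s where xs: "y = (x, s)" by (cases y)
    show "0 \<le> - snd y"
    proof (rule ccontr)
      assume "\<not> 0 \<le> - snd y"
      then have s: "0 < s" using xs by simp
      have "Poly_Mapping.map ((*) (1 / s)) (x $ i) \<in> \<Delta> i" for i
      proof -
        have "c \<le> npair (Poly_Mapping.map ((*) (1 / s)) (x $ i)) a" if "(a, c) \<in> F i" for a c
        proof -
          have "0 \<le> f (Some (i, a, c)) y" using y(2) that by blast
          then show ?thesis using s by (simp add: f_def xs npair_scale_left field_simps)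
        qed
        then show ?thesis using y(1) by (auto simp: F(3) V_def xs)
      qed
      then have "(\<Sum>i\<in>UNIV. Poly_Mapping.map ((*) (1 / s)) (x $ i)) \<noteq> 0"
        by (rule zero_notin_minkowski_sum[OF \<Delta>'(2) strict])
      then show False using scale_sum[of x "1 / s"] y(1) by (simp add: V_def xs)
    qed
  qed (use finS in \<open>auto simp: f_def scale_def npair_add_left npair_scale_left algebra_simps
      split: option.splits\<close>)
  then obtain l where l0: "\<forall>k\<in>?K. 0 \<le> l k"
    and l1: "\<forall>y\<in>V. - snd y = (\<Sum>k\<in>?K. l k * f k y)" by (elim exE conjE)
  note l = bspec[OF l0] bspec[OF l1]
  obtain D n where D: "0 < D" and n: "\<And>k. k \<in> ?K \<Longrightarrow> of_int (n k) = of_int D * l k"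
    using common_denominator[of ?K l] finS by auto
  have n0: "0 \<le> n k" if "k \<in> ?K" for k
  proof -
    have "(0::rat) \<le> of_int (n k)" using n[OF that] l(1)[OF that] D by simp
    then show ?thesis by simp
  qed
  \<comment> \<open>The functional and the lower bound that the certificate yields on the \<open>i\<close>-th polyhedron, with
     denominators cleared.\<close>
  define U where "U i = (\<Sum>(a, c)\<in>F i. Poly_Mapping.map ((*) (n (Some (i, a, c)))) a)" for i
  define L where "L i = (\<Sum>(a, c)\<in>F i. of_int (n (Some (i, a, c))) * c)" for i
  have npU: "npair v (U i) = (\<Sum>(a, c)\<in>F i. of_int (n (Some (i, a, c))) * npair v a)"
    for v :: "nat \<Rightarrow>\<^sub>0 rat" and i
    by (simp add: U_def npair_sum_right split_beta npair_scale_right)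
  have cert: "- of_int D * s = of_int D * l None * s + (\<Sum>i\<in>UNIV. npair (x $ i) (U i) - s * L i)"
    if "(x, s) \<in> V" for x s
  proof -
    have "of_int D * - s = of_int D * (\<Sum>k\<in>?K. l k * f k (x, s))"
      using l(2)[OF that] by simp
    also have "\<dots> = (\<Sum>k\<in>?K. (of_int D * l k) * f k (x, s))"
      by (simp only: sum_distrib_left mult.assoc)
    also have "\<dots> = of_int D * l None * s
        + (\<Sum>k\<in>?S. (of_int D * l (Some k)) * f (Some k) (x, s))"
      using finS by (simp add: sum.reindex f_def)
    also have "(\<Sum>k\<in>?S. (of_int D * l (Some k)) * f (Some k) (x, s))
        = (\<Sum>k\<in>?S. of_int (n (Some k)) * f (Some k) (x, s))"
      using n by (intro sum.cong) auto
    also have "\<dots> = (\<Sum>i\<in>UNIV. \<Sum>(a, c)\<in>F i. of_int (n (Some (i, a, c))) * (npair (x $ i) a - c * s))"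
      using F(1) by (subst sum.Sigma) (auto simp: f_def split_beta)
    also have "\<dots> = (\<Sum>i\<in>UNIV. npair (x $ i) (U i) - s * L i)"
      by (simp add: npU L_def split_beta right_diff_distrib sum_subtractf sum_distrib_left
          mult.commute mult.left_commute mult.assoc)
    finally show ?thesis by simp
  qed
  have "(0, 1) \<in> V" by (simp add: V_def)
  from cert[OF this] have "(\<Sum>i\<in>UNIV. L i) = of_int D * (1 + l None)"
    by (simp add: sum_negf algebra_simps)
  then have sumL: "1 \<le> (\<Sum>i\<in>UNIV. L i)"
  proof -
    have "(1::rat) \<le> of_int D" using D by simp
    moreover have "1 \<le> 1 + l None" using l(1)[of None] by simp
    ultimately have "1 * 1 \<le> of_int D * (1 + l None)" by (intro mult_mono) auto
    then show ?thesis using \<open>(\<Sum>i\<in>UNIV. L i) = _\<close> by simp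
  qed
  have Uc: "U i \<in> coords r" for i
    unfolding U_def split_beta by (intro coords_sum coords_scale) (use F(2)[of i] in auto)
  have Ueq: "U i = U None" for i
  proof (cases i)
    case (Some i')
    show ?thesis
    proof (rule poly_mapping_eqI)
      fix k
      show "Poly_Mapping.lookup (U i) k = Poly_Mapping.lookup (U None) k"
      proof (cases "k < r")
        case True
        define e where "e = Poly_Mapping.single k (1::rat)"
        have e: "e \<in> coords r" using True by (simp add: e_def coords_single)
        \<comment> \<open>Test the certificate on \<open>e\<close> in position \<open>i\<close> and \<open>- e\<close> in position \<open>None\<close>.\<close>
        define x where "x = (\<chi> j. if j = i then e else if j = None then - e else 0)"
        have sum2: "(\<Sum>j\<in>UNIV. h j) = h i + h None" if "\<And>j. j \<noteq> i \<Longrightarrow> j \<noteq> None \<Longrightarrow> h j = 0"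
          for h :: "'m option \<Rightarrow> 'b::comm_monoid_add"
        proof -
          have "(\<Sum>j\<in>UNIV. h j) = (\<Sum>j\<in>{i, None}. h j)"
            using that by (intro sum.mono_neutral_right) auto
          then show ?thesis using Some by simp
        qed
        have "(x, 0) \<in> V" using e Some
          by (auto simp: V_def x_def) (subst sum2, auto)
        from cert[OF this] have "0 = (\<Sum>j\<in>UNIV. npair (x $ j) (U j))" by simp
        also have "\<dots> = npair e (U i) - npair e (U None)"
          using Some by (subst sum2) (auto simp: x_def)
        finally show ?thesis by (simp add: e_def npair_single_left)
      qed (use Uc in \<open>auto simp: coords_iff\<close>)
    qed
  qed simp
  have bound: "L i \<le> npair x (U i)" if "x \<in> \<Delta> i" for x i
    unfolding L_def npU split_beta using that n0 F(3)[of i]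
    by (intro sum_mono mult_left_mono) auto
  \<comment> \<open>The bounds are rational, so a second multiple makes them integers.\<close>
  obtain E e where E: "0 < E" and e: "\<And>i. of_int (e i) = of_int E * L i"
    using common_denominator[of UNIV L] by auto
  let ?u = "Poly_Mapping.map ((*) E) (U None)"
  have bound': "of_int (e i) \<le> npair x ?u" if "x \<in> \<Delta> i" for x i
    using bound[OF that] Ueq[of i] E by (simp add: e npair_scale_right)
  have "?u \<in> dual_lattice_cone r \<sigma>"
  proof -
    obtain x where x: "x \<in> \<Delta> None" using \<Delta>'(3) by blast
    have "0 \<le> npair v ?u" if "v \<in> \<sigma>" for v
      using bounded_imp_nonneg_on_tailcone[OF x, of v r _ ?u] that \<Delta>'(2) bound' by blast
    then show ?thesis using Uc by (auto simp: dual_lattice_cone_def)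
  qed
  moreover have "1 \<le> (\<Sum>i\<in>UNIV. e i)"
  proof -
    have "1 * 1 \<le> of_int E * (\<Sum>i\<in>UNIV. L i)"
      using E sumL by (intro mult_mono) auto
    then have "(1::rat) \<le> of_int (\<Sum>i\<in>UNIV. e i)" by (simp add: e sum_distrib_left)
    then show ?thesis by (simp only: of_int_1_le_iff)
  qed
  ultimately show ?thesis using bound' by blast
qed

lemma submonoid_weight_semigroup: "submonoid (weight_semigroup r C)"
  unfolding submonoid_def weight_semigroup_def
  by (fastforce simp: npair_add_right zpair_add_right zero_prod_def)

text \<open>
  The choice \<open>v = - d\<close> makes the conditions at \<open>e\<^sub>1, \<dots>, e\<^sub>m\<close> hold, and the one at \<open>e\<^sub>0\<close> is exactly
  that the bounds have nonnegative sum.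
\<close>

lemma weight_semigroup_coneI:
  fixes d :: "'m::finite option \<Rightarrow> int"
  assumes u: "u \<in> dual_lattice_cone r \<sigma>"
    and d: "\<And>i x. x \<in> \<Delta> i \<Longrightarrow> of_int (d i) \<le> npair x u" and sum: "0 \<le> (\<Sum>i\<in>UNIV. d i)"
  shows "(u, \<chi> i. - d (Some i)) \<in> weight_semigroup r (cone_C \<sigma> \<Delta>)"
proof -
  let ?v = "(\<chi> i. - d (Some i)) :: int ^ 'm"
  let ?T = "{(a, b). 0 \<le> npair a u + zpair b ?v} :: ((nat \<Rightarrow>\<^sub>0 rat) \<times> (rat ^ 'm)) set"
  have "d None + (\<Sum>i\<in>UNIV. d (Some i)) = (\<Sum>i\<in>UNIV. d i)"
    by (simp add: UNIV_option_conv sum.reindex)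
  then have "(0::rat) \<le> of_int (d None + (\<Sum>i\<in>UNIV. d (Some i)))"
    using sum by (simp only: of_int_0_le_iff)
  then have e: "- of_int (d i) \<le> (zpair (e_vec i) ?v :: rat)" for i
    by (cases i) (simp_all add: zpair_e_vec sum_negf del: e_vec.simps)
  have "rat_cone ?T"
    unfolding rat_cone_def
  proof (intro conjI ballI allI impI)
    fix x y assume "x \<in> ?T" "y \<in> ?T"
    then show "x + y \<in> ?T" by (auto simp: npair_add_left zpair_add_left)
  next
    fix c :: rat and x assume "0 \<le> c" and x: "x \<in> ?T"
    then show "case x of (a, b) \<Rightarrow> (Poly_Mapping.map ((*) c) a, c *s b) \<in> ?T"
      by (auto simp: npair_scale_left zpair_scale_left simp flip: distrib_left)
  qed (simp add: zero_prod_def)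
  moreover have "\<sigma> \<times> {0} \<union> (\<Union>i. \<Delta> i \<times> {e_vec i}) \<subseteq> ?T"
  proof -
    have "0 \<le> npair x u + zpair (e_vec i) ?v" if "x \<in> \<Delta> i" for i x
      using d[OF that] e[of i] by linarith
    then show ?thesis using u by (auto simp: dual_lattice_cone_def)
  qed
  ultimately have "cone_C \<sigma> \<Delta> \<subseteq> ?T" unfolding cone_C_def by (simp add: hull_minimal)
  then show ?thesis using u by (auto simp: weight_semigroup_def dual_lattice_cone_def)
qed

lemma weight_semigroup_coneD:
  assumes "(u, v) \<in> weight_semigroup r (cone_C \<sigma> \<Delta>)"
  shows "u \<in> dual_lattice_cone r \<sigma>"
    and "x \<in> \<Delta> i \<Longrightarrow> - zpair (e_vec i) v \<le> npair x u"
proof -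
  have *: "0 \<le> npair a u + zpair b v" if "(a, b) \<in> \<sigma> \<times> {0} \<union> (\<Union>i. \<Delta> i \<times> {e_vec i})" for a b
  proof -
    have "(a, b) \<in> cone_C \<sigma> \<Delta>" unfolding cone_C_def using that by (rule hull_inc)
    then show ?thesis using assms by (auto simp: weight_semigroup_def)
  qed
  show "u \<in> dual_lattice_cone r \<sigma>"
    using assms *[of _ 0] by (auto simp: weight_semigroup_def dual_lattice_cone_def)
  show "- zpair (e_vec i) v \<le> npair x u" if "x \<in> \<Delta> i"
  proof -
    have "0 \<le> npair x u + zpair (e_vec i) v" by (rule *) (use that in blast)
    then show ?thesis by simp
  qed
qed

text \<open>
  Write \<open>u\<close> as a difference of two elements of the dual cone and pick lower bounds \<open>c1\<close>, \<open>c2\<close> of both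
  on the \<open>\<Delta> i\<close> whose difference is \<open>v\<close>.  These bounds may have negative sums, but adding \<open>k\<close> times
  the separating character, for \<open>k\<close> large, corrects this for both at once and does not change the
  difference.
\<close>

lemma weight_semigroup_generates:
  fixes \<Delta> :: "'m::finite option \<Rightarrow> (nat \<Rightarrow>\<^sub>0 rat) set" and v :: "int ^ 'm"
  assumes \<sigma>: "polyhedral_cone r \<sigma>" "pointed \<sigma>"
    and \<Delta>: "\<And>i. \<Delta> i = {} \<or> (rat_polyhedron r (\<Delta> i) \<and> tailcone r (\<Delta> i) = \<sigma>)"
    and strict: "minkowski_sum \<Delta> \<subset> \<sigma>" and u: "u \<in> coords r"
  shows "\<exists>s\<in>weight_semigroup r (cone_C \<sigma> \<Delta>). (u, v) + s \<in> weight_semigroup r (cone_C \<sigma> \<Delta>)"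
proof -
  let ?M = "dual_lattice_cone r \<sigma>"
  obtain u2 where u2: "u2 \<in> ?M" "u + u2 \<in> ?M"
    using dual_lattice_cone_generates[OF \<sigma> u] by blast
  have "\<exists>d. \<forall>i. \<forall>x\<in>\<Delta> i. of_int (d i) \<le> npair x w" if "w \<in> ?M" for w
  proof -
    have "\<forall>i. \<exists>d::int. \<forall>x\<in>\<Delta> i. of_int d \<le> npair x w"
      using dual_bounded_below[OF _ _ that] \<Delta> by (metis empty_iff)
    then show ?thesis by metis
  qed
  then obtain b1 b2 where b1: "\<And>i x. x \<in> \<Delta> i \<Longrightarrow> of_int (b1 i) \<le> npair x (u + u2)"
    and b2: "\<And>i x. x \<in> \<Delta> i \<Longrightarrow> of_int (b2 i) \<le> npair x u2"
    using u2 by meson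
  obtain u0 d where u0: "u0 \<in> ?M" "\<And>i x. x \<in> \<Delta> i \<Longrightarrow> of_int (d i) \<le> npair x u0"
    and d: "1 \<le> (\<Sum>i\<in>UNIV. d i)"
    using separating_character[OF \<Delta> strict] by blast
  \<comment> \<open>Lowering a bound is harmless, so \<open>c2 - c1 = v\<close> can be arranged at \<open>e\<^sub>1, \<dots>, e\<^sub>m\<close>.\<close>
  define v' where "v' i = (case i of None \<Rightarrow> 0 | Some j \<Rightarrow> v $ j)" for i
  define c1 where "c1 i = min (b1 i) (b2 i - v' i)" for i
  define c2 where "c2 i = c1 i + v' i" for i
  define k where "k = \<bar>\<Sum>i\<in>UNIV. c1 i\<bar> + \<bar>\<Sum>i\<in>UNIV. c2 i\<bar>"
  have k: "0 \<le> k" by (simp add: k_def)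
  have mem: "(w + Poly_Mapping.map ((*) k) u0, \<chi> i. - (c (Some i) + k * d (Some i)))
      \<in> weight_semigroup r (cone_C \<sigma> \<Delta>)"
    if w: "w \<in> ?M" and c: "\<And>i x. x \<in> \<Delta> i \<Longrightarrow> of_int (c i) \<le> npair x w"
      and ck: "\<bar>\<Sum>i\<in>UNIV. c i\<bar> \<le> k" for w c
  proof (rule weight_semigroup_coneI)
    show "w + Poly_Mapping.map ((*) k) u0 \<in> ?M"
      using w u0(1) k by (intro dual_lattice_cone_closed dual_lattice_cone_scale)
    show "of_int (c i + k * d i) \<le> npair x (w + Poly_Mapping.map ((*) k) u0)" if "x \<in> \<Delta> i" for i x
    proof -
      have "of_int k * of_int (d i) \<le> of_int k * npair x u0"
        using k u0(2)[OF that] by (intro mult_left_mono) auto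
      then show ?thesis using c[OF that] by (simp add: npair_add_right npair_scale_right)
    qed
    have "k * 1 \<le> k * (\<Sum>i\<in>UNIV. d i)" using k d by (intro mult_left_mono)
    then show "0 \<le> (\<Sum>i\<in>UNIV. c i + k * d i)"
      using ck by (simp add: sum.distrib flip: sum_distrib_left)
  qed
  let ?s = "(u2 + Poly_Mapping.map ((*) k) u0, \<chi> i. - (c2 (Some i) + k * d (Some i)))"
  have c1: "of_int (c1 i) \<le> npair x (u + u2)" if "x \<in> \<Delta> i" for i x
  proof -
    have "(of_int (c1 i) :: rat) \<le> of_int (b1 i)" by (simp add: c1_def)
    then show ?thesis using b1[OF that] by linarith
  qed
  have c2: "of_int (c2 i) \<le> npair x u2" if "x \<in> \<Delta> i" for i x
  proof -
    have "(of_int (c2 i) :: rat) \<le> of_int (b2 i)"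
      unfolding of_int_le_iff by (simp add: c1_def c2_def)
    then show ?thesis using b2[OF that] by linarith
  qed
  have "?s \<in> weight_semigroup r (cone_C \<sigma> \<Delta>)"
    using u2 c2 by (intro mem) (auto simp: k_def)
  moreover have "(u + u2 + Poly_Mapping.map ((*) k) u0, \<chi> i. - (c1 (Some i) + k * d (Some i)))
      \<in> weight_semigroup r (cone_C \<sigma> \<Delta>)"
    using u2 c1 by (intro mem) (auto simp: k_def)
  moreover have "(u + u2 + Poly_Mapping.map ((*) k) u0, \<chi> i. - (c1 (Some i) + k * d (Some i)))
      = (u, v) + ?s"
    by (simp add: add.assoc vec_eq_iff c2_def v'_def)
  ultimately have "?s \<in> weight_semigroup r (cone_C \<sigma> \<Delta>)"
    "(u, v) + ?s \<in> weight_semigroup r (cone_C \<sigma> \<Delta>)" by (metis, metis)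
  then show ?thesis by blast
qed

section \<open>Monomials and the coordinate functions of the line\<close>

definition zpower :: "'f::field ^ 'm \<Rightarrow> int ^ 'm::finite \<Rightarrow> 'f" where
  "zpower z v = (\<Prod>i\<in>UNIV. (z $ i) powi (v $ i))"

text \<open>
  The coordinate \<open>y\<^sub>i / y\<^sub>0\<close> in the function field of the line; it is \<open>1\<close> for \<open>i = None\<close>.
\<close>

definition L_coordinate :: "'k::field ^ ('m::finite option) \<Rightarrow> 'k ^ ('m option) \<Rightarrow> 'm option \<Rightarrow> 'k poly fract"
  where "L_coordinate p q i = Fract (y_on_L p q i) (y_on_L p q None)"

lemma zpower_0 [simp]: "zpower z 0 = 1"
  by (simp add: zpower_def)

lemma zpower_add: "z \<in> torus \<Longrightarrow> zpower z (v + v') = zpower z v * zpower z v'"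
  by (simp add: zpower_def torus_def power_int_add prod.distrib)

lemma zpower_nonzero: "z \<in> torus \<Longrightarrow> zpower z v \<noteq> 0"
  by (simp add: zpower_def torus_def)

lemma zpower_axis: "zpower z (axis i 1) = z $ i"
proof -
  have "zpower z (axis i 1) = (\<Prod>j\<in>UNIV. if j = i then z $ j else 1)"
    unfolding zpower_def by (intro prod.cong) (auto simp: axis_def)
  then show ?thesis by simp
qed

lemma z_monomial_eq_zpower: "z_monomial p q v = zpower (\<chi> i. L_coordinate p q (Some i)) v"
  by (simp add: z_monomial_def zpower_def L_coordinate_def)

section \<open>Orders of rational functions on the line\<close>

lemma ord_at_mult:
  assumes "f \<noteq> 0" "g \<noteq> 0"
  shows "ord_at P (f * g) = ord_at P f + ord_at P g"
proof -
  obtain a b where f: "f = Fract a b" "b \<noteq> 0" by (cases f)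
  obtain c d where g: "g = Fract c d" "d \<noteq> 0" by (cases g)
  have "a \<noteq> 0" "c \<noteq> 0" using assms f g by (auto simp: Zero_fract_def eq_fract)
  then show ?thesis using f g by (simp add: ord_at_Fract ord_poly_mult)
qed

lemma ord_at_const: "c \<noteq> 0 \<Longrightarrow> ord_at P (Fract [:c:] 1) = 0"
  by (cases P) (simp_all add: ord_at_Fract order_0I)

lemma ord_at_1 [simp]: "ord_at P 1 = 0"
  using ord_at_const[of 1 P] by (simp add: One_fract_def one_pCons)

lemma ord_at_inverse: "f \<noteq> 0 \<Longrightarrow> ord_at P (inverse f) = - ord_at P f"
  using ord_at_mult[of f "inverse f" P] by simp

lemma ord_at_power: "f \<noteq> 0 \<Longrightarrow> ord_at P (f ^ n) = int n * ord_at P f"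
  by (induction n) (simp_all add: ord_at_mult algebra_simps)

lemma ord_at_powi: "f \<noteq> 0 \<Longrightarrow> ord_at P (f powi k) = k * ord_at P f"
  by (simp add: power_int_def ord_at_power ord_at_inverse)

lemma ord_at_prod: "(\<And>i. i \<in> I \<Longrightarrow> f i \<noteq> 0) \<Longrightarrow> ord_at P (\<Prod>i\<in>I. f i) = (\<Sum>i\<in>I. ord_at P (f i))"
  by (induction I rule: infinite_finite_induct) (simp_all add: ord_at_mult)

text \<open>
  As a section of \<open>O(1)\<close>, \<open>y\<^sub>i\<close> has a simple zero at \<open>Q\<^sub>i\<close>; the trivialization by polynomials in the
  affine coordinate subtracts one at infinity.  The latter cancels in quotients.
\<close>

lemma ord_poly_y_on_L:
  fixes p q :: "'k::field ^ 'n"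
  assumes "p $ i \<noteq> 0 \<or> q $ i \<noteq> 0"
  shows "ord_poly P (y_on_L p q i) = of_bool (Q_pt p q i = P) - of_bool (P = None)"
proof (cases P)
  case (Some s)
  show ?thesis
  proof (cases "q $ i = 0")
    case True
    then show ?thesis using assms Some by (simp add: y_on_L_def Q_pt_def order_0I)
  next
    case False
    then have "y_on_L p q i = smult (q $ i) [:- (- p $ i / q $ i), 1:]" by (simp add: y_on_L_def)
    then have "order s (y_on_L p q i) = order s [:- (- p $ i / q $ i), 1:]"
      using False order_smult by metis
    also have "\<dots> = of_bool (- p $ i / q $ i = s)"
      using order_power_n_n[of s 1]
      by (cases "- p $ i / q $ i = s") (auto intro!: order_0I simp: add_eq_0_iff2)
    finally show ?thesis using False Some by (simp add: Q_pt_def)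
  qed
qed (simp add: y_on_L_def Q_pt_def)

lemma ord_at_z_monomial:
  fixes p q :: "'k::field ^ ('m::finite option)"
  assumes "\<And>i. p $ i \<noteq> 0 \<or> q $ i \<noteq> 0"
  shows "ord_at P (z_monomial p q v) = (\<Sum>i\<in>{i. Q_pt p q i = P}. zpair (e_vec i) v)"
proof -
  have y: "y_on_L p q i \<noteq> 0" for i using assms by (simp add: y_on_L_def)
  have z: "L_coordinate p q i \<noteq> 0" for i
    using y by (simp add: L_coordinate_def Zero_fract_def eq_fract)
  have "ord_at P (L_coordinate p q i) = of_bool (Q_pt p q i = P) - of_bool (Q_pt p q None = P)" for i
    using assms y by (simp add: L_coordinate_def ord_at_Fract ord_poly_y_on_L)
  then have "ord_at P (z_monomial p q v)
      = (\<Sum>i\<in>UNIV. v $ i * (of_bool (Q_pt p q (Some i) = P) - of_bool (Q_pt p q None = P)))"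
    using z by (simp add: z_monomial_eq_zpower zpower_def ord_at_prod ord_at_powi)
  also have "\<dots> = (\<Sum>i\<in>UNIV. of_bool (Q_pt p q (Some i) = P) * zpair (e_vec (Some i)) v)
      + of_bool (Q_pt p q None = P) * zpair (e_vec None) v"
    by (simp add: zpair_e_vec right_diff_distrib sum_subtractf sum_distrib_left mult.commute
        del: e_vec.simps)
  also have "\<dots> = (\<Sum>i\<in>UNIV. of_bool (Q_pt p q i = P) * zpair (e_vec i) v)"
    by (simp add: UNIV_option_conv sum.reindex o_def del: e_vec.simps sum_of_bool_mult_eq sum_mult_of_bool_eq)
  also have "\<dots> = (\<Sum>i\<in>{i. Q_pt p q i = P}. zpair (e_vec i) v)"
    by (rule sum.mono_neutral_cong_right) (auto simp del: e_vec.simps)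
  finally show ?thesis .
qed

text \<open>
  The conditions on \<open>(u, v)\<close> at the generators \<open>\<Delta> i \<times> e\<^sub>i\<close> bound the minimum of \<open>u\<close> on \<open>\<Delta> i\<close> below by
  minus the contribution of \<open>Q\<^sub>i\<close> to the order of \<open>z\<^sup>v\<close>.  That contribution is an integer, so the
  bound survives rounding down.
\<close>

lemma z_monomial_in_H0:
  fixes p q :: "'k::field ^ ('m::finite option)"
  assumes y: "\<And>i. p $ i \<noteq> 0 \<or> q $ i \<noteq> 0"
    and \<Delta>: "\<And>i. \<Delta> i = {} \<or> rat_polyhedron r (\<Delta> i)"
    and uv: "(u, v) \<in> weight_semigroup r (cone_C \<sigma> \<Delta>)"
  shows "z_monomial p q v \<in> H0 (divisor_at p q \<Delta> u)"
proof -
  have "0 \<le> ereal (of_int (ord_at P (z_monomial p q v))) + divisor_at p q \<Delta> u P" for P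
  proof -
    let ?I = "{i. Q_pt p q i = P}"
    have le: "ereal (- of_int (zpair (e_vec i) v)) \<le> floor_eval (\<Delta> i) u" for i
    proof (cases "\<Delta> i = {}")
      case False
      have b: "- zpair (e_vec i) v \<le> npair x u" if "x \<in> \<Delta> i" for x
        using weight_semigroup_coneD(2)[OF uv that] .
      obtain x where x: "x \<in> \<Delta> i" "\<And>y. y \<in> \<Delta> i \<Longrightarrow> npair x u \<le> npair y u"
        using rat_polyhedron_minimum_attained[OF _ False b] \<Delta>[of i] False by blast
      have "(LEAST x. x \<in> (\<lambda>v. npair v u) ` \<Delta> i) = npair x u"
        using x by (intro Least_equality) auto
      moreover have "(- zpair (e_vec i) v :: rat) = of_int (- zpair (e_vec i) v)"
        by (cases i) (simp_all add: zpair_e_vec del: e_vec.simps)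
      then have "- zpair (e_vec i) v \<le> \<lfloor>npair x u\<rfloor>"
        using b[OF x(1)] by (simp add: le_floor_iff)
      ultimately show ?thesis using False
        by (simp add: floor_eval_def flip: of_int_minus del: e_vec.simps)
    qed (simp add: floor_eval_def)
    have "ereal (- of_int (ord_at P (z_monomial p q v)))
        = (\<Sum>i\<in>?I. ereal (- of_int (zpair (e_vec i) v)))"
      by (simp add: ord_at_z_monomial[OF y] sum_negf del: e_vec.simps)
    also have "\<dots> \<le> divisor_at p q \<Delta> u P"
      unfolding divisor_at_def by (intro sum_mono le)
    finally have "ereal (of_int (ord_at P (z_monomial p q v)))
        + ereal (- of_int (ord_at P (z_monomial p q v)))
        \<le> ereal (of_int (ord_at P (z_monomial p q v))) + divisor_at p q \<Delta> u P"
      by (intro add_left_mono)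
    then show ?thesis by (simp add: zero_ereal_def)
  qed
  then show ?thesis by (simp add: H0_def)
qed

lemma const_in_H0: "Fract [:c:] 1 \<in> H0 (divisor_at p q \<Delta> 0)"
proof (cases "c = 0")
  case True
  then show ?thesis by (simp add: H0_def Zero_fract_def)
next
  case False
  have "floor_eval D 0 \<ge> 0" for D
  proof (cases "D = {}")
    case False
    then have "(\<lambda>v. npair v 0 :: rat) ` D = {0}" by auto
    then have "(LEAST x. x \<in> (\<lambda>v. npair v 0 :: rat) ` D) = 0" by (simp add: Least_equality)
    then show ?thesis by (simp add: floor_eval_def)
  qed (simp add: floor_eval_def)
  then show ?thesis using False by (simp add: H0_def ord_at_const divisor_at_def sum_nonneg)
qed

lemma const_mult_in_H0:
  assumes "f \<in> H0 D"
  shows "Fract [:c:] 1 * f \<in> H0 D"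
proof (cases "c = 0 \<or> f = 0")
  case True
  then have "Fract [:c:] 1 * f = 0" by (auto simp: Zero_fract_def)
  then show ?thesis by (simp add: H0_def)
next
  case False
  then have "Fract [:c:] 1 \<noteq> 0" by (simp add: Zero_fract_def eq_fract)
  then show ?thesis using False assms by (simp add: H0_def ord_at_mult ord_at_const)
qed

section \<open>Evaluation of rational functions at a point of the line\<close>

text \<open>
  The value at \<open>P\<close> of the homogenization of \<open>a\<close> to degree \<open>n\<close>, which treats the point at infinity on
  the same footing as the others.
\<close>

definition hval :: "'k::field option \<Rightarrow> nat \<Rightarrow> 'k poly \<Rightarrow> 'k" where
  "hval P n a = (case P of Some s \<Rightarrow> poly a s | None \<Rightarrow> coeff a n)"

lemma hval_mult:
  assumes "degree a \<le> m" "degree b \<le> n"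
  shows "hval P (m + n) (a * b) = hval P m a * hval P n b"
proof (cases P)
  case None
  show ?thesis
  proof (cases "degree a = m \<and> degree b = n")
    case True
    then show ?thesis using None by (auto simp: hval_def coeff_mult_degree_sum)
  next
    case False
    then have "degree (a * b) < m + n" "degree a < m \<or> degree b < n"
      using assms degree_mult_le[of a b] by auto
    then show ?thesis using None by (auto simp: hval_def coeff_eq_0)
  qed
qed (simp add: hval_def)

lemma hval_add: "hval P n (a + b) = hval P n a + hval P n b"
  by (cases P) (simp_all add: hval_def)

lemma hval_0 [simp]: "hval P n 0 = 0"
  by (cases P) (simp_all add: hval_def)

lemma hval_const [simp]: "hval P 0 [:c:] = c"
  by (cases P) (simp_all add: hval_def)

text \<open>
  The function \<open>f\<close> is regular at \<open>P\<close> with value \<open>c\<close>: it is a quotient of two homogeneous polynomials of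
  the same degree \<open>n\<close> whose denominator does not vanish at \<open>P\<close>.
\<close>

definition has_value :: "'k::field poly fract \<Rightarrow> 'k \<Rightarrow> 'k option \<Rightarrow> bool" where
  "has_value f c P \<longleftrightarrow> (\<exists>n a b. degree a \<le> n \<and> degree b \<le> n \<and> hval P n b \<noteq> 0 \<and>
     f = Fract a b \<and> c = hval P n a / hval P n b)"

lemma has_value_unique:
  assumes "has_value f c P" "has_value f d P"
  shows "c = d"
proof -
  obtain n a b where f1: "degree a \<le> n" "degree b \<le> n" "hval P n b \<noteq> 0" "f = Fract a b"
    "c = hval P n a / hval P n b" using assms(1) by (auto simp: has_value_def)
  obtain n' a' b' where f2: "degree a' \<le> n'" "degree b' \<le> n'" "hval P n' b' \<noteq> 0" "f = Fract a' b'"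
    "d = hval P n' a' / hval P n' b'" using assms(2) by (auto simp: has_value_def)
  have "b \<noteq> 0" "b' \<noteq> 0" using f1 f2 by auto
  then have "a * b' = a' * b" using f1(4) f2(4) by (simp add: eq_fract)
  then have "hval P (n + n') (a * b') = hval P (n' + n) (a' * b)" by (simp add: add.commute)
  then have "hval P n a * hval P n' b' = hval P n' a' * hval P n b"
    using f1 f2 by (simp add: hval_mult)
  then show ?thesis using f1 f2 by (simp add: frac_eq_eq)
qed

lemma has_value_add:
  assumes "has_value f c P" "has_value g d P"
  shows "has_value (f + g) (c + d) P"
proof -
  obtain n a b where f1: "degree a \<le> n" "degree b \<le> n" "hval P n b \<noteq> 0" "f = Fract a b"
    "c = hval P n a / hval P n b" using assms(1) by (auto simp: has_value_def)
  obtain n' a' b' where f2: "degree a' \<le> n'" "degree b' \<le> n'" "hval P n' b' \<noteq> 0" "g = Fract a' b'"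
    "d = hval P n' a' / hval P n' b'" using assms(2) by (auto simp: has_value_def)
  have nz: "b \<noteq> 0" "b' \<noteq> 0" using f1 f2 by auto
  have deg: "degree (x * y) \<le> n + n'" if "degree x \<le> n" "degree y \<le> n'" for x y :: "'a poly"
    using degree_mult_le[of x y] that by linarith
  have "degree (a * b' + a' * b) \<le> n + n'"
    using f1 f2 by (intro degree_add_le) (auto intro: deg simp: mult.commute[of a'])
  moreover have "degree (b * b') \<le> n + n'" using f1 f2 deg by blast
  moreover have "hval P (n + n') (a' * b) = hval P n' a' * hval P n b"
    using hval_mult[of a' n' b n P] f1 f2 by (simp add: add.commute)
  then have "c + d = hval P (n + n') (a * b' + a' * b) / hval P (n + n') (b * b')"
    using f1 f2 by (simp add: hval_add hval_mult add_frac_eq)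
  moreover have "hval P (n + n') (b * b') \<noteq> 0" using f1 f2 by (simp add: hval_mult)
  moreover have "f + g = Fract (a * b' + a' * b) (b * b')" using f1(4) f2(4) nz by simp
  ultimately show ?thesis unfolding has_value_def by blast
qed

lemma has_value_mult:
  assumes "has_value f c P" "has_value g d P"
  shows "has_value (f * g) (c * d) P"
proof -
  obtain n a b where f1: "degree a \<le> n" "degree b \<le> n" "hval P n b \<noteq> 0" "f = Fract a b"
    "c = hval P n a / hval P n b" using assms(1) by (auto simp: has_value_def)
  obtain n' a' b' where f2: "degree a' \<le> n'" "degree b' \<le> n'" "hval P n' b' \<noteq> 0" "g = Fract a' b'"
    "d = hval P n' a' / hval P n' b'" using assms(2) by (auto simp: has_value_def)
  have "degree (a * a') \<le> n + n'" "degree (b * b') \<le> n + n'"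
    using f1 f2 degree_mult_le[of a a'] degree_mult_le[of b b'] by linarith+
  moreover have "c * d = hval P (n + n') (a * a') / hval P (n + n') (b * b')"
    using f1 f2 by (simp add: hval_mult)
  moreover have "hval P (n + n') (b * b') \<noteq> 0" using f1 f2 by (simp add: hval_mult)
  moreover have "f * g = Fract (a * a') (b * b')" using f1(4) f2(4) by simp
  ultimately show ?thesis unfolding has_value_def by blast
qed

lemma has_value_const: "has_value (Fract [:c:] 1) c P"
  unfolding has_value_def
  by (intro exI[of _ 0] exI[of _ "[:c:]"] exI[of _ 1]) (simp add: one_pCons)

lemma has_value_0: "has_value 0 0 P" and has_value_1: "has_value 1 1 P"
  using has_value_const[of 0 P] has_value_const[of 1 P]
  by (simp_all add: Zero_fract_def One_fract_def one_pCons)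

lemma has_value_inverse:
  assumes "has_value f c P" "c \<noteq> 0"
  shows "has_value (inverse f) (inverse c) P"
proof -
  obtain n a b where f: "degree a \<le> n" "degree b \<le> n" "hval P n b \<noteq> 0" "f = Fract a b"
    "c = hval P n a / hval P n b" using assms(1) by (auto simp: has_value_def)
  then have "hval P n a \<noteq> 0" "inverse f = Fract b a" "inverse c = hval P n b / hval P n a"
    using assms(2) by auto
  then show ?thesis using f unfolding has_value_def by blast
qed

lemma has_value_power: "has_value f c P \<Longrightarrow> has_value (f ^ n) (c ^ n) P"
  by (induction n) (simp_all add: has_value_1 has_value_mult)

lemma has_value_powi: "has_value f c P \<Longrightarrow> c \<noteq> 0 \<Longrightarrow> has_value (f powi k) (c powi k) P"
  by (simp add: power_int_def has_value_power has_value_inverse)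

lemma has_value_prod:
  "(\<And>i. i \<in> I \<Longrightarrow> has_value (f i) (c i) P) \<Longrightarrow> has_value (\<Prod>i\<in>I. f i) (\<Prod>i\<in>I. c i) P"
  by (induction I rule: infinite_finite_induct) (simp_all add: has_value_1 has_value_mult)

text \<open>
  At a finite point, cancel the power of the linear factor that divides the denominator; it divides the
  numerator since the order is nonnegative.  At infinity, homogenize to the degree of the
  denominator.
\<close>

lemma has_value_exists:
  assumes "f \<noteq> 0" "0 \<le> ord_at P f"
  shows "\<exists>c. has_value f c P"
proof -
  obtain a b where f: "f = Fract a b" "b \<noteq> 0" by (cases f)
  have a: "a \<noteq> 0" using assms f by (auto simp: Zero_fract_def eq_fract)
  have ord: "ord_poly P b \<le> ord_poly P a" using assms f a by (simp add: ord_at_Fract)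
  show ?thesis
  proof (cases P)
    case None
    then have "degree a \<le> degree b" using ord by simp
    moreover have "hval P (degree b) b \<noteq> 0" using None f by (simp add: hval_def)
    ultimately show ?thesis using f unfolding has_value_def by blast
  next
    case (Some s)
    let ?l = "[:- s, 1:]"
    obtain b' where b': "b = ?l ^ order s b * b'" "\<not> ?l dvd b'"
      using order_decomp[OF f(2)] by blast
    have "order s b \<le> order s a" using ord Some by simp
    then have "?l ^ order s b dvd a" using order_1[of s a] by (meson dvd_trans le_imp_power_dvd)
    then obtain a' where a': "a = ?l ^ order s b * a'" by blast
    have "poly b' s \<noteq> 0" using b'(2) by (simp add: poly_eq_0_iff_dvd)
    moreover have "f = Fract a' b'"
    proof -
      have "b' \<noteq> 0" using b' f by auto
      moreover have "a * b' = a' * b" by (subst a', subst b'(1)) (simp add: ac_simps)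
      ultimately show ?thesis using f by (simp add: eq_fract)
    qed
    ultimately show ?thesis unfolding has_value_def
      by (intro exI exI[of _ "max (degree a') (degree b')"] exI[of _ a'] exI[of _ b'])
        (auto simp: hval_def Some)
  qed
qed

definition place_eval :: "'k::field option \<Rightarrow> 'k poly fract \<Rightarrow> 'k" where
  "place_eval P f = (THE c. has_value f c P)"

lemma place_eval_eq: "has_value f c P \<Longrightarrow> place_eval P f = c"
  unfolding place_eval_def using has_value_unique by blast

lemma has_value_z_monomial:
  assumes "\<And>i. hval P 1 (y_on_L p q i) \<noteq> 0"
  shows "has_value (z_monomial p q v)
    (zpower (\<chi> i. hval P 1 (y_on_L p q (Some i)) / hval P 1 (y_on_L p q None)) v) P"
proof -
  have "has_value (L_coordinate p q i) (hval P 1 (y_on_L p q i) / hval P 1 (y_on_L p q None)) P" for i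
    unfolding has_value_def L_coordinate_def
    by (rule exI[of _ 1], rule exI[of _ "y_on_L p q i"], rule exI[of _ "y_on_L p q None"])
      (use assms in \<open>auto simp: y_on_L_def\<close>)
  then show ?thesis
    using assms unfolding z_monomial_eq_zpower zpower_def
    by (intro has_value_prod) (auto intro!: has_value_powi)
qed

section \<open>Characters of the torus T\<close>

definition tpower :: "nat \<Rightarrow> (nat \<Rightarrow> 'f::field) \<Rightarrow> (nat \<Rightarrow>\<^sub>0 int) \<Rightarrow> 'f" where
  "tpower r t u = (\<Prod>i<r. t i powi Poly_Mapping.lookup u i)"

lemma tpower_0 [simp]: "tpower r t 0 = 1"
  by (simp add: tpower_def)

lemma tpower_one [simp]: "tpower r (\<lambda>_. 1) u = 1"
  by (simp add: tpower_def)

lemma tpower_add: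
  "(\<And>i. t i \<noteq> 0) \<Longrightarrow> tpower r t (u + u') = tpower r t u * tpower r t u'"
  by (simp add: tpower_def lookup_add power_int_add prod.distrib)

lemma tpower_mult: "tpower r (\<lambda>i. s i * t i) u = tpower r s u * tpower r t u"
  by (simp add: tpower_def power_int_mult_distrib prod.distrib)

lemma tpower_nonzero: "(\<And>i. t i \<noteq> 0) \<Longrightarrow> tpower r t u \<noteq> 0"
  by (simp add: tpower_def)

section \<open>Extending characters from a semigroup to a lattice\<close>

text \<open>
  Every \<open>g\<close> in \<open>G\<close> is a difference of elements of \<open>S\<close>, and the quotient of their values depends only on
  \<open>g\<close> because \<open>c\<close> is multiplicative and invertible on \<open>S\<close>.
\<close>

lemma character_extension:
  fixes S G :: "'g::ab_group_add set" and c :: "'g \<Rightarrow> 'k::field"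
  assumes S: "submonoid S" and diff: "\<And>g. g \<in> G \<Longrightarrow> \<exists>s\<in>S. g + s \<in> S"
    and mult: "\<And>s s'. s \<in> S \<Longrightarrow> s' \<in> S \<Longrightarrow> c (s + s') = c s * c s'"
    and nonzero: "\<And>s. s \<in> S \<Longrightarrow> c s \<noteq> 0"
  shows "\<exists>\<psi>. (\<forall>g\<in>G. \<forall>s\<in>S. g + s \<in> S \<longrightarrow> c (g + s) = \<psi> g * c s) \<and>
    (\<forall>g\<in>G. \<forall>h\<in>G. g + h \<in> G \<longrightarrow> \<psi> (g + h) = \<psi> g * \<psi> h) \<and> (\<forall>g\<in>G. \<psi> g \<noteq> 0)"
proof -
  have closed: "s + s' \<in> S" if "s \<in> S" "s' \<in> S" for s s'
    using S that by (auto simp: submonoid_def)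
  define d where "d g = (SOME s. s \<in> S \<and> g + s \<in> S)" for g
  have d: "d g \<in> S" "g + d g \<in> S" if "g \<in> G" for g
    using someI_ex[of "\<lambda>s. s \<in> S \<and> g + s \<in> S"] diff[OF that] by (auto simp: d_def)
  define \<psi> where "\<psi> g = c (g + d g) / c (d g)" for g
  have ext: "c (g + s) = \<psi> g * c s" if "g \<in> G" "s \<in> S" "g + s \<in> S" for g s
  proof -
    have "c (g + s) * c (d g) = c (g + s + d g)" using mult d that by metis
    also have "\<dots> = c ((g + d g) + s)" by (simp add: ac_simps)
    also have "\<dots> = c (g + d g) * c s" using mult d that by metis
    finally show ?thesis using nonzero[OF d(1)[OF that(1)]] by (simp add: \<psi>_def field_simps)
  qed
  have hom: "\<psi> (g + h) = \<psi> g * \<psi> h" if "g \<in> G" "h \<in> G" "g + h \<in> G" for g h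
  proof -
    have "\<psi> (g + h) * (c (d g) * c (d h)) = \<psi> (g + h) * c (d g + d h)"
      using mult d that by metis
    also have "(g + h) + (d g + d h) = (g + d g) + (h + d h)" by (simp add: ac_simps)
    then have "\<psi> (g + h) * c (d g + d h) = c ((g + d g) + (h + d h))"
      using ext[of "g + h" "d g + d h"] closed d that by metis
    also have "\<dots> = \<psi> g * \<psi> h * (c (d g) * c (d h))"
      using mult[of "g + d g" "h + d h"] ext[of g "d g"] ext[of h "d h"] d that by simp
    finally show ?thesis using nonzero d that by simp
  qed
  have "\<psi> g \<noteq> 0" if "g \<in> G" for g
    using nonzero d that by (simp add: \<psi>_def)
  then show ?thesis using ext hom by blast
qed

lemma int_character:
  fixes h :: "int \<Rightarrow> 'k::field"
  assumes "\<And>a b. h (a + b) = h a * h b" "h 0 \<noteq> 0"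
  shows "h n = h 1 powi n"
proof -
  have nz: "h a \<noteq> 0" for a
    using assms(1)[of a "- a"] assms(2) by auto
  have h0: "h 0 = 1" using assms(1)[of 0 0] nz[of 0] by simp
  show ?thesis
  proof (induction n rule: int_induct[of _ 0])
    case (step1 i)
    then show ?case using assms(1)[of i 1] nz by (simp add: power_int_add)
  next
    case (step2 i)
    have "h i = h (i - 1) * h 1" using assms(1)[of "i - 1" 1] by simp
    then show ?case using step2 nz by (simp add: power_int_diff field_simps)
  qed (simp add: h0)
qed

lemma lattice_character:
  fixes \<psi> :: "(nat \<Rightarrow>\<^sub>0 int) \<times> (int ^ 'm::finite) \<Rightarrow> 'k::field" and r :: nat
  defines "G \<equiv> coords r \<times> UNIV"
  assumes hom: "\<And>g h. g \<in> G \<Longrightarrow> h \<in> G \<Longrightarrow> \<psi> (g + h) = \<psi> g * \<psi> h"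
    and nz: "\<And>g. g \<in> G \<Longrightarrow> \<psi> g \<noteq> 0" and u: "u \<in> coords r"
  shows "\<psi> (u, v) = tpower r (\<lambda>i. if i < r then \<psi> (Poly_Mapping.single i 1, 0) else 1) u
    * zpower (\<chi> i. \<psi> (0, axis i 1)) v"
proof -
  have G0: "0 \<in> G" and Gsum: "\<And>I (x :: 'i \<Rightarrow> _). (\<And>i. i \<in> I \<Longrightarrow> x i \<in> G) \<Longrightarrow> (\<Sum>i\<in>I. x i) \<in> G"
    by (auto simp: G_def zero_prod_def)
      (metis (no_types, lifting) coords_sum fst_sum mem_Sigma_iff prod.collapse UNIV_I)
  have \<psi>0: "\<psi> 0 = 1"
    using hom[OF G0 G0] nz[OF G0] by simp
  have sum: "\<psi> (\<Sum>i\<in>I. x i) = (\<Prod>i\<in>I. \<psi> (x i))" if "finite I" "\<And>i. i \<in> I \<Longrightarrow> x i \<in> G"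
    for I :: "'i set" and x
    using that
  proof (induction I rule: finite_induct)
    case (insert i I)
    have "sum x I \<in> G" by (rule Gsum) (use insert.prems in auto)
    then show ?case using hom[of "x i" "sum x I"] insert by simp
  qed (simp add: \<psi>0)
  have 1: "\<psi> (Poly_Mapping.single i n, 0) = \<psi> (Poly_Mapping.single i 1, 0) powi n" if "i < r" for i n
  proof (rule int_character)
    fix a b :: int
    show "\<psi> (Poly_Mapping.single i (a + b), 0)
        = \<psi> (Poly_Mapping.single i a, 0) * \<psi> (Poly_Mapping.single i b, 0)"
      using hom[of "(Poly_Mapping.single i a, 0)" "(Poly_Mapping.single i b, 0)"] that
      by (simp add: single_add G_def coords_single)
  qed (use nz[OF G0] in \<open>simp add: zero_prod_def\<close>)
  have 2: "\<psi> (0, axis i n) = \<psi> (0, axis i 1) powi n" for i n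
  proof (rule int_character)
    fix a b :: int
    have "axis i (a + b) = axis i a + axis i b" by (simp add: axis_def vec_eq_iff)
    then show "\<psi> (0, axis i (a + b)) = \<psi> (0, axis i a) * \<psi> (0, axis i b)"
      using hom[of "(0, axis i a)" "(0, axis i b)"] by (simp add: G_def)
  next
    have ax: "axis i (0 :: int) = 0" by (simp add: axis_def vec_eq_iff)
    show "\<psi> (0, axis i 0) \<noteq> 0" unfolding ax using nz[OF G0] by (simp add: zero_prod_def)
  qed
  have v: "v = (\<Sum>i\<in>UNIV. axis i (v $ i))"
    by (simp add: vec_eq_iff axis_def)
  have "(u, v) = (\<Sum>i<r. (Poly_Mapping.single i (Poly_Mapping.lookup u i), 0))
      + (\<Sum>i\<in>UNIV. (0, axis i (v $ i)))"
    using coords_expansion[OF u] v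
    by (intro prod_eqI) (simp_all add: fst_sum snd_sum)
  also have "\<psi> \<dots> = \<psi> (\<Sum>i<r. (Poly_Mapping.single i (Poly_Mapping.lookup u i), 0))
      * \<psi> (\<Sum>i\<in>UNIV. (0, axis i (v $ i)))"
    by (intro hom Gsum) (auto simp: G_def coords_single)
  also have "\<psi> (\<Sum>i<r. (Poly_Mapping.single i (Poly_Mapping.lookup u i), 0))
      = (\<Prod>i<r. \<psi> (Poly_Mapping.single i (Poly_Mapping.lookup u i), 0))"
    by (rule sum) (auto simp: G_def coords_single)
  also have "\<dots> = tpower r (\<lambda>i. if i < r then \<psi> (Poly_Mapping.single i 1, 0) else 1) u"
    unfolding tpower_def by (intro prod.cong refl, subst 1) auto
  also have "\<psi> (\<Sum>i\<in>UNIV. (0, axis i (v $ i))) = (\<Prod>i\<in>UNIV. \<psi> (0, axis i (v $ i)))"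
    by (rule sum) (auto simp: G_def)
  also have "\<dots> = zpower (\<chi> i. \<psi> (0, axis i 1)) v"
    unfolding zpower_def by (intro prod.cong refl, subst 2) simp
  finally show ?thesis .
qed

section \<open>Points of the line\<close>

lemma independent_minor:
  fixes p q :: "'k::field ^ 'n"
  assumes "p \<noteq> q" "vec.independent {p, q}"
  obtains i j where "p $ i * q $ j \<noteq> p $ j * q $ i"
proof (rule ccontr)
  assume no: "\<not> thesis"
  have "p \<noteq> 0" using assms(2) vec.dependent_zero by blast
  then obtain i where i: "p $ i \<noteq> 0" by (auto simp: vec_eq_iff)
  have "q = (q $ i / p $ i) *s p"
    unfolding vec_eq_iff
  proof
    fix j
    have "p $ i * q $ j = p $ j * q $ i" using no that by blast
    then show "q $ j = ((q $ i / p $ i) *s p) $ j" using i by (simp add: field_simps)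
  qed
  moreover have "(q $ i / p $ i) *s p \<in> vec.span {p}"
    by (intro vec.span_scale vec.span_base) simp
  ultimately have "q \<in> vec.span {p}" by metis
  moreover have "vec.independent (insert q {p})" using assms(2) by (simp add: insert_commute)
  ultimately show False using assms(1) vec.independent_insert[of q "{p}"] by auto
qed

text \<open>
  Cramer's rule read as an explicit parametrization: all coordinates \<open>y k\<close> are determined by two of
  them through linear forms in \<open>p k\<close> and \<open>q k\<close>, which exhibits \<open>y\<close> as a combination of \<open>p\<close> and \<open>q\<close>.
\<close>

lemma line_torus_partI:
  fixes p q :: "'k::field ^ ('m::finite option)" and y :: "'m option \<Rightarrow> 'k"
  assumes W: "W = vec.span {p, q}" and minor: "p $ i * q $ j \<noteq> p $ j * q $ i"
    and y: "\<And>k. y k \<noteq> 0" "y None = 1"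
    and cramer: "\<And>k. (p $ i * q $ j - p $ j * q $ i) * y k
      = (p $ k * q $ j - p $ j * q $ k) * y i + (p $ i * q $ k - p $ k * q $ i) * y j"
  shows "(\<chi> k. y (Some k)) \<in> line_torus_part W"
proof -
  define D where "D = p $ i * q $ j - p $ j * q $ i"
  have D: "D \<noteq> 0" using minor by (simp add: D_def)
  define w where "w = ((q $ j * y i - q $ i * y j) / D) *s p + ((p $ i * y j - p $ j * y i) / D) *s q"
  have wk: "w $ k = y k" for k
  proof -
    have "D * (w $ k) = (q $ j * y i - q $ i * y j) * p $ k + (p $ i * y j - p $ j * y i) * q $ k"
      using D by (simp add: w_def field_simps)
    also have "\<dots> = D * y k" using cramer[of k] by (simp add: D_def algebra_simps)
    finally show ?thesis using D by simp
  qed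
  have "w \<in> W" unfolding W w_def
    by (intro vec.span_add vec.span_scale vec.span_base) auto
  moreover have "(\<chi> k. y (Some k)) = (\<chi> k. w $ Some k / w $ None)"
    by (simp add: wk y)
  moreover have "\<forall>k. w $ k \<noteq> 0" using y(1) by (simp add: wk)
  ultimately show ?thesis unfolding line_torus_part_def by blast
qed

text \<open>
  The point \<open>a p + b q\<close> of \<open>W\<close> has parameter \<open>b / a\<close> on the line, or infinity if \<open>a = 0\<close>.
\<close>

lemma line_torus_part_place:
  fixes p q :: "'k::field ^ ('m::finite option)"
  assumes W: "W = vec.span {p, q}" and z: "z \<in> line_torus_part W"
  obtains P where "\<And>i. hval P 1 (y_on_L p q i) \<noteq> 0" "\<And>i. Q_pt p q i \<noteq> P"
    "z = (\<chi> i. hval P 1 (y_on_L p q (Some i)) / hval P 1 (y_on_L p q None))"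
proof -
  obtain y :: "'k ^ ('m option)" where y: "y \<in> W" "\<And>i. y $ i \<noteq> 0" "z = (\<chi> i. y $ Some i / y $ None)"
    using z by (auto simp: line_torus_part_def)
  obtain a where "y - a *s p \<in> vec.span {q}"
    using y(1) unfolding W vec.span_breakdown_eq[of y p] by blast
  then obtain b where "y - a *s p = b *s q" unfolding vec.span_singleton by blast
  then have ab: "y = a *s p + b *s q" by (simp add: diff_eq_eq add.commute)
  show thesis
  proof (cases "a = 0")
    case True
    then have b: "b \<noteq> 0" and q: "\<And>i. q $ i \<noteq> 0" using y(2) ab by auto
    show ?thesis
    proof (rule that[of None])
      show "z = (\<chi> i. hval None 1 (y_on_L p q (Some i)) / hval None 1 (y_on_L p q None))"
        using y(3) ab True b by (simp add: hval_def y_on_L_def)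
    qed (use q in \<open>auto simp: hval_def y_on_L_def Q_pt_def\<close>)
  next
    case False
    have yi: "y $ i = a * (p $ i + b / a * q $ i)" for i
      using False by (simp add: ab field_simps)
    have h: "hval (Some (b / a)) 1 (y_on_L p q i) = p $ i + b / a * q $ i" for i
      by (simp add: hval_def y_on_L_def)
    have nz: "p $ i + b / a * q $ i \<noteq> 0" for i
      using y(2)[of i] yi[of i] by auto
    show ?thesis
    proof (rule that[of "Some (b / a)"])
      fix i
      show "hval (Some (b / a)) 1 (y_on_L p q i) \<noteq> 0" using nz h by simp
      show "Q_pt p q i \<noteq> Some (b / a)"
      proof
        assume "Q_pt p q i = Some (b / a)"
        then have "q $ i \<noteq> 0" "b / a = - p $ i / q $ i" by (auto simp: Q_pt_def split: if_splits)
        then show False using nz[of i] by simp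
      qed
    next
      show "z = (\<chi> i. hval (Some (b / a)) 1 (y_on_L p q (Some i)) / hval (Some (b / a)) 1 (y_on_L p q None))"
        using False unfolding y(3) h by (simp add: vec_eq_iff yi)
    qed
  qed
qed

lemma y_on_L_nonzero:
  fixes p q :: "'k::field ^ 'n"
  assumes "meets_torus W" "W = vec.span {p, q}"
  shows "p $ i \<noteq> 0 \<or> q $ i \<noteq> 0"
proof (rule ccontr)
  assume "\<not> ?thesis"
  then have 0: "p $ i = 0" "q $ i = 0" by auto
  obtain y where y: "y \<in> W" "y $ i \<noteq> 0" using assms(1) by (auto simp: meets_torus_def)
  have "vec.subspace {x :: 'k ^ 'n. x $ i = 0}" by (auto simp: vec.subspace_def)
  then have "vec.span {p, q} \<subseteq> {x. x $ i = 0}" using 0 by (intro vec.span_minimal) auto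
  then show False using y assms(2) by blast
qed

section \<open>The points of X(L) in the torus\<close>

lemma single_in_ring_AL:
  "u \<in> dual_lattice_cone r \<sigma> \<Longrightarrow> f \<in> H0 (divisor_at p q \<Delta> u) \<Longrightarrow>
    Poly_Mapping.single u f \<in> ring_AL r \<sigma> \<Delta> p q"
  by (auto simp: ring_AL_def)

lemma algebra_point_scale:
  assumes \<xi>: "algebra_point (ring_AL r \<sigma> \<Delta> p q) \<xi>"
    and u: "u \<in> dual_lattice_cone r \<sigma>" "f \<in> H0 (divisor_at p q \<Delta> u)"
  shows "\<xi> (Poly_Mapping.single u (Fract [:c:] 1 * f)) = c * \<xi> (Poly_Mapping.single u f)"
proof -
  have "\<xi> (Poly_Mapping.single 0 (Fract [:c:] 1) * Poly_Mapping.single u f)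
      = \<xi> (Poly_Mapping.single 0 (Fract [:c:] 1)) * \<xi> (Poly_Mapping.single u f)"
    using \<xi> u single_in_ring_AL[OF dual_lattice_cone_closed(1) const_in_H0] single_in_ring_AL
    unfolding algebra_point_def by blast
  then show ?thesis using \<xi> by (simp add: mult_single algebra_point_def)
qed

text \<open>
  The monomials \<open>\<chi>\<^sup>u z\<^sup>v\<close> with \<open>(u, v)\<close> in \<open>S\<close> have nonzero values under \<open>\<xi>\<close>, as those in the range of
  \<open>H\<close> generate, so \<open>\<xi>\<close> restricts to a character of \<open>S\<close>.  Its extension \<open>\<psi>\<close> to the lattice gives the
  torus points \<open>t\<close> and \<open>z\<close>.  That \<open>z\<close> lies on \<open>L\<close> follows from the Cramer relations between three of
  the \<open>y\<^sub>i\<close>, which become relations in \<open>A(L)\<close> after multiplication with a monomial that brings all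
  three terms into the semigroup.
\<close>

lemma algebra_point_in_torus:
  fixes p q :: "'k::field ^ ('m::finite option)"
    and H :: "'h::finite \<Rightarrow> (nat \<Rightarrow>\<^sub>0 int) \<times> (int ^ 'm)"
  defines "chr \<equiv> \<lambda>s. Poly_Mapping.single (fst s) (z_monomial p q (snd s))"
  assumes W: "W = vec.span {p, q}" "meets_torus W" "p \<noteq> q" "vec.independent {p, q}"
    and S: "submonoid S" "submonoid hull (range H) = S"
    and S_H0: "\<And>u v. (u, v) \<in> S \<Longrightarrow> u \<in> coords r \<inter> dual_lattice_cone r \<sigma> \<and>
      z_monomial p q v \<in> H0 (divisor_at p q \<Delta> u)"
    and gen: "\<And>g. g \<in> coords r \<times> UNIV \<Longrightarrow> \<exists>s\<in>S. g + s \<in> S"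
    and \<xi>: "algebra_point (ring_AL r \<sigma> \<Delta> p q) \<xi>" "\<And>j. \<xi> (chr (H j)) \<noteq> 0"
  obtains t z where "\<And>i. t i \<noteq> 0" "z \<in> line_torus_part W"
    "\<And>j. \<xi> (chr (H j)) = tpower r t (fst (H j)) * zpower z (snd (H j))"
proof -
  have y: "y_on_L p q i \<noteq> 0" for i
    using y_on_L_nonzero[OF W(2,1), of i] by (auto simp: y_on_L_def)
  define \<zeta> where "\<zeta> = (\<chi> i. L_coordinate p q (Some i))"
  have \<zeta>: "\<zeta> \<in> torus"
    using y by (auto simp: \<zeta>_def torus_def L_coordinate_def Zero_fract_def eq_fract)
  have chr_A: "chr s \<in> ring_AL r \<sigma> \<Delta> p q" if "s \<in> S" for s
    using S_H0[of "fst s" "snd s"] that by (auto simp: chr_def intro: single_in_ring_AL)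
  define c where "c s = \<xi> (chr s)" for s
  have c_mult: "c (s + s') = c s * c s'" if "s \<in> S" "s' \<in> S" for s s'
  proof -
    have "chr (s + s') = chr s * chr s'"
      using zpower_add[OF \<zeta>] by (simp add: chr_def mult_single z_monomial_eq_zpower \<zeta>_def)
    then show ?thesis using \<xi>(1) chr_A that by (simp add: algebra_point_def c_def)
  qed
  have "chr 0 = Poly_Mapping.single 0 (Fract [:1:] 1)"
    by (simp add: chr_def z_monomial_eq_zpower One_fract_def one_pCons)
  then have c0: "c 0 = 1" using \<xi>(1) unfolding c_def algebra_point_def by metis
  have "submonoid (S \<inter> {s. c s \<noteq> 0})"
    using S(1) c0 c_mult by (auto simp: submonoid_def)
  moreover have "range H \<subseteq> S \<inter> {s. c s \<noteq> 0}"
    using \<xi>(2) S(2) hull_subset[of "range H" submonoid] by (auto simp: c_def)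
  ultimately have "S \<subseteq> S \<inter> {s. c s \<noteq> 0}"
    using hull_minimal[of "range H"] S(2) by metis
  then have c_nz: "c s \<noteq> 0" if "s \<in> S" for s using that by blast
  let ?G = "coords r \<times> UNIV :: ((nat \<Rightarrow>\<^sub>0 int) \<times> (int ^ 'm)) set"
  have "\<exists>\<psi>. (\<forall>g\<in>?G. \<forall>s\<in>S. g + s \<in> S \<longrightarrow> c (g + s) = \<psi> g * c s) \<and>
      (\<forall>g\<in>?G. \<forall>h\<in>?G. g + h \<in> ?G \<longrightarrow> \<psi> (g + h) = \<psi> g * \<psi> h) \<and> (\<forall>g\<in>?G. \<psi> g \<noteq> 0)"
    by (rule character_extension) (fact S(1) gen c_mult c_nz)+
  then obtain \<psi> where
    ext': "\<forall>g\<in>?G. \<forall>s\<in>S. g + s \<in> S \<longrightarrow> c (g + s) = \<psi> g * c s"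
    and hom'': "\<forall>g\<in>?G. \<forall>h\<in>?G. g + h \<in> ?G \<longrightarrow> \<psi> (g + h) = \<psi> g * \<psi> h"
    and nz': "\<forall>g\<in>?G. \<psi> g \<noteq> 0"
    by (elim exE conjE)
  have ext: "c (g + s) = \<psi> g * c s" if "g \<in> ?G" "s \<in> S" "g + s \<in> S" for g s
    using ext' that by blast
  have nz: "\<psi> g \<noteq> 0" if "g \<in> ?G" for g
    using nz' that by blast
  have hom': "\<psi> (g + h) = \<psi> g * \<psi> h" if "g \<in> ?G" "h \<in> ?G" for g h
  proof -
    have "g + h \<in> ?G" using that by auto
    then show ?thesis by (rule hom''[rule_format, OF that])
  qed
  define t where "t i = (if i < r then \<psi> (Poly_Mapping.single i 1, 0) else 1)" for i
  \<comment> \<open>The exponent of the coordinate \<open>y\<^sub>k / y\<^sub>0\<close>.\<close>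
  define E :: "'m option \<Rightarrow> (nat \<Rightarrow>\<^sub>0 int) \<times> (int ^ 'm)"
    where "E k = (case k of None \<Rightarrow> 0 | Some i \<Rightarrow> (0, axis i 1))" for k
  have EG: "E k \<in> ?G" for k by (auto simp: E_def zero_prod_def split: option.splits)
  define z where "z = (\<chi> i. \<psi> (E (Some i)))"
  have \<psi>: "\<psi> (u, v) = tpower r t u * zpower z v" if "u \<in> coords r" for u v
    using lattice_character[OF hom' nz that] by (simp add: t_def[abs_def] z_def E_def)
  obtain i j where ij: "p $ i * q $ j \<noteq> p $ j * q $ i" using independent_minor[OF W(3,4)] .
  have "z \<in> line_torus_part W"
    unfolding z_def
  proof (rule line_torus_partI[OF W(1) ij])
    show "\<psi> (E k) \<noteq> 0" for k using nz EG by blast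
    have "\<psi> (0 + 0) = \<psi> 0 * \<psi> 0" by (rule hom') (auto simp: zero_prod_def)
    moreover have "\<psi> 0 \<noteq> 0" by (rule nz) (auto simp: zero_prod_def)
    ultimately show "\<psi> (E None) = 1" by (simp add: E_def)
    fix k
    have "\<forall>l. \<exists>s\<in>S. E l + s \<in> S" using gen EG by blast
    then obtain s where s: "\<And>l. s l \<in> S" "\<And>l. E l + s l \<in> S" by metis
    \<comment> \<open>Multiplication with the monomial of \<open>b\<close> brings the three coordinate functions into \<open>A(L)\<close>.\<close>
    define b where "b = s i + s j + s k"
    have closed: "x + y \<in> S" if "x \<in> S" "y \<in> S" for x y
      using S(1) that by (auto simp: submonoid_def)
    have b: "b \<in> S" unfolding b_def using s closed by blast
    have "E i + b = (E i + s i) + (s j + s k)" "E j + b = (E j + s j) + (s i + s k)"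
      "E k + b = (E k + s k) + (s i + s j)"
      by (simp_all add: b_def ac_simps)
    then have Eb: "E l + b \<in> S" if "l \<in> {i, j, k}" for l
      using that s closed by (metis insertE emptyE)
    obtain u v where uv: "b = (u, v)" by (cases b)
    define M where "M l = z_monomial p q v * L_coordinate p q l" for l
    have chrM: "chr (E l + b) = Poly_Mapping.single u (M l)" for l
    proof (cases l)
      case None
      have "L_coordinate p q None = 1" using y by (simp add: L_coordinate_def One_fract_def eq_fract)
      then show ?thesis using None by (simp add: E_def chr_def uv M_def)
    next
      case (Some i)
      then show ?thesis
        using zpower_add[OF \<zeta>, of "axis i 1" v]
        by (simp add: E_def chr_def uv M_def z_monomial_eq_zpower zpower_axis \<zeta>_def mult.commute)
    qed
    have uD: "u \<in> dual_lattice_cone r \<sigma>" using S_H0 b uv by blast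
    have M_H0: "M l \<in> H0 (divisor_at p q \<Delta> u)" if "l \<in> {i, j, k}" for l
    proof -
      have "E l + b = (u, snd (E l + b))" by (cases l) (simp_all add: E_def uv)
      then have "z_monomial p q (snd (E l + b)) \<in> H0 (divisor_at p q \<Delta> u)"
        using S_H0 Eb[OF that] by metis
      moreover have "fst (E l + b) = u" by (cases l) (simp_all add: E_def uv)
      then have "Poly_Mapping.lookup (chr (E l + b)) u = z_monomial p q (snd (E l + b))"
        unfolding chr_def by (simp only: lookup_single_eq)
      then have "M l = z_monomial p q (snd (E l + b))" by (simp add: chrM)
      ultimately show ?thesis by simp
    qed
    define A B D where "A = p $ k * q $ j - p $ j * q $ k" and "B = p $ i * q $ k - p $ k * q $ i"
      and "D = p $ i * q $ j - p $ j * q $ i"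
    have "[:D:] * y_on_L p q k = [:A:] * y_on_L p q i + [:B:] * y_on_L p q j"
      by (simp add: y_on_L_def A_def B_def D_def algebra_simps)
    then have "Fract [:D:] 1 * L_coordinate p q k
        = Fract [:A:] 1 * L_coordinate p q i + Fract [:B:] 1 * L_coordinate p q j"
      using y by (simp add: L_coordinate_def eq_fract algebra_simps)
    then have rel: "Fract [:D:] 1 * M k = Fract [:A:] 1 * M i + Fract [:B:] 1 * M j"
      unfolding M_def by (metis mult.left_commute distrib_left)
    have sc: "\<xi> (Poly_Mapping.single u (Fract [:x:] 1 * M l)) = x * c (E l + b)"
      if "l \<in> {i, j, k}" for x l
      using algebra_point_scale[OF \<xi>(1) uD M_H0[OF that]] chrM by (simp add: c_def)
    have "Poly_Mapping.single u (Fract [:x:] 1 * M l) \<in> ring_AL r \<sigma> \<Delta> p q" if "l \<in> {i, j, k}" for x l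
      using single_in_ring_AL uD const_mult_in_H0 M_H0[OF that] by blast
    then have "\<xi> (Poly_Mapping.single u (Fract [:A:] 1 * M i) + Poly_Mapping.single u (Fract [:B:] 1 * M j))
        = A * c (E i + b) + B * c (E j + b)"
      using \<xi>(1) sc by (simp add: algebra_point_def)
    then have "D * c (E k + b) = A * c (E i + b) + B * c (E j + b)"
      using sc[of k D] by (simp add: rel single_add)
    moreover have "c (E l + b) = \<psi> (E l) * c b" if "l \<in> {i, j, k}" for l
      using ext[OF EG b Eb[OF that]] .
    ultimately have "(D * \<psi> (E k)) * c b = (A * \<psi> (E i) + B * \<psi> (E j)) * c b"
      by (simp add: algebra_simps)
    then show "D * \<psi> (E k) = A * \<psi> (E i) + B * \<psi> (E j)" using c_nz[OF b] by simp
  qed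
  moreover have "t i \<noteq> 0" for i
    using nz by (auto simp: t_def coords_single)
  moreover have "\<xi> (chr (H j)) = tpower r t (fst (H j)) * zpower z (snd (H j))" for j
  proof -
    have Hj: "H j \<in> S" using S(2) hull_subset[of "range H" submonoid] by auto
    then have "H j \<in> ?G" "0 \<in> S" using S_H0[of "fst (H j)" "snd (H j)"] S(1)
      by (auto simp: submonoid_def mem_Times_iff)
    then have "c (H j) = \<psi> (H j)" using ext[of "H j" 0] Hj c0 by simp
    then show ?thesis using \<psi>[of "fst (H j)" "snd (H j)"] \<open>H j \<in> ?G\<close>
      by (simp add: c_def mem_Times_iff)
  qed
  ultimately show ?thesis using that by blast
qed

text \<open>
  At a point \<open>P\<close> other than the \<open>Q\<^sub>i\<close> the divisors have coefficient \<open>0\<close>, so all coefficients of an element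
  of \<open>A(L)\<close> are regular at \<open>P\<close>.
\<close>

lemma evaluation_algebra_point:
  fixes p q :: "'k::field ^ ('m::finite option)"
  assumes P: "\<And>i. Q_pt p q i \<noteq> P" and t: "\<And>i. t i \<noteq> 0"
  shows "algebra_point (ring_AL r \<sigma> \<Delta> p q)
    (\<lambda>F. \<Sum>u\<in>Poly_Mapping.keys F. place_eval P (Poly_Mapping.lookup F u) * tpower r t u)"
    (is "algebra_point _ ?\<xi>")
proof -
  \<comment> \<open>The subring of \<open>K(L)[M]\<close> of elements with coefficients regular at \<open>P\<close>.\<close>
  define R where "R = {F :: (nat \<Rightarrow>\<^sub>0 int) \<Rightarrow>\<^sub>0 'k poly fract.
      \<forall>u. \<exists>c. has_value (Poly_Mapping.lookup F u) c P}"
  have A_R: "F \<in> R" if F: "F \<in> ring_AL r \<sigma> \<Delta> p q" for F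
  proof -
    have "\<exists>c. has_value (Poly_Mapping.lookup F u) c P" for u
    proof (cases "Poly_Mapping.lookup F u = 0")
      case True
      then show ?thesis using has_value_0 by metis
    next
      case False
      then have "Poly_Mapping.lookup F u \<in> H0 (divisor_at p q \<Delta> u)"
        using F by (auto simp: ring_AL_def in_keys_iff)
      then have "0 \<le> ereal (of_int (ord_at P (Poly_Mapping.lookup F u))) + divisor_at p q \<Delta> u P"
        using False by (auto simp: H0_def)
      then have "0 \<le> ord_at P (Poly_Mapping.lookup F u)"
        using P by (simp add: divisor_at_def)
      then show ?thesis using has_value_exists False by blast
    qed
    then show ?thesis by (simp add: R_def)
  qed
  have ev: "has_value (Poly_Mapping.lookup F u) (place_eval P (Poly_Mapping.lookup F u)) P"
    if F: "F \<in> R" for F u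
  proof -
    obtain c where "has_value (Poly_Mapping.lookup F u) c P" using F by (auto simp: R_def)
    then show ?thesis using place_eval_eq by metis
  qed
  have pe0 [simp]: "place_eval P 0 = 0" by (rule place_eval_eq[OF has_value_0])
  have add: "?\<xi> (F + G) = ?\<xi> F + ?\<xi> G" if "F \<in> R" "G \<in> R" for F G
    by (rule setsum_keys_plus_distrib[where f = "\<lambda>u x. place_eval P x * tpower r t u"])
      (simp_all add: place_eval_eq[OF has_value_add[OF ev[OF that(1)] ev[OF that(2)]]] distrib_right)
  have R_add: "F + G \<in> R" if "F \<in> R" "G \<in> R" for F G
    using that has_value_add unfolding R_def mem_Collect_eq lookup_add by blast
  have R_0: "0 \<in> R" using has_value_0 by (auto simp: R_def)
  have R_sum: "(\<Sum>i\<in>I. F i) \<in> R \<and> ?\<xi> (\<Sum>i\<in>I. F i) = (\<Sum>i\<in>I. ?\<xi> (F i))"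
    if "finite I" "\<And>i. i \<in> I \<Longrightarrow> F i \<in> R" for I :: "'i set" and F
    using that
  proof (induction I rule: finite_induct)
    case (insert i I)
    then show ?case using add[of "F i" "sum F I"] R_add[of "F i" "sum F I"] by simp
  qed (simp add: R_0)
  have R_single: "Poly_Mapping.single u f \<in> R" if "has_value f c P" for u f c
    using that has_value_0 by (auto simp: R_def lookup_single when_def)
  have \<xi>_single: "?\<xi> (Poly_Mapping.single u f) = place_eval P f * tpower r t u" for u f
    by (cases "f = 0") simp_all
  have mult: "?\<xi> (F * G) = ?\<xi> F * ?\<xi> G" if F: "F \<in> R" and G: "G \<in> R" for F G
  proof -
    let ?I = "Poly_Mapping.keys F \<times> Poly_Mapping.keys G"
    let ?f = "Poly_Mapping.lookup F" and ?g = "Poly_Mapping.lookup G"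
    have "F * G = (\<Sum>(u, u')\<in>?I. Poly_Mapping.single (u + u') (?f u * ?g u'))"
      by (subst poly_mapping_expansion[of F], subst poly_mapping_expansion[of G])
        (simp add: sum_product sum.cartesian_product mult_single)
    then have "?\<xi> (F * G) = (\<Sum>x\<in>?I. ?\<xi> (Poly_Mapping.single (fst x + snd x) (?f (fst x) * ?g (snd x))))"
      using R_sum[of ?I "\<lambda>x. Poly_Mapping.single (fst x + snd x) (?f (fst x) * ?g (snd x))"]
        R_single[OF has_value_mult[OF ev[OF F] ev[OF G]]] by (simp add: split_beta)
    also have "\<dots> = (\<Sum>x\<in>?I. (place_eval P (?f (fst x)) * tpower r t (fst x))
        * (place_eval P (?g (snd x)) * tpower r t (snd x)))"
      unfolding \<xi>_single
      by (simp add: place_eval_eq[OF has_value_mult[OF ev[OF F] ev[OF G]]] tpower_add[OF t] ac_simps)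
    also have "\<dots> = ?\<xi> F * ?\<xi> G"
      by (simp add: sum_product sum.cartesian_product split_beta)
    finally show ?thesis .
  qed
  have "?\<xi> (Poly_Mapping.single 0 (Fract [:c:] 1)) = c" for c
    unfolding \<xi>_single using place_eval_eq[OF has_value_const] by simp
  then show ?thesis unfolding algebra_point_def using A_R add mult by blast
qed

lemma X_L_torus:
  fixes p q :: "'k::field ^ ('m::finite option)"
    and H :: "'h::finite \<Rightarrow> (nat \<Rightarrow>\<^sub>0 int) \<times> (int ^ 'm)"
  assumes W: "W = vec.span {p, q}" "meets_torus W" "p \<noteq> q" "vec.independent {p, q}"
    and S: "submonoid S" "submonoid hull (range H) = S"
    and S_H0: "\<And>u v. (u, v) \<in> S \<Longrightarrow> u \<in> coords r \<inter> dual_lattice_cone r \<sigma> \<and>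
      z_monomial p q v \<in> H0 (divisor_at p q \<Delta> u)"
    and gen: "\<And>g. g \<in> coords r \<times> UNIV \<Longrightarrow> \<exists>s\<in>S. g + s \<in> S"
  shows "X_L r \<sigma> \<Delta> p q H \<inter> torus =
    {\<chi> j. tpower r t (fst (H j)) * zpower z (snd (H j)) | t z.
       (\<forall>i. t i \<noteq> 0) \<and> z \<in> line_torus_part W}" (is "_ = ?Z")
proof (intro equalityI subsetI)
  fix x assume "x \<in> X_L r \<sigma> \<Delta> p q H \<inter> torus"
  then obtain \<xi> where \<xi>: "algebra_point (ring_AL r \<sigma> \<Delta> p q) \<xi>"
    "x = (\<chi> j. \<xi> (Poly_Mapping.single (fst (H j)) (z_monomial p q (snd (H j)))))" "x \<in> torus"
    unfolding X_L_def by blast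
  have nz: "\<xi> (Poly_Mapping.single (fst (H j)) (z_monomial p q (snd (H j)))) \<noteq> 0" for j
    using \<xi>(2,3) by (simp add: torus_def)
  obtain t z where tz: "\<And>i. t i \<noteq> 0" "z \<in> line_torus_part W"
    "\<And>j. \<xi> (Poly_Mapping.single (fst (H j)) (z_monomial p q (snd (H j))))
      = tpower r t (fst (H j)) * zpower z (snd (H j))"
    using algebra_point_in_torus[OF W S S_H0 gen \<xi>(1) nz] by blast
  then have "x = (\<chi> j. tpower r t (fst (H j)) * zpower z (snd (H j)))" using \<xi>(2) by simp
  then show "x \<in> ?Z" using tz by blast
next
  fix x assume "x \<in> ?Z"
  then obtain t z where x: "x = (\<chi> j. tpower r t (fst (H j)) * zpower z (snd (H j)))"
    and t: "\<And>i. t i \<noteq> 0" and z: "z \<in> line_torus_part W" by blast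
  obtain P where P: "\<And>i. hval P 1 (y_on_L p q i) \<noteq> 0" "\<And>i. Q_pt p q i \<noteq> P"
    "z = (\<chi> i. hval P 1 (y_on_L p q (Some i)) / hval P 1 (y_on_L p q None))"
    using line_torus_part_place[OF W(1) z] by blast
  let ?\<xi> = "\<lambda>F. \<Sum>u\<in>Poly_Mapping.keys F. place_eval P (Poly_Mapping.lookup F u) * tpower r t u"
  have "?\<xi> (Poly_Mapping.single u (z_monomial p q v)) = tpower r t u * zpower z v" for u v
  proof -
    have "place_eval P (z_monomial p q v) = zpower z v"
      unfolding P(3) by (rule place_eval_eq[OF has_value_z_monomial[OF P(1)]])
    moreover have "place_eval P 0 = 0" by (rule place_eval_eq[OF has_value_0])
    ultimately show ?thesis by (cases "z_monomial p q v = 0") simp_all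
  qed
  then have "x = (\<chi> j. ?\<xi> (Poly_Mapping.single (fst (H j)) (z_monomial p q (snd (H j)))))"
    by (simp add: x)
  moreover have "algebra_point (ring_AL r \<sigma> \<Delta> p q) ?\<xi>"
    by (rule evaluation_algebra_point) (use P(2) t in auto)
  ultimately have "x \<in> X_L r \<sigma> \<Delta> p q H"
    unfolding X_L_def mem_Collect_eq by (intro exI conjI)
  moreover have "z \<in> torus" using P(1,3) by (simp add: torus_def)
  then have "x \<in> torus" using t by (simp add: x torus_def tpower_nonzero zpower_nonzero)
  ultimately show "x \<in> X_L r \<sigma> \<Delta> p q H \<inter> torus" by blast
qed

section \<open>Monomial maps between tori\<close>

text \<open>
  \<open>M_part H\<close> and \<open>Z_part H\<close> are the two components of the exponent map \<open>\<int>\<^sup>n \<rightarrow> M \<times> \<int>\<^sup>m\<close> that sends the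
  \<open>j\<close>-th basis vector to \<open>H j\<close>; it is dual to \<open>phi H\<close> and to the monomial map below.
\<close>

definition M_part :: "('h::finite \<Rightarrow> (nat \<Rightarrow>\<^sub>0 int) \<times> (int ^ 'm)) \<Rightarrow> int ^ 'h \<Rightarrow> (nat \<Rightarrow>\<^sub>0 int)" where
  "M_part H a = (\<Sum>j\<in>UNIV. Poly_Mapping.map ((*) (a $ j)) (fst (H j)))"

definition Z_part :: "('h::finite \<Rightarrow> (nat \<Rightarrow>\<^sub>0 int) \<times> (int ^ 'm)) \<Rightarrow> int ^ 'h \<Rightarrow> int ^ 'm" where
  "Z_part H a = (\<Sum>j\<in>UNIV. (a $ j) *s snd (H j))"

definition monomial_map :: "nat \<Rightarrow> ('h::finite \<Rightarrow> (nat \<Rightarrow>\<^sub>0 int) \<times> (int ^ 'm::finite)) \<Rightarrow>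
    (nat \<Rightarrow> 'k::field) \<Rightarrow> 'k ^ 'm \<Rightarrow> 'k ^ 'h" where
  "monomial_map r H t z = (\<chi> j. tpower r t (fst (H j)) * zpower z (snd (H j)))"

lemma M_part_add: "M_part H (a + b) = M_part H a + M_part H b"
  by (rule poly_mapping_eqI) (simp add: M_part_def lookup_sum lookup_add distrib_right sum.distrib)

lemma Z_part_add: "Z_part H (a + b) = Z_part H a + Z_part H b"
  by (simp add: Z_part_def vec_eq_iff distrib_right sum.distrib)

lemma M_part_scale: "M_part H (c *s a) = Poly_Mapping.map ((*) c) (M_part H a)"
  by (rule poly_mapping_eqI) (simp add: M_part_def lookup_sum sum_distrib_left mult.assoc)

lemma Z_part_scale: "Z_part H (c *s a) = c *s Z_part H a"
  by (simp add: Z_part_def vec_eq_iff sum_distrib_left mult.assoc)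

lemma M_part_0 [simp]: "M_part H 0 = 0" and Z_part_0 [simp]: "Z_part H 0 = 0"
  using M_part_add[of H 0 0] Z_part_add[of H 0 0] by simp_all

lemma M_part_minus: "M_part H (- a) = - M_part H a" and Z_part_minus: "Z_part H (- a) = - Z_part H a"
  using M_part_add[of H a "- a"] Z_part_add[of H a "- a"] by (simp_all add: add_eq_0_iff)

lemma M_part_sum: "M_part H (\<Sum>i\<in>I. a i) = (\<Sum>i\<in>I. M_part H (a i))"
  and Z_part_sum: "Z_part H (\<Sum>i\<in>I. a i) = (\<Sum>i\<in>I. Z_part H (a i))"
  by (induction I rule: infinite_finite_induct) (simp_all add: M_part_add Z_part_add)

lemma M_part_axis: "M_part H (axis j 1) = fst (H j)"
proof -
  have "M_part H (axis j 1) = (\<Sum>i\<in>UNIV. if i = j then fst (H i) else 0)"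
    unfolding M_part_def
    by (intro sum.cong refl) (auto simp: axis_def intro!: poly_mapping_eqI)
  then show ?thesis by simp
qed

lemma Z_part_axis: "Z_part H (axis j 1) = snd (H j)"
proof -
  have "Z_part H (axis j 1) = (\<Sum>i\<in>UNIV. if i = j then snd (H i) else 0)"
    unfolding Z_part_def by (intro sum.cong refl) (auto simp: axis_def vec_eq_iff)
  then show ?thesis by simp
qed

lemma zpair_phi: "zpair (phi H x) a = npair (fst x) (M_part H a) + zpair (snd x) (Z_part H a)"
  by (simp add: M_part_def Z_part_def npair_sum_right zpair_sum_right npair_scale_right
      zpair_scale_right flip: sum.distrib) (simp add: zpair_def phi_def distrib_left mult.commute)

lemma zpower_monomial_map:
  assumes "\<And>i. t i \<noteq> 0" "z \<in> torus"
  shows "zpower (monomial_map r H t z) a = tpower r t (M_part H a) * zpower z (Z_part H a)"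
proof -
  have powi_sum: "x powi (\<Sum>j\<in>J. n j) = (\<Prod>j\<in>J. x powi n j)" if "x \<noteq> 0"
    for x :: 'a and J :: "'j set" and n
    using that by (induction J rule: infinite_finite_induct) (simp_all add: power_int_add)
  have prod_powi: "(\<Prod>i\<in>I. x i) powi n = (\<Prod>i\<in>I. x i powi n)"
    for x :: "'j \<Rightarrow> 'a" and I n
    by (induction I rule: infinite_finite_induct) (simp_all add: power_int_mult_distrib)
  have "tpower r t (M_part H a) = (\<Prod>j\<in>UNIV. tpower r t (fst (H j)) powi (a $ j))"
    unfolding tpower_def M_part_def lookup_sum lookup_scale powi_sum[OF assms(1)] prod_powi
    by (subst prod.swap) (simp add: power_int_mult mult.commute flip: power_int_mult)
  moreover have "zpower z (Z_part H a) = (\<Prod>j\<in>UNIV. zpower z (snd (H j)) powi (a $ j))"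
    using assms(2) unfolding zpower_def Z_part_def sum_component vector_smult_component prod_powi
    by (subst prod.swap) (simp add: torus_def powi_sum mult.commute flip: power_int_mult)
  ultimately show ?thesis
    unfolding zpower_def[of "monomial_map r H t z"]
    by (simp add: monomial_map_def power_int_mult_distrib prod.distrib)
qed

text \<open>
  The differences of elements of the semigroup exhaust the lattice, and the image of the exponent map
  contains the semigroup and is closed under differences.
\<close>

lemma exponents_generate:
  fixes H :: "'h::finite \<Rightarrow> (nat \<Rightarrow>\<^sub>0 int) \<times> (int ^ 'm)"
  assumes S: "submonoid hull (range H) = S" and gen: "\<exists>s\<in>S. g + s \<in> S"
  shows "\<exists>a. M_part H a = fst g \<and> Z_part H a = snd g"
proof -
  let ?R = "{(M_part H a, Z_part H a) | a. True}"
  have "submonoid ?R"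
    unfolding submonoid_def
  proof (intro conjI ballI)
    show "0 \<in> ?R" by (auto simp: zero_prod_def intro!: exI[of _ 0])
    fix x y assume "x \<in> ?R" "y \<in> ?R"
    then obtain a b where "x = (M_part H a, Z_part H a)" "y = (M_part H b, Z_part H b)" by blast
    then have "x + y = (M_part H (a + b), Z_part H (a + b))" by (simp add: M_part_add Z_part_add)
    then show "x + y \<in> ?R" by blast
  qed
  moreover have "range H \<subseteq> ?R"
  proof
    fix x assume "x \<in> range H"
    then obtain j where "x = H j" by blast
    then have "x = (M_part H (axis j 1), Z_part H (axis j 1))" by (simp add: M_part_axis Z_part_axis)
    then show "x \<in> ?R" by blast
  qed
  ultimately have SR: "S \<subseteq> ?R" using S hull_minimal[of "range H" ?R submonoid] by simp
  obtain s where "s \<in> S" "g + s \<in> S" using gen by blast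
  then have "s \<in> ?R" "g + s \<in> ?R" using SR by auto
  then obtain a b where "s = (M_part H a, Z_part H a)" "g + s = (M_part H b, Z_part H b)" by blast
  then have "M_part H (b + - a) = fst g" "Z_part H (b + - a) = snd g"
    unfolding M_part_add Z_part_add M_part_minus Z_part_minus
    by (metis fst_add fst_conv diff_conv_add_uminus add_diff_cancel_right',
        metis snd_add snd_conv diff_conv_add_uminus add_diff_cancel_right')
  then show ?thesis by blast
qed

section \<open>Independence of characters\<close>

text \<open>
  A root of \<open>x (x\<^sup>n - 1) + 1\<close>.
\<close>

lemma alg_closed_not_root_of_unity:
  assumes "0 < n"
  obtains x :: "'k::alg_closed_field" where "x \<noteq> 0" "x ^ n \<noteq> 1"
proof -
  let ?f = "monom 1 (Suc n) - monom 1 1 + 1 :: 'k poly"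
  have "coeff ?f (Suc n) = 1" using assms by (simp add: coeff_1)
  then have "degree ?f > 0" using le_degree[of ?f "Suc n"] by simp
  then obtain x where x: "poly ?f x = 0" using alg_closed_imp_poly_has_root by blast
  then have "x * x ^ n - x + 1 = 0" by (simp add: poly_monom)
  then have "x \<noteq> 0" "x ^ n \<noteq> 1" by auto
  then show ?thesis using that by blast
qed

lemma tpower_separates:
  assumes "u \<in> coords r" "u' \<in> coords r" "u \<noteq> u'"
  obtains s :: "nat \<Rightarrow> 'k::alg_closed_field" where "\<And>i. s i \<noteq> 0" "tpower r s u \<noteq> tpower r s u'"
proof -
  obtain i where i: "Poly_Mapping.lookup u i \<noteq> Poly_Mapping.lookup u' i"
    using assms(3) by (auto simp: poly_mapping_eq_iff fun_eq_iff)
  have ir: "i < r"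
  proof (rule ccontr)
    assume "\<not> i < r"
    then have "Poly_Mapping.lookup u i = 0" "Poly_Mapping.lookup u' i = 0"
      using assms(1,2) by (simp_all add: coords_iff)
    then show False using i by simp
  qed
  define n where "n = nat \<bar>Poly_Mapping.lookup u i - Poly_Mapping.lookup u' i\<bar>"
  have "0 < n" using i by (simp add: n_def)
  then obtain x :: 'k where x: "x \<noteq> 0" "x ^ n \<noteq> 1" by (rule alg_closed_not_root_of_unity)
  define s where "s j = (if j = i then x else 1)" for j
  have s: "tpower r s w = x powi Poly_Mapping.lookup w i" for w
  proof -
    have "tpower r s w = (\<Prod>j<r. if j = i then x powi Poly_Mapping.lookup w i else 1)"
      unfolding tpower_def by (intro prod.cong) (auto simp: s_def)
    then show ?thesis using ir by simp
  qed
  have neq: "x powi a \<noteq> x powi b" if "n = nat \<bar>a - b\<bar>" for a b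
  proof
    assume eq: "x powi a = x powi b"
    have "x powi (a - b) = 1" "x powi (b - a) = 1" using eq x by (simp_all add: power_int_diff)
    then have "x powi \<bar>a - b\<bar> = 1" by (cases "a \<le> b") (simp_all add: abs_if)
    then show False using x(2) that by (simp add: power_int_def)
  qed
  have "s j \<noteq> 0" for j using x by (simp add: s_def)
  moreover have "tpower r s u \<noteq> tpower r s u'" unfolding s by (rule neq[OF n_def])
  ultimately show ?thesis by (rule that)
qed

text \<open>
  Dedekind's argument: substituting \<open>s t\<close> for \<open>t\<close> and subtracting \<open>tpower r s w\<close> times the original
  relation eliminates the character \<open>w\<close>; a suitable \<open>s\<close> keeps the coefficient at \<open>v\<close> alive.
\<close>

lemma tpower_independent:
  fixes c :: "(nat \<Rightarrow>\<^sub>0 int) \<Rightarrow> 'k::alg_closed_field"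
  assumes "finite B" "B \<subseteq> coords r"
    and "\<And>t. (\<And>i. t i \<noteq> 0) \<Longrightarrow> (\<Sum>u\<in>B. c u * tpower r t u) = 0" and "u \<in> B"
  shows "c u = 0"
  using assms
proof (induction B arbitrary: c u rule: finite_induct)
  case (insert w B)
  have B0: "c v = 0" if v: "v \<in> B" for v
  proof -
    have "v \<noteq> w" using v insert.hyps by blast
    then obtain s :: "nat \<Rightarrow> 'k" where s: "\<And>i. s i \<noteq> 0" "tpower r s v \<noteq> tpower r s w"
      using tpower_separates[of v r w] insert.prems(1) v by blast
    have "c v * (tpower r s v - tpower r s w) = 0"
    proof (rule insert.IH[where c = "\<lambda>v. c v * (tpower r s v - tpower r s w)"])
      fix t :: "nat \<Rightarrow> 'k" assume t: "\<And>i. t i \<noteq> 0"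
      have "(\<Sum>u\<in>insert w B. c u * tpower r (\<lambda>i. s i * t i) u) = 0"
        by (rule insert.prems(2)) (simp add: s t)
      moreover have "(\<Sum>u\<in>insert w B. c u * tpower r t u) = 0"
        by (rule insert.prems(2)) (simp add: t)
      ultimately have "(\<Sum>u\<in>insert w B. c u * tpower r (\<lambda>i. s i * t i) u)
          - tpower r s w * (\<Sum>u\<in>insert w B. c u * tpower r t u) = 0" by simp
      then have "(\<Sum>u\<in>insert w B. c u * (tpower r s u - tpower r s w) * tpower r t u) = 0"
        unfolding sum_distrib_left sum_subtractf[symmetric] by (simp add: tpower_mult algebra_simps)
      then show "(\<Sum>u\<in>B. c u * (tpower r s u - tpower r s w) * tpower r t u) = 0"
        using insert.hyps by simp
    qed (use insert.prems v in auto)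
    then show ?thesis using s by simp
  qed
  have "(\<Sum>u\<in>insert w B. c u * tpower r (\<lambda>_. 1) u) = 0" by (rule insert.prems(2)) simp
  then have "c w = 0" using insert.hyps B0 by simp
  then show ?case using B0 insert.prems(3) by blast
qed simp

section \<open>Push-forward and slices of Laurent polynomials\<close>

lemma laurent_eval_zpower:
  "laurent_eval f x = (\<Sum>a\<in>Poly_Mapping.keys f. Poly_Mapping.lookup f a * zpower x a)"
  by (simp add: laurent_eval_def zpower_def)

lemma laurent_eval_add: "laurent_eval (f + g) x = laurent_eval f x + laurent_eval g x"
  unfolding laurent_eval_zpower
  by (rule setsum_keys_plus_distrib[where f = "\<lambda>a c. c * zpower x a"]) (simp_all add: distrib_right)

lemma laurent_eval_0 [simp]: "laurent_eval 0 x = 0"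
  by (simp add: laurent_eval_def)

lemma laurent_eval_single: "laurent_eval (Poly_Mapping.single a c) x = c * zpower x a"
  by (cases "c = 0") (simp_all add: laurent_eval_zpower)

lemma laurent_eval_sum: "laurent_eval (\<Sum>i\<in>I. f i) x = (\<Sum>i\<in>I. laurent_eval (f i) x)"
  by (induction I rule: infinite_finite_induct) (simp_all add: laurent_eval_add)

text \<open>
  The map of group algebras induced by a map of exponents.
\<close>

definition push :: "('a \<Rightarrow> 'b) \<Rightarrow> ('a \<Rightarrow>\<^sub>0 'k::comm_monoid_add) \<Rightarrow> ('b \<Rightarrow>\<^sub>0 'k)" where
  "push g f = (\<Sum>a\<in>Poly_Mapping.keys f. Poly_Mapping.single (g a) (Poly_Mapping.lookup f a))"

lemma push_0 [simp]: "push g 0 = 0"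
  by (simp add: push_def)

lemma push_single: "push g (Poly_Mapping.single a c) = Poly_Mapping.single (g a) c"
  by (cases "c = 0") (simp_all add: push_def)

lemma push_add: "push g (f + h) = push g f + push g h"
  unfolding push_def
  by (rule setsum_keys_plus_distrib[where f = "\<lambda>a c. Poly_Mapping.single (g a) c"])
    (simp_all add: single_add)

lemma push_sum: "push g (\<Sum>i\<in>I. f i) = (\<Sum>i\<in>I. push g (f i))"
  by (induction I rule: infinite_finite_induct) (simp_all add: push_add)

lemma push_mult:
  fixes f h :: "'a::monoid_add \<Rightarrow>\<^sub>0 'k::comm_ring_1"
  assumes "\<And>a b. g (a + b) = g a + (g b :: 'b::monoid_add)"
  shows "push g (f * h) = push g f * push g h"
proof -
  have "f * h = (\<Sum>a\<in>Poly_Mapping.keys f. \<Sum>b\<in>Poly_Mapping.keys h.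
      Poly_Mapping.single (a + b) (Poly_Mapping.lookup f a * Poly_Mapping.lookup h b))"
    by (subst poly_mapping_expansion[of f], subst poly_mapping_expansion[of h])
      (simp add: sum_product mult_single)
  then have "push g (f * h) = (\<Sum>a\<in>Poly_Mapping.keys f. \<Sum>b\<in>Poly_Mapping.keys h.
      Poly_Mapping.single (g a + g b) (Poly_Mapping.lookup f a * Poly_Mapping.lookup h b))"
    by (simp add: push_sum push_single assms)
  then show ?thesis by (simp add: push_def sum_product mult_single)
qed

lemma lookup_push_inj:
  assumes "inj g"
  shows "Poly_Mapping.lookup (push g f) (g a) = Poly_Mapping.lookup f a"
  using assms by (simp add: push_def lookup_sum lookup_single when_def inj_eq in_keys_iff)

lemma keys_push_inj:
  assumes "inj g"
  shows "Poly_Mapping.keys (push g f) = g ` Poly_Mapping.keys f"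
proof -
  have "Poly_Mapping.lookup (push g f) b = 0" if "b \<notin> g ` Poly_Mapping.keys f" for b
    using that by (auto simp: push_def lookup_sum lookup_single when_def intro!: sum.neutral)
  then have "Poly_Mapping.keys (push g f) \<subseteq> g ` Poly_Mapping.keys f"
    by (meson in_keys_iff subsetI)
  moreover have "g ` Poly_Mapping.keys f \<subseteq> Poly_Mapping.keys (push g f)"
    by (auto simp: in_keys_iff lookup_push_inj[OF assms])
  ultimately show ?thesis by (rule equalityI)
qed

text \<open>
  The component of \<open>f\<close> of degree \<open>u\<close> in \<open>M\<close> under substitution of the monomial map, regarded as a Laurent
  polynomial on the torus of \<open>z\<close>.
\<close>

definition slice :: "('h::finite \<Rightarrow> (nat \<Rightarrow>\<^sub>0 int) \<times> (int ^ 'm)) \<Rightarrow> (nat \<Rightarrow>\<^sub>0 int) \<Rightarrow>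
    ('k::field, 'h) laurent \<Rightarrow> ('k, 'm) laurent" where
  "slice H u f = (\<Sum>a\<in>Poly_Mapping.keys f.
     Poly_Mapping.single (Z_part H a) (if M_part H a = u then Poly_Mapping.lookup f a else 0))"

lemma slice_0 [simp]: "slice H u 0 = 0"
  by (simp add: slice_def)

lemma slice_single:
  "slice H u (Poly_Mapping.single a c) = (if M_part H a = u then Poly_Mapping.single (Z_part H a) c else 0)"
  by (cases "c = 0") (simp_all add: slice_def)

lemma slice_add: "slice H u (f + h) = slice H u f + slice H u h"
  unfolding slice_def
  by (rule setsum_keys_plus_distrib[where
        f = "\<lambda>a c. Poly_Mapping.single (Z_part H a) (if M_part H a = u then c else 0)"])
    (simp_all add: single_add)

lemma slice_sum: "slice H u (\<Sum>i\<in>I. f i) = (\<Sum>i\<in>I. slice H u (f i))"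
  by (induction I rule: infinite_finite_induct) (simp_all add: slice_add)

lemma slice_mult_single:
  "slice H u (Poly_Mapping.single b c * f) = Poly_Mapping.single (Z_part H b) c * slice H (u - M_part H b) f"
proof -
  have "slice H u (Poly_Mapping.single b c * f)
      = (\<Sum>a\<in>Poly_Mapping.keys f. slice H u (Poly_Mapping.single (b + a) (c * Poly_Mapping.lookup f a)))"
    by (subst poly_mapping_expansion[of f]) (simp add: sum_distrib_left mult_single slice_sum)
  also have "\<dots> = (\<Sum>a\<in>Poly_Mapping.keys f. Poly_Mapping.single (Z_part H b) c *
      Poly_Mapping.single (Z_part H a) (if M_part H a = u - M_part H b then Poly_Mapping.lookup f a else 0))"
    by (intro sum.cong refl)
      (auto simp: slice_single M_part_add Z_part_add mult_single algebra_simps)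
  finally show ?thesis by (simp add: slice_def sum_distrib_left)
qed

lemma lookup_slice:
  "Poly_Mapping.lookup (slice H u f) v =
    (\<Sum>a\<in>{a \<in> Poly_Mapping.keys f. M_part H a = u \<and> Z_part H a = v}. Poly_Mapping.lookup f a)"
proof -
  have "Poly_Mapping.lookup (slice H u f) v = (\<Sum>a\<in>Poly_Mapping.keys f.
      if M_part H a = u \<and> Z_part H a = v then Poly_Mapping.lookup f a else 0)"
    unfolding slice_def lookup_sum by (intro sum.cong) (auto simp: lookup_single when_def)
  then show ?thesis by (simp add: sum.inter_filter)
qed

section \<open>Initial ideals\<close>

lemma lookup_initial_form:
  "Poly_Mapping.lookup (initial_form w f) a =
    (if \<forall>b\<in>Poly_Mapping.keys f. zpair w a \<le> zpair w b then Poly_Mapping.lookup f a else 0)"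
  by (auto simp: initial_form_def lookup_sum lookup_single when_def in_keys_iff)

lemma keys_initial_form:
  "Poly_Mapping.keys (initial_form w f) =
    {a \<in> Poly_Mapping.keys f. \<forall>b\<in>Poly_Mapping.keys f. zpair w a \<le> zpair w b}"
  by (auto simp: in_keys_iff lookup_initial_form split: if_splits)

lemma ring_ideal_initial_ideal: "ring_ideal (initial_ideal w I)"
  unfolding initial_ideal_def by (rule hull_in) (auto simp: ring_ideal_def)

lemma initial_ideal_incl: "f \<in> I \<Longrightarrow> initial_form w f \<in> initial_ideal w I"
  unfolding initial_ideal_def by (intro hull_inc imageI)

lemma initial_ideal_minimal:
  "ring_ideal T \<Longrightarrow> (\<And>f. f \<in> I \<Longrightarrow> initial_form w f \<in> T) \<Longrightarrow> initial_ideal w I \<subseteq> T"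
  unfolding initial_ideal_def by (intro hull_minimal) auto

lemma ring_ideal_sum: "ring_ideal J \<Longrightarrow> (\<And>i. i \<in> I \<Longrightarrow> f i \<in> J) \<Longrightarrow> (\<Sum>i\<in>I. f i) \<in> J"
  by (induction I rule: infinite_finite_induct) (auto simp: ring_ideal_def)

text \<open>
  An injective map of exponents merges no terms, so it only relabels those of minimal weight.
\<close>

lemma initial_form_push:
  assumes "inj g" "\<And>a. zpair w (g a) = zpair w' a"
  shows "initial_form w (push g f) = push g (initial_form w' f)"
proof (rule poly_mapping_eqI)
  fix b
  show "Poly_Mapping.lookup (initial_form w (push g f)) b
      = Poly_Mapping.lookup (push g (initial_form w' f)) b"
  proof (cases "b \<in> range g")
    case True
    then show ?thesis
      using assms by (auto simp: lookup_initial_form lookup_push_inj keys_push_inj)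
  next
    case False
    then have "b \<notin> Poly_Mapping.keys (initial_form w (push g f))"
      "b \<notin> Poly_Mapping.keys (push g (initial_form w' f))"
      using assms(1) by (auto simp: keys_initial_form keys_push_inj)
    then show ?thesis by (simp add: in_keys_iff)
  qed
qed

text \<open>
  The weight \<open>w\<close> of a term of \<open>f\<close> depends only on its image under the exponent map.  Hence the slice of
  \<open>initial_form w f\<close> consists of the terms of \<open>slice H u f\<close> whose weight is a fixed number, which bounds
  the weights of all its terms from below: these are the terms of minimal weight, or there are none
  of that weight.  Terms of \<open>f\<close> with the same image may cancel in the slice, which is why the second case
  can occur.
\<close>

lemma slice_initial_form:
  assumes w: "w = phi H (n, w')"
  shows "slice H u (initial_form w f) \<in> {0, initial_form w' (slice H u f)}"
proof -
  have wt: "zpair w a = npair n (M_part H a) + zpair w' (Z_part H a)" for a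
    by (simp add: w zpair_phi)
  \<comment> \<open>A term \<open>z\<^sup>v\<close> of the slice comes from terms of \<open>f\<close> that all have minimal weight.\<close>
  define low where "low v \<longleftrightarrow> (\<forall>b\<in>Poly_Mapping.keys f. npair n u + zpair w' v \<le> zpair w b)" for v
  have key: "\<exists>a\<in>Poly_Mapping.keys f. M_part H a = u \<and> Z_part H a = v"
    if "v \<in> Poly_Mapping.keys (slice H u f)" for v
  proof (rule ccontr)
    assume "\<not> ?thesis"
    then have empty: "{a \<in> Poly_Mapping.keys f. M_part H a = u \<and> Z_part H a = v} = {}" by blast
    have "Poly_Mapping.lookup (slice H u f) v = 0" unfolding lookup_slice empty by simp
    then show False using that by (simp add: in_keys_iff)
  qed
  have in_slice: "Poly_Mapping.lookup (slice H u (initial_form w f)) v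
      = (if low v then Poly_Mapping.lookup (slice H u f) v else 0)" for v
  proof -
    have "{a \<in> Poly_Mapping.keys (initial_form w f). M_part H a = u \<and> Z_part H a = v}
        = (if low v then {a \<in> Poly_Mapping.keys f. M_part H a = u \<and> Z_part H a = v} else {})"
      by (auto simp: keys_initial_form low_def wt)
    then show ?thesis
      by (auto simp: lookup_slice lookup_initial_form low_def wt intro!: sum.cong)
  qed
  show ?thesis
  proof (cases "\<exists>v\<in>Poly_Mapping.keys (slice H u f). low v")
    case False
    then have "slice H u (initial_form w f) = 0"
      by (intro poly_mapping_eqI) (auto simp: in_slice in_keys_iff)
    then show ?thesis by simp
  next
    case True
    then obtain v0 where v0: "v0 \<in> Poly_Mapping.keys (slice H u f)" "low v0" by blast
    have "low v \<longleftrightarrow> (\<forall>v'\<in>Poly_Mapping.keys (slice H u f). zpair w' v \<le> zpair w' v')"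
      if "v \<in> Poly_Mapping.keys (slice H u f)" for v
    proof
      assume low: "low v"
      show "\<forall>v'\<in>Poly_Mapping.keys (slice H u f). zpair w' v \<le> zpair w' v'"
      proof
        fix v' assume "v' \<in> Poly_Mapping.keys (slice H u f)"
        then obtain a where "a \<in> Poly_Mapping.keys f" "M_part H a = u" "Z_part H a = v'"
          using key by blast
        then show "zpair w' v \<le> zpair w' v'" using low by (auto simp: low_def wt)
      qed
    next
      assume "\<forall>v'\<in>Poly_Mapping.keys (slice H u f). zpair w' v \<le> zpair w' v'"
      then show "low v" using v0 by (auto simp: low_def intro: order_trans[OF add_left_mono])
    qed
    then have "slice H u (initial_form w f) = initial_form w' (slice H u f)"
      by (intro poly_mapping_eqI) (auto simp: in_slice lookup_initial_form in_keys_iff)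
    then show ?thesis by simp
  qed
qed

section \<open>Tropicalization of a monomial image\<close>

text \<open>
  Pulled back along the monomial map, \<open>f\<close> is a combination of the characters \<open>u\<close> of \<open>T\<close> with coefficients
  the values of the slices at \<open>z\<close>; as it vanishes for all \<open>t\<close>, all coefficients vanish.
\<close>

lemma slice_vanishing:
  fixes Y :: "('k::alg_closed_field ^ 'm::finite) set" and H :: "'h::finite \<Rightarrow> (nat \<Rightarrow>\<^sub>0 int) \<times> (int ^ 'm)"
  assumes Y: "Y \<subseteq> torus" and H: "\<And>j. fst (H j) \<in> coords r"
    and f: "f \<in> vanishing_ideal {monomial_map r H t z | t z. (\<forall>i. t i \<noteq> 0) \<and> z \<in> Y}"
  shows "slice H u f \<in> vanishing_ideal Y"
proof -
  have "laurent_eval (slice H u f) z = 0" if z: "z \<in> Y" for z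
  proof (cases "u \<in> M_part H ` Poly_Mapping.keys f")
    case True
    let ?B = "M_part H ` Poly_Mapping.keys f"
    have sl: "laurent_eval (slice H u' f) z
        = (\<Sum>a\<in>{a \<in> Poly_Mapping.keys f. M_part H a = u'}. Poly_Mapping.lookup f a * zpower z (Z_part H a))"
      for u'
      by (simp add: slice_def laurent_eval_sum laurent_eval_single sum.inter_filter
          if_distrib[of "\<lambda>x. x * _"] cong: if_cong)
    show ?thesis
    proof (rule tpower_independent[where c = "\<lambda>u. laurent_eval (slice H u f) z" and B = ?B and r = r])
      show "?B \<subseteq> coords r" using H by (auto simp: M_part_def)
      fix t :: "nat \<Rightarrow> 'k" assume t: "\<And>i. t i \<noteq> 0"
      have "0 = laurent_eval f (monomial_map r H t z)"
        using f t z by (auto simp: vanishing_ideal_def)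
      also have "\<dots> = (\<Sum>a\<in>Poly_Mapping.keys f.
          Poly_Mapping.lookup f a * (tpower r t (M_part H a) * zpower z (Z_part H a)))"
        using zpower_monomial_map[of t z r H] t z Y by (auto simp: laurent_eval_zpower)
      also have "\<dots> = (\<Sum>u\<in>?B. \<Sum>a\<in>{a \<in> Poly_Mapping.keys f. M_part H a = u}.
          Poly_Mapping.lookup f a * (tpower r t (M_part H a) * zpower z (Z_part H a)))"
        by (rule sum.image_gen) simp
      also have "\<dots> = (\<Sum>u\<in>?B. laurent_eval (slice H u f) z * tpower r t u)"
        unfolding sl sum_distrib_right by (intro sum.cong refl) (auto simp: ac_simps)
      finally show "(\<Sum>u\<in>?B. laurent_eval (slice H u f) z * tpower r t u) = 0" by simp
    qed (use True in auto)
  next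
    case False
    then have "slice H u f = 0" unfolding slice_def by (intro sum.neutral) auto
    then show ?thesis by simp
  qed
  then show ?thesis by (simp add: vanishing_ideal_def)
qed

text \<open>
  The hypothesis \<open>gen\<close> says that the exponent map is onto \<open>M \<times> \<int>\<^sup>m\<close>, so that \<open>X\<close> is an isomorphic copy
  of \<open>T \<times> Y\<close>.
\<close>

lemma Trop_monomial_image:
  fixes Y :: "('k::alg_closed_field ^ 'm::finite) set" and H :: "'h::finite \<Rightarrow> (nat \<Rightarrow>\<^sub>0 int) \<times> (int ^ 'm)"
  assumes Y: "Y \<subseteq> torus" and H: "\<And>j. fst (H j) \<in> coords r"
    and gen: "\<And>u v. u \<in> coords r \<Longrightarrow> \<exists>a. M_part H a = u \<and> Z_part H a = v"
    and X: "X = {monomial_map r H t z | t z. (\<forall>i. t i \<noteq> 0) \<and> z \<in> Y}"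
  shows "Trop X = phi H ` (coords r \<times> Trop Y)"
proof -
  let ?I = "vanishing_ideal X" and ?J = "vanishing_ideal Y"
  have "\<forall>i. \<exists>a. i < r \<longrightarrow> M_part H a = Poly_Mapping.single i 1 \<and> Z_part H a = 0"
    using gen coords_single by blast
  then obtain kM where kM: "\<And>i. i < r \<Longrightarrow> M_part H (kM i) = Poly_Mapping.single i 1"
    "\<And>i. i < r \<Longrightarrow> Z_part H (kM i) = 0" by metis
  have "\<forall>i. \<exists>a. M_part H a = 0 \<and> Z_part H a = axis i 1" using gen by blast
  then obtain kZ where kZ: "\<And>i. M_part H (kZ i) = 0" "\<And>i. Z_part H (kZ i) = axis i 1" by metis
  \<comment> \<open>A homomorphic section of the exponent map over \<open>0 \<times> \<int>\<^sup>m\<close>.\<close>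
  define \<kappa> where "\<kappa> v = (\<Sum>i\<in>UNIV. (v $ i) *s kZ i)" for v :: "int ^ 'm"
  have \<kappa>: "M_part H (\<kappa> v) = 0" "Z_part H (\<kappa> v) = v" for v
  proof -
    show "M_part H (\<kappa> v) = 0"
      by (rule poly_mapping_eqI) (simp add: \<kappa>_def M_part_sum M_part_scale kZ lookup_sum)
    show "Z_part H (\<kappa> v) = v"
      by (simp add: \<kappa>_def Z_part_sum Z_part_scale kZ vec_eq_iff axis_def
          if_distrib[of "(*) _"] cong: if_cong)
  qed
  have \<kappa>_add: "\<kappa> (v + v') = \<kappa> v + \<kappa> v'" for v v'
    by (simp add: \<kappa>_def vec_eq_iff distrib_right sum.distrib)
  have \<kappa>_inj: "inj \<kappa>" using \<kappa>(2) by (metis injI)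
  have push_I: "push \<kappa> f \<in> ?I" if "f \<in> ?J" for f
  proof -
    have "laurent_eval (push \<kappa> f) x = 0" if x: "x \<in> X" for x
    proof -
      obtain t z where tz: "x = monomial_map r H t z" "\<And>i. t i \<noteq> 0" "z \<in> Y" using x X by blast
      have "laurent_eval (push \<kappa> f) x = laurent_eval f z"
        using zpower_monomial_map[of t z r H] tz Y
        by (auto simp: push_def laurent_eval_sum laurent_eval_single laurent_eval_zpower[of f] \<kappa>)
      then show ?thesis using \<open>f \<in> ?J\<close> tz(3) by (simp add: vanishing_ideal_def)
    qed
    then show ?thesis by (simp add: vanishing_ideal_def)
  qed
  have same: "(\<exists>a. Poly_Mapping.single a 1 \<in> initial_ideal w ?I)
      \<longleftrightarrow> (\<exists>b. Poly_Mapping.single b 1 \<in> initial_ideal w' ?J)" if w: "w = phi H (n, w')" for w n w'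
  proof
    assume "\<exists>b. Poly_Mapping.single b 1 \<in> initial_ideal w' ?J"
    then obtain b where b: "Poly_Mapping.single b 1 \<in> initial_ideal w' ?J" by blast
    have ideal: "ring_ideal (initial_ideal w ?I)" by (rule ring_ideal_initial_ideal)
    have "initial_ideal w' ?J \<subseteq> {g. push \<kappa> g \<in> initial_ideal w ?I}"
    proof (rule initial_ideal_minimal)
      show "ring_ideal {g. push \<kappa> g \<in> initial_ideal w ?I}"
        using ideal by (auto simp: ring_ideal_def push_add push_mult[of \<kappa>, OF \<kappa>_add])
      fix f assume "f \<in> ?J"
      then have "initial_form w (push \<kappa> f) \<in> initial_ideal w ?I"
        by (intro initial_ideal_incl push_I)
      then show "initial_form w' f \<in> {g. push \<kappa> g \<in> initial_ideal w ?I}"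
        using initial_form_push[of \<kappa> w w' f] \<kappa>_inj by (simp add: w zpair_phi \<kappa>)
    qed
    then have "Poly_Mapping.single (\<kappa> b) 1 \<in> initial_ideal w ?I" using b by (auto simp: push_single)
    then show "\<exists>a. Poly_Mapping.single a 1 \<in> initial_ideal w ?I" by blast
  next
    assume "\<exists>a. Poly_Mapping.single a 1 \<in> initial_ideal w ?I"
    then obtain a where a: "Poly_Mapping.single a 1 \<in> initial_ideal w ?I" by blast
    have ideal: "ring_ideal (initial_ideal w' ?J)" by (rule ring_ideal_initial_ideal)
    have "initial_ideal w ?I \<subseteq> {F. \<forall>u. slice H u F \<in> initial_ideal w' ?J}"
    proof (rule initial_ideal_minimal)
      have "slice H u (G * F) \<in> initial_ideal w' ?J"
        if F: "\<forall>u. slice H u F \<in> initial_ideal w' ?J" for F G u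
      proof -
        have "slice H u (G * F) = (\<Sum>b\<in>Poly_Mapping.keys G.
            Poly_Mapping.single (Z_part H b) (Poly_Mapping.lookup G b) * slice H (u - M_part H b) F)"
          by (subst poly_mapping_expansion[of G])
            (simp add: sum_distrib_right slice_sum slice_mult_single)
        then show ?thesis using ideal F by (auto simp: ring_ideal_def intro!: ring_ideal_sum)
      qed
      then show "ring_ideal {F. \<forall>u. slice H u F \<in> initial_ideal w' ?J}"
        using ideal by (auto simp: ring_ideal_def slice_add)
      fix f assume "f \<in> ?I"
      then have "slice H u f \<in> ?J" for u
        using H unfolding X by (intro slice_vanishing[where r = r] Y)
      then show "initial_form w f \<in> {F. \<forall>u. slice H u F \<in> initial_ideal w' ?J}"
        using slice_initial_form[OF w, of _ f] initial_ideal_incl[of _ ?J w'] ideal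
        by (auto simp: ring_ideal_def) (metis empty_iff insert_iff)
    qed
    then have "slice H (M_part H a) (Poly_Mapping.single a 1) \<in> initial_ideal w' ?J" using a by blast
    then show "\<exists>b. Poly_Mapping.single b 1 \<in> initial_ideal w' ?J" by (auto simp: slice_single)
  qed
  \<comment> \<open>A relation \<open>a\<close> among the exponents of nonzero weight, say negative, makes \<open>x\<^sup>a\<close> the initial form
     of \<open>x\<^sup>a - 1\<close>.  A weight that kills all relations is the pairing with its values on preimages of a
     basis.\<close>
  have in_range: "\<exists>n\<in>coords r. \<exists>w'. w = phi H (n, w')" if w: "w \<in> Trop X" for w
  proof -
    have neg: False if a: "M_part H a = 0" "Z_part H a = 0" "zpair w a < 0" for a
    proof -
      let ?f = "Poly_Mapping.single a 1 - Poly_Mapping.single 0 1 :: ('k, 'h) laurent"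
      have "laurent_eval ?f x = 0" if x: "x \<in> X" for x
      proof -
        obtain t z where "x = monomial_map r H t z" "\<And>i. t i \<noteq> 0" "z \<in> Y" using x X by blast
        then have "zpower x a = 1" using zpower_monomial_map[of t z r H a] Y a by auto
        moreover have "laurent_eval ?f x + laurent_eval (Poly_Mapping.single 0 1) x
            = laurent_eval (Poly_Mapping.single a 1) x" by (simp flip: laurent_eval_add)
        moreover have "laurent_eval (Poly_Mapping.single 0 1) x = 1"
          unfolding laurent_eval_single by simp
        ultimately show ?thesis by (simp add: laurent_eval_single)
      qed
      then have "initial_form w ?f \<in> initial_ideal w ?I"
        by (intro initial_ideal_incl) (simp add: vanishing_ideal_def)
      moreover have "initial_form w ?f = Poly_Mapping.single a 1"
      proof (rule poly_mapping_eqI)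
        fix b
        have "a \<noteq> 0" using a by auto
        then have "Poly_Mapping.keys ?f = {a, 0}"
          by (auto simp: in_keys_iff lookup_minus lookup_single lookup_one when_def split: if_splits)
        then show "Poly_Mapping.lookup (initial_form w ?f) b
            = Poly_Mapping.lookup (Poly_Mapping.single a 1) b"
          using a \<open>a \<noteq> 0\<close>
          by (auto simp: lookup_initial_form lookup_minus lookup_single lookup_one when_def)
      qed
      ultimately show False using w by (auto simp: Trop_def)
    qed
    have zero: "zpair w a = 0" if "M_part H a = 0" "Z_part H a = 0" for a
      using neg[of a] neg[of "- a"] that by (force simp: M_part_minus Z_part_minus)
    define n where "n = (\<Sum>i<r. Poly_Mapping.single i (zpair w (kM i)))"
    define w' where "w' = (\<chi> i. zpair w (kZ i))"
    have n: "n \<in> coords r" unfolding n_def by (intro coords_sum coords_single) simp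
    have n_lookup: "Poly_Mapping.lookup n i = zpair w (kM i)" if "i < r" for i
      using that by (simp add: n_def lookup_sum lookup_single when_def)
    have "w = phi H (n, w')"
      unfolding vec_eq_iff
    proof
      fix j
      define a where "a = axis j 1 + - ((\<Sum>i<r. Poly_Mapping.lookup (fst (H j)) i *s kM i)
          + (\<Sum>i\<in>UNIV. (snd (H j) $ i) *s kZ i))"
      have "M_part H a = 0"
      proof (rule poly_mapping_eqI)
        fix k
        have "(\<Sum>i<r. Poly_Mapping.lookup (fst (H j)) i * Poly_Mapping.lookup (M_part H (kM i)) k)
            = Poly_Mapping.lookup (fst (H j)) k"
          using H[of j] by (auto simp: kM lookup_single when_def coords_iff if_distrib[of "(*) _"] cong: if_cong)
        then show "Poly_Mapping.lookup (M_part H a) k = Poly_Mapping.lookup 0 k"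
          unfolding a_def M_part_add M_part_minus M_part_sum M_part_scale M_part_axis kZ
          by (simp add: lookup_add lookup_sum lookup_minus)
      qed
      moreover have "Z_part H a = 0"
        unfolding a_def Z_part_add Z_part_minus Z_part_sum Z_part_scale Z_part_axis kZ
        by (simp add: kM vec_eq_iff axis_def if_distrib[of "(*) _"] cong: if_cong)
      ultimately have "zpair w a = 0" by (rule zero)
      then have "w $ j = (\<Sum>i<r. of_int (Poly_Mapping.lookup (fst (H j)) i) * zpair w (kM i))
          + (\<Sum>i\<in>UNIV. of_int (snd (H j) $ i) * zpair w (kZ i))"
        unfolding a_def zpair_add_right zpair_minus_right zpair_sum_right zpair_scale_right
          zpair_axis_right by simp
      also have "\<dots> = npair n (fst (H j)) + zpair w' (snd (H j))"
        unfolding zpair_def[of w'] by (simp add: npair_coords[OF n] n_lookup w'_def mult.commute)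
      finally show "w $ j = phi H (n, w') $ j" by (simp add: phi_def)
    qed
    then show ?thesis using n by blast
  qed
  have eq: "phi H (n, w') \<in> Trop X \<longleftrightarrow> w' \<in> Trop Y" for n w'
    using same[OF refl, of n w'] by (auto simp: Trop_def)
  show ?thesis
  proof (intro equalityI subsetI)
    fix w assume "w \<in> Trop X"
    then show "w \<in> phi H ` (coords r \<times> Trop Y)" using in_range[of w] eq by blast
  next
    fix w assume "w \<in> phi H ` (coords r \<times> Trop Y)"
    then show "w \<in> Trop X" using eq by auto
  qed
qed

section \<open>The linear map \<phi>\<close>

lemma lookup_scaleR [simp]:
  "Poly_Mapping.lookup (c *\<^sub>R x) i = c *\<^sub>R Poly_Mapping.lookup (x :: 'a \<Rightarrow>\<^sub>0 'b::real_vector) i"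
proof -
  have "finite {i. c *\<^sub>R Poly_Mapping.lookup x i \<noteq> 0}"
    by (rule finite_subset[OF _ finite_lookup[of x]]) auto
  then show ?thesis by (simp add: scaleR_poly_mapping_def)
qed

lemma scaleR_eq_scale: "c *\<^sub>R x = Poly_Mapping.map ((*) c) x" for x :: "nat \<Rightarrow>\<^sub>0 real"
  by (rule poly_mapping_eqI) simp

lemma linear_phi:
  fixes H :: "'h::finite \<Rightarrow> (nat \<Rightarrow>\<^sub>0 int) \<times> (int ^ 'm::finite)"
  shows "linear (phi H)"
proof (rule linearI)
  have "zpair (c *\<^sub>R w) v = c * zpair w v" for c and w :: "real ^ 'm" and v
    by (simp add: zpair_def sum_distrib_left mult.assoc)
  then show "phi H (c *\<^sub>R x) = c *\<^sub>R phi H x" for c x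
    by (simp add: phi_def vec_eq_iff scaleR_eq_scale npair_scale_left distrib_left)
qed (simp add: phi_def vec_eq_iff npair_add_left zpair_add_left)

text \<open>
  By duality: \<open>phi H x\<close> determines the pairing of \<open>x\<close> with every element of the lattice generated by the
  exponents.
\<close>

lemma inj_on_phi:
  assumes "\<And>u v. u \<in> coords r \<Longrightarrow> \<exists>a. M_part H a = u \<and> Z_part H a = v"
  shows "inj_on (phi H) (coords r \<times> UNIV)"
proof (rule inj_onI)
  fix x y assume xy: "x \<in> coords r \<times> UNIV" "y \<in> coords r \<times> UNIV" and eq: "phi H x = phi H y"
  have *: "npair (fst x) u + zpair (snd x) v = npair (fst y) u + zpair (snd y) v" if "u \<in> coords r" for u v
    using assms[OF that, of v] eq zpair_phi by metis
  have "Poly_Mapping.lookup (fst x) i = Poly_Mapping.lookup (fst y) i" for i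
  proof (cases "i < r")
    case True
    then show ?thesis using *[OF coords_single[of i r 1], of 0] by (simp add: npair_single_right)
  qed (use xy in \<open>auto simp: coords_iff\<close>)
  moreover have "snd x $ i = snd y $ i" for i
    using *[of 0 "axis i 1"] by (simp add: zpair_axis_right)
  ultimately show "x = y" by (intro prod_eqI poly_mapping_eqI) (auto simp: vec_eq_iff)
qed

lemma coords_eq_span: "coords r = span ((\<lambda>i. Poly_Mapping.single i (1::real)) ` {..<r})"
  and independent_singles: "independent ((\<lambda>i. Poly_Mapping.single i (1::real)) ` {..<r})"
proof -
  let ?B = "(\<lambda>i. Poly_Mapping.single i (1::real)) ` {..<r}"
  have inj: "inj_on (\<lambda>i. Poly_Mapping.single i (1::real)) {..<r}"
    by (rule inj_onI) (metis lookup_single_eq lookup_single_not_eq zero_neq_one)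
  have "subspace (coords r :: (nat \<Rightarrow>\<^sub>0 real) set)"
    by (simp add: subspace_def scaleR_eq_scale)
  then have "span ?B \<subseteq> coords r" by (intro span_minimal) (auto simp: coords_single)
  moreover have "v \<in> span ?B" if "v \<in> coords r" for v
  proof -
    have single: "Poly_Mapping.single i c = c *\<^sub>R Poly_Mapping.single i 1" for i and c :: real
      by (rule poly_mapping_eqI) (simp add: lookup_single when_def)
    have "v = (\<Sum>i<r. Poly_Mapping.lookup v i *\<^sub>R Poly_Mapping.single i 1)"
      using coords_expansion[OF that] unfolding single[of _ "Poly_Mapping.lookup v _"] .
    also have "\<dots> \<in> span ?B" by (intro span_sum span_scale span_base) auto
    finally show ?thesis .
  qed
  ultimately show "coords r = span ?B" by blast
  show "independent ?B"
  proof
    assume "dependent ?B"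
    then obtain c v where c: "v \<in> ?B" "c v \<noteq> 0" "(\<Sum>v\<in>?B. c v *\<^sub>R v) = 0"
      by (auto simp: dependent_finite)
    obtain k where k: "k < r" "v = Poly_Mapping.single k 1" using c by blast
    have "Poly_Mapping.lookup (\<Sum>v\<in>?B. c v *\<^sub>R v) k = c v"
      using k by (simp add: sum.reindex[OF inj] lookup_sum lookup_single when_def
          if_distrib[of "(*) _"] cong: if_cong)
    then show False using c by simp
  qed
qed

lemma dim_phi_image:
  fixes H :: "'h::finite \<Rightarrow> (nat \<Rightarrow>\<^sub>0 int) \<times> (int ^ 'm::finite)"
  assumes "inj_on (phi H) (coords r \<times> UNIV)"
  shows "dim ((\<lambda>n. phi H (n, 0)) ` coords r) = r" "subspace ((\<lambda>n. phi H (n, 0)) ` coords r)"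
proof -
  let ?f = "\<lambda>n. phi H (n, 0)" and ?B = "(\<lambda>i. Poly_Mapping.single i (1::real)) ` {..<r}"
  have "linear (\<lambda>n :: nat \<Rightarrow>\<^sub>0 real. (n, 0 :: real ^ 'm))" by (rule linearI) auto
  from linear_compose[OF this linear_phi] have lin: "linear ?f" by (simp add: o_def)
  have inj: "inj_on ?f (coords r)" using assms by (auto simp: inj_on_def)
  show "subspace (?f ` coords r)"
    unfolding coords_eq_span by (intro linear_subspace_image[OF lin] subspace_span)
  have "independent (?f ` ?B)"
    using inj unfolding coords_eq_span
    by (intro linear_independent_injective_image[OF lin independent_singles])
  moreover have "?f ` coords r = span (?f ` ?B)"
    unfolding coords_eq_span using linear_span_image[OF lin] by blast
  moreover have "card (?f ` ?B) = r"
  proof -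
    have "inj_on ?f ?B" by (rule inj_on_subset[OF inj]) (auto simp: coords_single)
    moreover have "inj_on (\<lambda>i. Poly_Mapping.single i (1::real)) {..<r}"
      by (rule inj_onI) (metis lookup_single_eq lookup_single_not_eq zero_neq_one)
    ultimately show ?thesis by (simp add: card_image)
  qed
  ultimately show "dim (?f ` coords r) = r" by (simp add: dim_eq_card_independent)
qed

theorem proposition4p5:
  fixes r :: nat
    and \<sigma> :: "(nat \<Rightarrow>\<^sub>0 rat) set"
    and \<Delta> :: "'m::finite option \<Rightarrow> (nat \<Rightarrow>\<^sub>0 rat) set"
    and W :: "('k::alg_closed_field ^ ('m option)) set"
    and p q :: "'k ^ ('m option)"
    and H :: "'h::finite \<Rightarrow> (nat \<Rightarrow>\<^sub>0 int) \<times> (int ^ 'm)"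
  assumes "polyhedral_cone r \<sigma>" and "pointed \<sigma>"
    and "\<And>i. \<Delta> i = {} \<or> (rat_polyhedron r (\<Delta> i) \<and> tailcone r (\<Delta> i) = \<sigma>)"
    and "minkowski_sum \<Delta> \<subset> \<sigma>"
    and "proj_line W" and "meets_torus W"
    and "p \<noteq> q" and "vec.independent {p, q}" and "W = vec.span {p, q}"
    and "inj H"
    and "submonoid hull (range H) = weight_semigroup r (cone_C \<sigma> \<Delta>)"
  shows "linear (phi H) \<and> inj_on (phi H) (coords r \<times> UNIV) \<and>
    Trop (X_L r \<sigma> \<Delta> p q H \<inter> torus) = phi H ` (coords r \<times> Trop (line_torus_part W)) \<and>
    (\<exists>(P :: (real ^ 'h) set) (\<Gamma> :: (real ^ 'm) set) \<psi>.
       subspace P \<and> dim P = r \<and> tropical_line TYPE('k) \<Gamma> \<and>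
       linear \<psi> \<and> inj \<psi> \<and> P \<inter> range \<psi> = {0} \<and>
       Trop (X_L r \<sigma> \<Delta> p q H \<inter> torus) = {x + \<psi> g | x g. x \<in> P \<and> g \<in> \<Gamma>})"
proof -
  let ?S = "weight_semigroup r (cone_C \<sigma> \<Delta>)"
  have gen: "\<exists>s\<in>?S. g + s \<in> ?S" if "g \<in> coords r \<times> UNIV" for g
    using weight_semigroup_generates[OF assms(1-4), of "fst g" "snd g"] that by (auto simp: mem_Times_iff)
  have y: "p $ i \<noteq> 0 \<or> q $ i \<noteq> 0" for i
    using y_on_L_nonzero[OF assms(6,9)] .
  have S_H0: "u \<in> coords r \<inter> dual_lattice_cone r \<sigma> \<and> z_monomial p q v \<in> H0 (divisor_at p q \<Delta> u)"
    if "(u, v) \<in> ?S" for u v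
  proof -
    have "z_monomial p q v \<in> H0 (divisor_at p q \<Delta> u)"
      by (rule z_monomial_in_H0[OF y _ that]) (use assms(3) in blast)
    then show ?thesis
      using weight_semigroup_coneD(1)[OF that] that by (auto simp: weight_semigroup_def)
  qed
  have X: "X_L r \<sigma> \<Delta> p q H \<inter> torus
      = {monomial_map r H t z | t z. (\<forall>i. t i \<noteq> 0) \<and> z \<in> line_torus_part W}"
    unfolding monomial_map_def
    by (rule X_L_torus[OF assms(9,6,7,8) submonoid_weight_semigroup assms(11) S_H0 gen])
  have range_H: "H j \<in> ?S" for j
    using assms(11) hull_subset[of "range H" submonoid] by auto
  have gen_H: "\<exists>a. M_part H a = u \<and> Z_part H a = v" if "u \<in> coords r" for u v
    using exponents_generate[OF assms(11) gen[of "(u, v)"]] that by simp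
  have "line_torus_part W \<subseteq> torus" by (auto simp: line_torus_part_def torus_def)
  moreover have "fst (H j) \<in> coords r" for j
    using range_H[of j] by (auto simp: weight_semigroup_def)
  ultimately have Trop: "Trop (X_L r \<sigma> \<Delta> p q H \<inter> torus) = phi H ` (coords r \<times> Trop (line_torus_part W))"
    by (rule Trop_monomial_image[OF _ _ gen_H X])
  have inj: "inj_on (phi H) (coords r \<times> UNIV)" by (rule inj_on_phi[OF gen_H])
  define P where "P = (\<lambda>n. phi H (n, 0)) ` coords r"
  define \<psi> where "\<psi> w = phi H (0, w)" for w
  have split: "phi H (n, 0) + \<psi> w = phi H (n, w)" for n w
    using linear_add[OF linear_phi, of H "(n, 0)" "(0, w)"] by (simp add: \<psi>_def)
  have "{x + \<psi> g | x g. x \<in> P \<and> g \<in> Trop (line_torus_part W)}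
      = {phi H (n, 0) + \<psi> w | n w. n \<in> coords r \<and> w \<in> Trop (line_torus_part W)}"
    unfolding P_def by blast
  also have "\<dots> = phi H ` (coords r \<times> Trop (line_torus_part W))"
    unfolding split by auto
  finally have "phi H ` (coords r \<times> Trop (line_torus_part W))
      = {x + \<psi> g | x g. x \<in> P \<and> g \<in> Trop (line_torus_part W)}" ..
  moreover have "linear \<psi>"
  proof -
    have "linear (\<lambda>w :: real ^ 'm. (0 :: nat \<Rightarrow>\<^sub>0 real, w))" by (rule linearI) auto
    from linear_compose[OF this linear_phi] show ?thesis by (simp add: \<psi>_def[abs_def] o_def)
  qed
  moreover have "inj \<psi>"
    using inj by (auto simp: \<psi>_def inj_on_def)
  moreover have "P \<inter> range \<psi> = {0}"
  proof -
    have phi0: "phi H (0, 0) = 0" by (simp add: phi_def vec_eq_iff)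
    have "x = 0" if "x \<in> P" "x \<in> range \<psi>" for x
    proof -
      from that(1) obtain n where n: "n \<in> coords r" "x = phi H (n, 0)" unfolding P_def by blast
      from that(2) obtain w where w: "x = phi H (0, w)" unfolding \<psi>_def by blast
      have "(n, 0) = (0, w)" by (rule inj_onD[OF inj]) (use n w in auto)
      then show ?thesis using n(2) phi0 by simp
    qed
    moreover have "0 \<in> P" "0 \<in> range \<psi>"
      using phi0 by (auto simp: P_def \<psi>_def image_iff)
    ultimately show ?thesis by blast
  qed
  moreover have "tropical_line TYPE('k) (Trop (line_torus_part W))"
    unfolding tropical_line_def using assms(5,6) by blast
  moreover have "subspace P" "dim P = r"
    unfolding P_def using dim_phi_image[OF inj] by simp_all
  ultimately have "subspace P \<and> dim P = r \<and> tropical_line TYPE('k) (Trop (line_torus_part W)) \<and>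
      linear \<psi> \<and> inj \<psi> \<and> P \<inter> range \<psi> = {0} \<and> Trop (X_L r \<sigma> \<Delta> p q H \<inter> torus)
        = {x + \<psi> g | x g. x \<in> P \<and> g \<in> Trop (line_torus_part W)}"
    unfolding Trop by (intro conjI)
  then show ?thesis
    by (intro conjI linear_phi inj Trop)
      (intro exI[of _ P] exI[of _ "Trop (line_torus_part W)"] exI[of _ \<psi>])
qed

end
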